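(* Let $\mathcal{A},\mathcal{B}$ be $\Bbbk$-linear categories and assume that all hom spaces in $\mathcal{A}$ are projective over $\Bbbk$. Let $F,G\colon\mathcal{A}\to\mathrm{Ch}^b(\mathcal{B})$ be an unobstructed pair of dg functors, i.e. $H^k(\underline{\mathrm{Hom}}_{\mathcal{B}}(F(X'),G(X)))=0$ for all $k<0$ and all $X,X'\in\mathcal{A}$, and let $H^0(F),H^0(G)\colon\mathcal{A}\to\mathcal{K}^b(\mathcal{B})$ denote the induced functors. Then any natural transformation $H^0(F)\to H^0(G)$ extends to a unique-up-to-homotopy $A_\infty$-natural transformation $\mathrm{Bar}_{\mathcal{A}}\to M^G_F$ (closed, of degree zero).
   Context: $\Bbbk$ is a commutative ring. $\mathrm{Ch}^b(\mathcal{B})$ is the dg category of bounded cochain complexes with $\underline{\mathrm{Hom}}^k(X,Y)=\prod_i\mathrm{Hom}(X^i,Y^{i+k})$, $d(f)=\delta_Yf-(-1)^{|f|}f\delta_X$; $\mathcal{K}^b(\mathcal{B})=H^0(\mathrm{Ch}^b(\mathcal{B}))$. $\mathcal{A}$ is regarded as a dg category in degree $0$ with zero differential, so a dg functor $\mathcal{A}\to\mathrm{Ch}^b(\mathcal{B})$ is a $\Bbbk$-linear functor to complexes and chain maps. An $(\mathcal{A},\mathcal{A})$-bimodule $B$ is a family of complexes $B(X,Y)$ of $\Bbbk$-modules with unital associative action maps $\mathrm{Hom}(X,X')\otimes B(X,Y)\otimes\mathrm{Hom}(Y',Y)\to B(X',Y')$, $f\otimes b\otimes g\mapsto f\cdot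 b\cdot g$. A degree $l$ bimodule map $\phi\colon B_1\to B_2$ is a family of degree $l$ $\Bbbk$-linear maps with $\phi(f\cdot b\cdot g)=(-1)^{l|f|}f\cdot\phi(b)\cdot g$; these form a complex. $M^G_F(X,X')=\underline{\mathrm{Hom}}(F(X'),G(X))$ with $a\cdot m\cdot b=G(a)\circ m\circ F(b)$. $\mathrm{Bar}_{\mathcal{A}}(X,X')=\bigoplus_{r\ge0}\bigoplus_{X_0,\dots,X_r\in\mathcal{A}}\mathrm{Hom}(X_0,X)\otimes\mathrm{Hom}(X_1,X_0)\otimes\cdots\otimes\mathrm{Hom}(X',X_r)$ with the $r$-summand in degree $-r$, elements written $[f_0,\dots,f_{r+1}]$, differential $[f_0,\dots,f_{r+1}]\mapsto\sum_{i=0}^r(-1)^i[\dots,f_i\circ f_{i+1},\dots]$ (zero for $r=0$), and bimodule structure by composition in the first and last slots. An $A_\infty$-natural transformation $F\to G$ of degree $l$ is a degree $l$ bimodule map $\boldsymbol\tau\colon\mathrm{Bar}_{\mathcal{A}}\to M^G_F$. A closed degree-zero one extends a natural transformation $\eta\colon H^0(F)\to H^0(G)$ if $\boldsymbol\tau([\mathrm{id}_X,\mathrm{id}_X])$ represents $\eta_X$ for all $X\in\mathcal{A}$. Two are homotopic if their difference is exact in the complex of bimodule maps. *)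

theory Defs
  imports "HOL-Algebra.Module" "HOL-Algebra.AbelCoset"
begin

section \<open>Modules\<close>

text \<open>The record type \<^typ>\<open>('k, 'm) module\<close> of the library inherits a multiplication and a unit
  from rings; they play no role for modules and are left unspecified.\<close>

definition module_of ::
    "'m set \<Rightarrow> 'm \<Rightarrow> ('m \<Rightarrow> 'm \<Rightarrow> 'm) \<Rightarrow> ('k \<Rightarrow> 'm \<Rightarrow> 'm) \<Rightarrow> ('k, 'm) module" where
  "module_of U z p s =
     \<lparr>carrier = U, mult = (\<lambda>_. undefined), one = undefined, zero = z, add = p, smult = s\<rparr>"

definition module_hom :: "'k ring \<Rightarrow> ('k, 'm) module \<Rightarrow> ('k, 'n) module \<Rightarrow> ('m \<Rightarrow> 'n) set" where
  "module_hom R M N =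
     {h. h \<in> carrier M \<rightarrow> carrier N \<and>
         (\<forall>x\<in>carrier M. \<forall>y\<in>carrier M. h (x \<oplus>\<^bsub>M\<^esub> y) = h x \<oplus>\<^bsub>N\<^esub> h y) \<and>
         (\<forall>a\<in>carrier R. \<forall>x\<in>carrier M. h (a \<odot>\<^bsub>M\<^esub> x) = a \<odot>\<^bsub>N\<^esub> h x)}"

definition submodule_span :: "'k ring \<Rightarrow> ('k, 'm) module \<Rightarrow> 'm set \<Rightarrow> 'm set" where
  "submodule_span R M S = \<Inter>{N. submodule N R M \<and> S \<subseteq> N}"

definition quotient_module :: "('k, 'm) module \<Rightarrow> 'm set \<Rightarrow> ('k, 'm set) module" where
  "quotient_module M N =
     module_of (a_rcosets\<^bsub>M\<^esub> N) N (\<lambda>C D. C <+>\<^bsub>M\<^esub> D) (\<lambda>a C. \<Union>x\<in>C. N +>\<^bsub>M\<^esub> (a \<odot>\<^bsub>M\<^esub> x))"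

definition direct_sum :: "'i set \<Rightarrow> ('i \<Rightarrow> ('k, 'm) module) \<Rightarrow> ('k, 'i \<Rightarrow> 'm) module" where
  "direct_sum I M =
     module_of {x \<in> \<Pi>\<^sub>E i\<in>I. carrier (M i). finite {i \<in> I. x i \<noteq> \<zero>\<^bsub>M i\<^esub>}}
       (\<lambda>i\<in>I. \<zero>\<^bsub>M i\<^esub>) (\<lambda>x y. \<lambda>i\<in>I. x i \<oplus>\<^bsub>M i\<^esub> y i) (\<lambda>a x. \<lambda>i\<in>I. a \<odot>\<^bsub>M i\<^esub> x i)"

definition sum_inj :: "'i set \<Rightarrow> ('i \<Rightarrow> ('k, 'm) module) \<Rightarrow> 'i \<Rightarrow> 'm \<Rightarrow> 'i \<Rightarrow> 'm" where
  "sum_inj I M i x = (\<lambda>j\<in>I. if j = i then x else \<zero>\<^bsub>M j\<^esub>)"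

definition direct_product :: "('i \<Rightarrow> ('k, 'm) module) \<Rightarrow> ('k, 'i \<Rightarrow> 'm) module" where
  "direct_product M =
     module_of {x. \<forall>i. x i \<in> carrier (M i)}
       (\<lambda>i. \<zero>\<^bsub>M i\<^esub>) (\<lambda>x y i. x i \<oplus>\<^bsub>M i\<^esub> y i) (\<lambda>a x i. a \<odot>\<^bsub>M i\<^esub> x i)"

definition self_module :: "'k ring \<Rightarrow> ('k, 'k) module" where
  "self_module R = module_of (carrier R) \<zero>\<^bsub>R\<^esub> (\<lambda>x y. x \<oplus>\<^bsub>R\<^esub> y) (\<lambda>a x. a \<otimes>\<^bsub>R\<^esub> x)"

definition free_module :: "'k ring \<Rightarrow> 's set \<Rightarrow> ('k, 's \<Rightarrow> 'k) module" where
  "free_module R S = direct_sum S (\<lambda>_. self_module R)"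

definition free_gen :: "'k ring \<Rightarrow> 's set \<Rightarrow> 's \<Rightarrow> 's \<Rightarrow> 'k" where
  "free_gen R S s = sum_inj S (\<lambda>_. self_module R) s \<one>\<^bsub>R\<^esub>"

text \<open>Projectivity is the lifting property against surjections \<open>g : N \<rightarrow> Q\<close>. In HOL the element
  types of \<open>N\<close> and \<open>Q\<close> have to be fixed; the chosen ones already accommodate the canonical surjection
  from the free module on \<^term>\<open>carrier P\<close> onto \<open>P\<close>. A splitting of it makes \<open>P\<close> a direct summand of a
  free module and hence yields the lifting property against arbitrary modules.\<close>

definition projective_module :: "'k ring \<Rightarrow> ('k, 'p) module \<Rightarrow> bool" where
  "projective_module R P \<longleftrightarrow> module R P \<and>
     (\<forall>(N :: ('k, 'p \<Rightarrow> 'k) module) (Q :: ('k, 'p) module) g f.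
        module R N \<and> module R Q \<and>
        g \<in> module_hom R N Q \<and> g ` carrier N = carrier Q \<and> f \<in> module_hom R P Q \<longrightarrow>
        (\<exists>h \<in> module_hom R P N. \<forall>x\<in>carrier P. g (h x) = f x))"

text \<open>The tensor product over \<open>R\<close> of a finite list of modules: the free module on the lists of
  elements, modulo multilinearity in every slot.\<close>

definition tensor_words :: "('k, 'm) module list \<Rightarrow> 'm list set" where
  "tensor_words Ms = {fs. list_all2 (\<lambda>f M. f \<in> carrier M) fs Ms}"

definition tensor_relations :: "'k ring \<Rightarrow> ('k, 'm) module list \<Rightarrow> ('m list \<Rightarrow> 'k) set" where
  "tensor_relations R Ms =
     (let W = tensor_words Ms; L = free_module R W; e = free_gen R W in
        {e (fs[i := x \<oplus>\<^bsub>Ms ! i\<^esub> y]) \<ominus>\<^bsub>L\<^esub> (e (fs[i := x]) \<oplus>\<^bsub>L\<^esub> e (fs[i := y])) | fs i x y.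
           fs \<in> W \<and> i < length Ms \<and> x \<in> carrier (Ms ! i) \<and> y \<in> carrier (Ms ! i)} \<union>
        {e (fs[i := a \<odot>\<^bsub>Ms ! i\<^esub> x]) \<ominus>\<^bsub>L\<^esub> (a \<odot>\<^bsub>L\<^esub> e (fs[i := x])) | fs i a x.
           fs \<in> W \<and> i < length Ms \<and> a \<in> carrier R \<and> x \<in> carrier (Ms ! i)})"

definition tensor_kernel :: "'k ring \<Rightarrow> ('k, 'm) module list \<Rightarrow> ('m list \<Rightarrow> 'k) set" where
  "tensor_kernel R Ms = submodule_span R (free_module R (tensor_words Ms)) (tensor_relations R Ms)"

definition tensor_product ::
    "'k ring \<Rightarrow> ('k, 'm) module list \<Rightarrow> ('k, ('m list \<Rightarrow> 'k) set) module" where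
  "tensor_product R Ms =
     quotient_module (free_module R (tensor_words Ms)) (tensor_kernel R Ms)"

definition pure_tensor ::
    "'k ring \<Rightarrow> ('k, 'm) module list \<Rightarrow> 'm list \<Rightarrow> ('m list \<Rightarrow> 'k) set" where
  "pure_tensor R Ms fs =
     tensor_kernel R Ms +>\<^bsub>free_module R (tensor_words Ms)\<^esub> free_gen R (tensor_words Ms) fs"


section \<open>Cochain complexes of modules\<close>

record ('k, 'e) mod_complex =
  grade :: "int \<Rightarrow> ('k, 'e) module"
  diff :: "int \<Rightarrow> 'e \<Rightarrow> 'e"

text \<open>\<open>signed M n x\<close> is $(-1)^n x$.\<close>

definition signed :: "('k, 'e) module \<Rightarrow> int \<Rightarrow> 'e \<Rightarrow> 'e" where
  "signed M n x = (if even n then x else \<ominus>\<^bsub>M\<^esub> x)"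

definition cocycles :: "('k, 'e) mod_complex \<Rightarrow> int \<Rightarrow> ('k, 'e) module" where
  "cocycles C n =
     (grade C n)\<lparr>carrier := {x \<in> carrier (grade C n). diff C n x = \<zero>\<^bsub>grade C (n + 1)\<^esub>}\<rparr>"

definition coboundaries :: "('k, 'e) mod_complex \<Rightarrow> int \<Rightarrow> 'e set" where
  "coboundaries C n = diff C (n - 1) ` carrier (grade C (n - 1))"

definition cohomology :: "('k, 'e) mod_complex \<Rightarrow> int \<Rightarrow> ('k, 'e set) module" where
  "cohomology C n = quotient_module (cocycles C n) (coboundaries C n)"

definition coh_class :: "('k, 'e) mod_complex \<Rightarrow> int \<Rightarrow> 'e \<Rightarrow> 'e set" where
  "coh_class C n x = coboundaries C n +>\<^bsub>cocycles C n\<^esub> x"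


section \<open>Linear categories\<close>

text \<open>\<open>Mor C X Y\<close> is the module of morphisms from \<open>X\<close> to \<open>Y\<close>, and \<open>Comp C X Y Z g f\<close> is \<open>g \<circ> f\<close>
  for \<open>f : X \<rightarrow> Y\<close> and \<open>g : Y \<rightarrow> Z\<close>. Morphism modules of distinct pairs of objects may overlap, which
  is why composition carries the objects.\<close>

record ('o, 'k, 'm) lin_cat =
  Ob :: "'o set"
  Mor :: "'o \<Rightarrow> 'o \<Rightarrow> ('k, 'm) module"
  Comp :: "'o \<Rightarrow> 'o \<Rightarrow> 'o \<Rightarrow> 'm \<Rightarrow> 'm \<Rightarrow> 'm"
  Ident :: "'o \<Rightarrow> 'm"

locale linear_category =
  fixes R :: "'k ring" and C :: "('o, 'k, 'm) lin_cat"
  assumes base_ring: "cring R"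
    and mor_module: "\<lbrakk>X \<in> Ob C; Y \<in> Ob C\<rbrakk> \<Longrightarrow> module R (Mor C X Y)"
    and comp_linear_left:
      "\<lbrakk>X \<in> Ob C; Y \<in> Ob C; Z \<in> Ob C; f \<in> carrier (Mor C X Y)\<rbrakk> \<Longrightarrow>
         (\<lambda>g. Comp C X Y Z g f) \<in> module_hom R (Mor C Y Z) (Mor C X Z)"
    and comp_linear_right:
      "\<lbrakk>X \<in> Ob C; Y \<in> Ob C; Z \<in> Ob C; g \<in> carrier (Mor C Y Z)\<rbrakk> \<Longrightarrow>
         (\<lambda>f. Comp C X Y Z g f) \<in> module_hom R (Mor C X Y) (Mor C X Z)"
    and comp_assoc:
      "\<lbrakk>W \<in> Ob C; X \<in> Ob C; Y \<in> Ob C; Z \<in> Ob C;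
        f \<in> carrier (Mor C W X); g \<in> carrier (Mor C X Y); h \<in> carrier (Mor C Y Z)\<rbrakk> \<Longrightarrow>
         Comp C W X Z (Comp C X Y Z h g) f = Comp C W Y Z h (Comp C W X Y g f)"
    and ident_closed: "X \<in> Ob C \<Longrightarrow> Ident C X \<in> carrier (Mor C X X)"
    and comp_ident_left:
      "\<lbrakk>X \<in> Ob C; Y \<in> Ob C; f \<in> carrier (Mor C X Y)\<rbrakk> \<Longrightarrow> Comp C X Y Y (Ident C Y) f = f"
    and comp_ident_right:
      "\<lbrakk>X \<in> Ob C; Y \<in> Ob C; f \<in> carrier (Mor C X Y)\<rbrakk> \<Longrightarrow> Comp C X X Y f (Ident C X) = f"

record ('o, 'm, 'p, 'n) lin_functor =
  fobj :: "'o \<Rightarrow> 'p"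
  fmor :: "'o \<Rightarrow> 'o \<Rightarrow> 'm \<Rightarrow> 'n"

definition is_linear_functor ::
    "'k ring \<Rightarrow> ('o, 'k, 'm) lin_cat \<Rightarrow> ('p, 'k, 'n) lin_cat \<Rightarrow> ('o, 'm, 'p, 'n) lin_functor \<Rightarrow> bool"
  where
  "is_linear_functor R C D F \<longleftrightarrow>
     (\<forall>X\<in>Ob C. fobj F X \<in> Ob D) \<and>
     (\<forall>X\<in>Ob C. \<forall>Y\<in>Ob C. fmor F X Y \<in> module_hom R (Mor C X Y) (Mor D (fobj F X) (fobj F Y))) \<and>
     (\<forall>X\<in>Ob C. \<forall>Y\<in>Ob C. \<forall>Z\<in>Ob C. \<forall>f\<in>carrier (Mor C X Y). \<forall>g\<in>carrier (Mor C Y Z).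
        fmor F X Z (Comp C X Y Z g f) =
        Comp D (fobj F X) (fobj F Y) (fobj F Z) (fmor F Y Z g) (fmor F X Y f)) \<and>
     (\<forall>X\<in>Ob C. fmor F X X (Ident C X) = Ident D (fobj F X))"

definition natural_transformation ::
    "('o, 'k, 'm) lin_cat \<Rightarrow> ('p, 'k, 'n) lin_cat \<Rightarrow> ('o, 'm, 'p, 'n) lin_functor \<Rightarrow>
     ('o, 'm, 'p, 'n) lin_functor \<Rightarrow> ('o \<Rightarrow> 'n) \<Rightarrow> bool" where
  "natural_transformation C D F G \<eta> \<longleftrightarrow>
     (\<forall>X\<in>Ob C. \<eta> X \<in> carrier (Mor D (fobj F X) (fobj G X))) \<and>
     (\<forall>X\<in>Ob C. \<forall>Y\<in>Ob C. \<forall>f\<in>carrier (Mor C X Y).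
        Comp D (fobj F X) (fobj F Y) (fobj G Y) (\<eta> Y) (fmor F X Y f) =
        Comp D (fobj F X) (fobj G X) (fobj G Y) (fmor G X Y f) (\<eta> X))"


section \<open>Bounded complexes over a linear category\<close>

record ('o, 'm) cochain =
  cobj :: "int \<Rightarrow> 'o"
  cdiff :: "int \<Rightarrow> 'm"

definition zero_object :: "('o, 'k, 'm) lin_cat \<Rightarrow> 'o \<Rightarrow> bool" where
  "zero_object B Z \<longleftrightarrow> Z \<in> Ob B \<and>
     (\<forall>X\<in>Ob B. carrier (Mor B X Z) = {\<zero>\<^bsub>Mor B X Z\<^esub>} \<and> carrier (Mor B Z X) = {\<zero>\<^bsub>Mor B Z X\<^esub>})"

definition bounded_complex :: "('o, 'k, 'm) lin_cat \<Rightarrow> ('o, 'm) cochain \<Rightarrow> bool" where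
  "bounded_complex B X \<longleftrightarrow>
     (\<forall>i. cobj X i \<in> Ob B) \<and>
     (\<forall>i. cdiff X i \<in> carrier (Mor B (cobj X i) (cobj X (i + 1)))) \<and>
     (\<forall>i. Comp B (cobj X i) (cobj X (i + 1)) (cobj X (i + 2)) (cdiff X (i + 1)) (cdiff X i) =
          \<zero>\<^bsub>Mor B (cobj X i) (cobj X (i + 2))\<^esub>) \<and>
     (\<exists>N. \<forall>i. \<bar>i\<bar> > N \<longrightarrow> zero_object B (cobj X i))"

definition hom_complex ::
    "('o, 'k, 'm) lin_cat \<Rightarrow> ('o, 'm) cochain \<Rightarrow> ('o, 'm) cochain \<Rightarrow> ('k, int \<Rightarrow> 'm) mod_complex" where
  "hom_complex B X Y =
     \<lparr>grade = (\<lambda>k. direct_product (\<lambda>i. Mor B (cobj X i) (cobj Y (i + k)))),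
      diff = (\<lambda>k f i.
        Comp B (cobj X i) (cobj Y (i + k)) (cobj Y (i + k + 1)) (cdiff Y (i + k)) (f i)
          \<ominus>\<^bsub>Mor B (cobj X i) (cobj Y (i + k + 1))\<^esub>
        signed (Mor B (cobj X i) (cobj Y (i + k + 1))) k
          (Comp B (cobj X i) (cobj X (i + 1)) (cobj Y (i + k + 1)) (f (i + 1)) (cdiff X i)))\<rparr>"

text \<open>\<open>hom_comp B X Y Z l k g f\<close> is \<open>g \<circ> f\<close> for \<open>f\<close> of degree \<open>k\<close> from \<open>X\<close> to \<open>Y\<close> and \<open>g\<close> of degree
  \<open>l\<close> from \<open>Y\<close> to \<open>Z\<close>.\<close>

definition hom_comp ::
    "('o, 'k, 'm) lin_cat \<Rightarrow> ('o, 'm) cochain \<Rightarrow> ('o, 'm) cochain \<Rightarrow> ('o, 'm) cochain \<Rightarrow>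
     int \<Rightarrow> int \<Rightarrow> (int \<Rightarrow> 'm) \<Rightarrow> (int \<Rightarrow> 'm) \<Rightarrow> int \<Rightarrow> 'm" where
  "hom_comp B X Y Z l k g f =
     (\<lambda>i. Comp B (cobj X i) (cobj Y (i + k)) (cobj Z (i + k + l)) (g (i + k)) (f i))"

definition hom_ident :: "('o, 'k, 'm) lin_cat \<Rightarrow> ('o, 'm) cochain \<Rightarrow> int \<Rightarrow> 'm" where
  "hom_ident B X = (\<lambda>i. Ident B (cobj X i))"

text \<open>The bounded complexes and chain maps over \<open>B\<close>. Chain maps are the closed degree zero
  morphisms of the dg category of bounded complexes, so a dg functor to the latter from a linear
  category in degree zero is a linear functor to \<open>chain_category B\<close>.\<close>

definition chain_category ::
    "('o, 'k, 'm) lin_cat \<Rightarrow> (('o, 'm) cochain, 'k, int \<Rightarrow> 'm) lin_cat" where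
  "chain_category B =
     \<lparr>Ob = {X. bounded_complex B X},
      Mor = (\<lambda>X Y. cocycles (hom_complex B X Y) 0),
      Comp = (\<lambda>X Y Z. hom_comp B X Y Z 0 0),
      Ident = hom_ident B\<rparr>"

definition homotopy_category ::
    "('o, 'k, 'm) lin_cat \<Rightarrow> (('o, 'm) cochain, 'k, (int \<Rightarrow> 'm) set) lin_cat" where
  "homotopy_category B =
     \<lparr>Ob = {X. bounded_complex B X},
      Mor = (\<lambda>X Y. cohomology (hom_complex B X Y) 0),
      Comp = (\<lambda>X Y Z D C.
        \<Union>g\<in>D. \<Union>f\<in>C. coh_class (hom_complex B X Z) 0 (hom_comp B X Y Z 0 0 g f)),
      Ident = (\<lambda>X. coh_class (hom_complex B X X) 0 (hom_ident B X))\<rparr>"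

definition dg_functor ::
    "'k ring \<Rightarrow> ('a, 'k, 'f) lin_cat \<Rightarrow> ('b, 'k, 'g) lin_cat \<Rightarrow>
     ('a, 'f, ('b, 'g) cochain, int \<Rightarrow> 'g) lin_functor \<Rightarrow> bool" where
  "dg_functor R A B F \<longleftrightarrow> is_linear_functor R A (chain_category B) F"

definition H0_functor ::
    "('b, 'k, 'g) lin_cat \<Rightarrow> ('a, 'f, ('b, 'g) cochain, int \<Rightarrow> 'g) lin_functor \<Rightarrow>
     ('a, 'f, ('b, 'g) cochain, (int \<Rightarrow> 'g) set) lin_functor" where
  "H0_functor B F =
     \<lparr>fobj = fobj F,
      fmor = (\<lambda>X Y f. coh_class (hom_complex B (fobj F X) (fobj F Y)) 0 (fmor F X Y f))\<rparr>"

definition unobstructed ::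
    "('a, 'k, 'f) lin_cat \<Rightarrow> ('b, 'k, 'g) lin_cat \<Rightarrow>
     ('a, 'f, ('b, 'g) cochain, int \<Rightarrow> 'g) lin_functor \<Rightarrow>
     ('a, 'f, ('b, 'g) cochain, int \<Rightarrow> 'g) lin_functor \<Rightarrow> bool" where
  "unobstructed A B F G \<longleftrightarrow>
     (\<forall>X\<in>Ob A. \<forall>X'\<in>Ob A. \<forall>k<0.
        let H = cohomology (hom_complex B (fobj F X') (fobj G X)) k in carrier H = {\<zero>\<^bsub>H\<^esub>})"


section \<open>Bimodules over a linear category\<close>

text \<open>\<open>act B X X' Y Y' n f b g\<close> is \<open>f \<cdot> b \<cdot> g\<close>, an element of \<open>B(X', Y')\<close>, for \<open>f : X \<rightarrow> X'\<close>,
  \<open>b\<close> of degree \<open>n\<close> in \<open>B(X, Y)\<close> and \<open>g : Y' \<rightarrow> Y\<close>.\<close>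

record ('o, 'k, 'm, 'e) bimod =
  cpx :: "'o \<Rightarrow> 'o \<Rightarrow> ('k, 'e) mod_complex"
  act :: "'o \<Rightarrow> 'o \<Rightarrow> 'o \<Rightarrow> 'o \<Rightarrow> int \<Rightarrow> 'm \<Rightarrow> 'e \<Rightarrow> 'm \<Rightarrow> 'e"

text \<open>The sign $(-1)^{l|f|}$ is trivial, since morphisms of \<open>A\<close> have degree zero. The maps are taken
  to be \<^const>\<open>undefined\<close> off the objects of \<open>A\<close> and off the carriers, so that equal families of maps
  are equal as functions.\<close>

definition bimodule_maps ::
    "'k ring \<Rightarrow> ('o, 'k, 'm) lin_cat \<Rightarrow> ('o, 'k, 'm, 'e) bimod \<Rightarrow> ('o, 'k, 'm, 'd) bimod \<Rightarrow> int \<Rightarrow>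
     ('o \<Rightarrow> 'o \<Rightarrow> int \<Rightarrow> 'e \<Rightarrow> 'd) set" where
  "bimodule_maps R A P Q l =
     {\<phi> \<in> \<Pi>\<^sub>E X\<in>Ob A. \<Pi>\<^sub>E Y\<in>Ob A. \<Pi>\<^sub>E n\<in>UNIV.
            module_hom R (grade (cpx P X Y) n) (grade (cpx Q X Y) (n + l)) \<inter>
            extensional (carrier (grade (cpx P X Y) n)).
        \<forall>X\<in>Ob A. \<forall>X'\<in>Ob A. \<forall>Y\<in>Ob A. \<forall>Y'\<in>Ob A. \<forall>n.
        \<forall>f\<in>carrier (Mor A X X'). \<forall>b\<in>carrier (grade (cpx P X Y) n). \<forall>g\<in>carrier (Mor A Y' Y).
          \<phi> X' Y' n (act P X X' Y Y' n f b g) = act Q X X' Y Y' (n + l) f (\<phi> X Y n b) g}"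

definition bimodule_map_complex ::
    "'k ring \<Rightarrow> ('o, 'k, 'm) lin_cat \<Rightarrow> ('o, 'k, 'm, 'e) bimod \<Rightarrow> ('o, 'k, 'm, 'd) bimod \<Rightarrow>
     ('k, 'o \<Rightarrow> 'o \<Rightarrow> int \<Rightarrow> 'e \<Rightarrow> 'd) mod_complex" where
  "bimodule_map_complex R A P Q =
     \<lparr>grade = (\<lambda>l. module_of (bimodule_maps R A P Q l)
        (\<lambda>X\<in>Ob A. \<lambda>Y\<in>Ob A. \<lambda>n. \<lambda>b\<in>carrier (grade (cpx P X Y) n). \<zero>\<^bsub>grade (cpx Q X Y) (n + l)\<^esub>)
        (\<lambda>\<phi> \<psi>. \<lambda>X\<in>Ob A. \<lambda>Y\<in>Ob A. \<lambda>n. \<lambda>b\<in>carrier (grade (cpx P X Y) n).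
           \<phi> X Y n b \<oplus>\<^bsub>grade (cpx Q X Y) (n + l)\<^esub> \<psi> X Y n b)
        (\<lambda>a \<phi>. \<lambda>X\<in>Ob A. \<lambda>Y\<in>Ob A. \<lambda>n. \<lambda>b\<in>carrier (grade (cpx P X Y) n).
           a \<odot>\<^bsub>grade (cpx Q X Y) (n + l)\<^esub> \<phi> X Y n b)),
      diff = (\<lambda>l \<phi>. \<lambda>X\<in>Ob A. \<lambda>Y\<in>Ob A. \<lambda>n. \<lambda>b\<in>carrier (grade (cpx P X Y) n).
        diff (cpx Q X Y) (n + l) (\<phi> X Y n b)
          \<ominus>\<^bsub>grade (cpx Q X Y) (n + l + 1)\<^esub>
        signed (grade (cpx Q X Y) (n + l + 1)) l (\<phi> X Y (n + 1) (diff (cpx P X Y) n b)))\<rparr>"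

text \<open>The bimodule $M^G_F$.\<close>

definition hom_bimodule ::
    "('b, 'k, 'g) lin_cat \<Rightarrow> ('a, 'f, ('b, 'g) cochain, int \<Rightarrow> 'g) lin_functor \<Rightarrow>
     ('a, 'f, ('b, 'g) cochain, int \<Rightarrow> 'g) lin_functor \<Rightarrow> ('a, 'k, 'f, int \<Rightarrow> 'g) bimod" where
  "hom_bimodule B F G =
     \<lparr>cpx = (\<lambda>X X'. hom_complex B (fobj F X') (fobj G X)),
      act = (\<lambda>X Z X' Z' n a m b.
        hom_comp B (fobj F Z') (fobj G X) (fobj G Z) 0 n (fmor G X Z a)
          (hom_comp B (fobj F Z') (fobj F X') (fobj G X) n 0 m (fmor F Z' X' b)))\<rparr>"


section \<open>The bar complex\<close>

text \<open>The index set of the summands in degree \<open>n\<close>: the tuples $(X_0, \dots, X_r)$ with $n = -r$;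
  there are none for \<open>n > 0\<close>.\<close>

definition bar_index :: "('o, 'k, 'm) lin_cat \<Rightarrow> int \<Rightarrow> 'o list set" where
  "bar_index A n = {Xs. Xs \<noteq> [] \<and> set Xs \<subseteq> Ob A \<and> int (length Xs) = 1 - n}"

text \<open>\<open>chain_mors A [Y\<^sub>0, \<dots>, Y\<^sub>m]\<close> is the list of the modules $\mathrm{Hom}(Y_{i+1}, Y_i)$ for
  \<open>i < m\<close>.\<close>

definition chain_mors :: "('o, 'k, 'm) lin_cat \<Rightarrow> 'o list \<Rightarrow> ('k, 'm) module list" where
  "chain_mors A Ys = map (\<lambda>i. Mor A (Ys ! Suc i) (Ys ! i)) [0..<length Ys - 1]"

definition bar_mors :: "('o, 'k, 'm) lin_cat \<Rightarrow> 'o \<Rightarrow> 'o \<Rightarrow> 'o list \<Rightarrow> ('k, 'm) module list" where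
  "bar_mors A X X' Xs = chain_mors A (X # Xs @ [X'])"

definition bar_module ::
    "'k ring \<Rightarrow> ('o, 'k, 'm) lin_cat \<Rightarrow> 'o \<Rightarrow> 'o \<Rightarrow> int \<Rightarrow>
     ('k, 'o list \<Rightarrow> ('m list \<Rightarrow> 'k) set) module" where
  "bar_module R A X X' n =
     direct_sum (bar_index A n) (\<lambda>Xs. tensor_product R (bar_mors A X X' Xs))"

text \<open>The element $[f_0, \dots, f_{r+1}]$ of the summand indexed by \<open>Xs\<close> $= (X_0, \dots, X_r)$.\<close>

definition bar_elem ::
    "'k ring \<Rightarrow> ('o, 'k, 'm) lin_cat \<Rightarrow> 'o \<Rightarrow> 'o \<Rightarrow> int \<Rightarrow> 'o list \<Rightarrow> 'm list \<Rightarrow>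
     'o list \<Rightarrow> ('m list \<Rightarrow> 'k) set" where
  "bar_elem R A X X' n Xs fs =
     sum_inj (bar_index A n) (\<lambda>Xs. tensor_product R (bar_mors A X X' Xs)) Xs
       (pure_tensor R (bar_mors A X X' Xs) fs)"

text \<open>The linear map on the degree \<open>n\<close> part of the bar complex with prescribed values \<open>g Xs fs\<close>
  (multilinear in \<open>fs\<close>) on the elements $[f_0, \dots, f_{r+1}]$.\<close>

definition bar_extend ::
    "'k ring \<Rightarrow> ('o, 'k, 'm) lin_cat \<Rightarrow> 'o \<Rightarrow> 'o \<Rightarrow> int \<Rightarrow> ('k, 'n) module \<Rightarrow>
     ('o list \<Rightarrow> 'm list \<Rightarrow> 'n) \<Rightarrow> ('o list \<Rightarrow> ('m list \<Rightarrow> 'k) set) \<Rightarrow> 'n" where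
  "bar_extend R A X X' n N g =
     (THE h. h \<in> module_hom R (bar_module R A X X' n) N \<and>
        h \<in> extensional (carrier (bar_module R A X X' n)) \<and>
        (\<forall>Xs\<in>bar_index A n. \<forall>fs\<in>tensor_words (bar_mors A X X' Xs).
           h (bar_elem R A X X' n Xs fs) = g Xs fs))"

definition merge_mors ::
    "('o, 'k, 'm) lin_cat \<Rightarrow> 'o \<Rightarrow> 'o \<Rightarrow> 'o list \<Rightarrow> nat \<Rightarrow> 'm list \<Rightarrow> 'm list" where
  "merge_mors A X X' Xs i fs =
     (let Ys = X # Xs @ [X'] in
        take i fs @
        [Comp A (Ys ! (i + 2)) (Ys ! (i + 1)) (Ys ! i) (fs ! i) (fs ! (i + 1))] @
        drop (i + 2) fs)"

definition bar_diff ::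
    "'k ring \<Rightarrow> ('o, 'k, 'm) lin_cat \<Rightarrow> 'o \<Rightarrow> 'o \<Rightarrow> int \<Rightarrow>
     ('o list \<Rightarrow> ('m list \<Rightarrow> 'k) set) \<Rightarrow> 'o list \<Rightarrow> ('m list \<Rightarrow> 'k) set" where
  "bar_diff R A X X' n =
     (let N = bar_module R A X X' (n + 1) in
        bar_extend R A X X' n N
          (\<lambda>Xs fs. if n = 0 then \<zero>\<^bsub>N\<^esub>
             else (\<Oplus>\<^bsub>N\<^esub>i\<in>{..<length Xs}. signed N (int i)
                     (bar_elem R A X X' (n + 1) (take i Xs @ drop (i + 1) Xs)
                       (merge_mors A X X' Xs i fs)))))"

definition bar_act ::
    "'k ring \<Rightarrow> ('o, 'k, 'm) lin_cat \<Rightarrow> 'o \<Rightarrow> 'o \<Rightarrow> 'o \<Rightarrow> 'o \<Rightarrow> int \<Rightarrow> 'm \<Rightarrow>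
     ('o list \<Rightarrow> ('m list \<Rightarrow> 'k) set) \<Rightarrow> 'm \<Rightarrow> 'o list \<Rightarrow> ('m list \<Rightarrow> 'k) set" where
  "bar_act R A X Z X' Z' n a x b =
     bar_extend R A X X' n (bar_module R A Z Z' n)
       (\<lambda>Xs fs. bar_elem R A Z Z' n Xs
          ([Comp A (hd Xs) X Z a (hd fs)] @ butlast (tl fs) @ [Comp A Z' X' (last Xs) (last fs) b])) x"

definition bar_bimodule ::
    "'k ring \<Rightarrow> ('o, 'k, 'm) lin_cat \<Rightarrow> ('o, 'k, 'm, 'o list \<Rightarrow> ('m list \<Rightarrow> 'k) set) bimod" where
  "bar_bimodule R A =
     \<lparr>cpx = (\<lambda>X X'. \<lparr>grade = bar_module R A X X', diff = bar_diff R A X X'\<rparr>),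
      act = bar_act R A\<rparr>"


section \<open>Natural transformations up to coherent homotopy\<close>

definition A_inf_complex ::
    "'k ring \<Rightarrow> ('a, 'k, 'f) lin_cat \<Rightarrow> ('b, 'k, 'g) lin_cat \<Rightarrow>
     ('a, 'f, ('b, 'g) cochain, int \<Rightarrow> 'g) lin_functor \<Rightarrow>
     ('a, 'f, ('b, 'g) cochain, int \<Rightarrow> 'g) lin_functor \<Rightarrow>
     ('k, 'a \<Rightarrow> 'a \<Rightarrow> int \<Rightarrow> ('a list \<Rightarrow> ('f list \<Rightarrow> 'k) set) \<Rightarrow> int \<Rightarrow> 'g) mod_complex" where
  "A_inf_complex R A B F G = bimodule_map_complex R A (bar_bimodule R A) (hom_bimodule B F G)"

definition closed_A_inf_transformation ::
    "'k ring \<Rightarrow> ('a, 'k, 'f) lin_cat \<Rightarrow> ('b, 'k, 'g) lin_cat \<Rightarrow>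
     ('a, 'f, ('b, 'g) cochain, int \<Rightarrow> 'g) lin_functor \<Rightarrow>
     ('a, 'f, ('b, 'g) cochain, int \<Rightarrow> 'g) lin_functor \<Rightarrow>
     ('a \<Rightarrow> 'a \<Rightarrow> int \<Rightarrow> ('a list \<Rightarrow> ('f list \<Rightarrow> 'k) set) \<Rightarrow> int \<Rightarrow> 'g) \<Rightarrow> bool" where
  "closed_A_inf_transformation R A B F G \<tau> \<longleftrightarrow> \<tau> \<in> carrier (cocycles (A_inf_complex R A B F G) 0)"

text \<open>Here $[\mathrm{id}_X, \mathrm{id}_X]$ lies in the summand $X_0 = X$, $r = 0$, of the bar complex
  evaluated at \<open>(X, X)\<close>.\<close>

definition extends_transformation ::
    "'k ring \<Rightarrow> ('a, 'k, 'f) lin_cat \<Rightarrow> ('b, 'k, 'g) lin_cat \<Rightarrow>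
     ('a, 'f, ('b, 'g) cochain, int \<Rightarrow> 'g) lin_functor \<Rightarrow>
     ('a, 'f, ('b, 'g) cochain, int \<Rightarrow> 'g) lin_functor \<Rightarrow>
     ('a \<Rightarrow> 'a \<Rightarrow> int \<Rightarrow> ('a list \<Rightarrow> ('f list \<Rightarrow> 'k) set) \<Rightarrow> int \<Rightarrow> 'g) \<Rightarrow>
     ('a \<Rightarrow> (int \<Rightarrow> 'g) set) \<Rightarrow> bool" where
  "extends_transformation R A B F G \<tau> \<eta> \<longleftrightarrow>
     (\<forall>X\<in>Ob A. coh_class (hom_complex B (fobj F X) (fobj G X)) 0
        (\<tau> X X 0 (bar_elem R A X X 0 [X] [Ident A X, Ident A X])) = \<eta> X)"

definition A_inf_homotopic ::
    "'k ring \<Rightarrow> ('a, 'k, 'f) lin_cat \<Rightarrow> ('b, 'k, 'g) lin_cat \<Rightarrow>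
     ('a, 'f, ('b, 'g) cochain, int \<Rightarrow> 'g) lin_functor \<Rightarrow>
     ('a, 'f, ('b, 'g) cochain, int \<Rightarrow> 'g) lin_functor \<Rightarrow>
     ('a \<Rightarrow> 'a \<Rightarrow> int \<Rightarrow> ('a list \<Rightarrow> ('f list \<Rightarrow> 'k) set) \<Rightarrow> int \<Rightarrow> 'g) \<Rightarrow>
     ('a \<Rightarrow> 'a \<Rightarrow> int \<Rightarrow> ('a list \<Rightarrow> ('f list \<Rightarrow> 'k) set) \<Rightarrow> int \<Rightarrow> 'g) \<Rightarrow> bool" where
  "A_inf_homotopic R A B F G \<tau> \<tau>' \<longleftrightarrow>
     \<tau> \<ominus>\<^bsub>grade (A_inf_complex R A B F G) 0\<^esub> \<tau>' \<in> coboundaries (A_inf_complex R A B F G) 0"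


section \<open>Well-definedness of \<^const>\<open>bar_extend\<close>\<close>

text \<open>The description in \<^const>\<open>bar_extend\<close> determines a unique map whenever the prescribed values
  are multilinear: \<open>bar_extend_unique_existence\<close> below.\<close>

lemma module_ofI:
  assumes "cring R"
    and "z \<in> U" "\<And>x y. x \<in> U \<Longrightarrow> y \<in> U \<Longrightarrow> p x y \<in> U"
    and "\<And>x y w. x \<in> U \<Longrightarrow> y \<in> U \<Longrightarrow> w \<in> U \<Longrightarrow> p (p x y) w = p x (p y w)"
    and "\<And>x y. x \<in> U \<Longrightarrow> y \<in> U \<Longrightarrow> p x y = p y x"
    and "\<And>x. x \<in> U \<Longrightarrow> p z x = x"
    and "\<And>x. x \<in> U \<Longrightarrow> \<exists>y\<in>U. p y x = z"
    and "\<And>a x. a \<in> carrier R \<Longrightarrow> x \<in> U \<Longrightarrow> s a x \<in> U"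
    and "\<And>a b x. a \<in> carrier R \<Longrightarrow> b \<in> carrier R \<Longrightarrow> x \<in> U \<Longrightarrow> s (a \<oplus>\<^bsub>R\<^esub> b) x = p (s a x) (s b x)"
    and "\<And>a x y. a \<in> carrier R \<Longrightarrow> x \<in> U \<Longrightarrow> y \<in> U \<Longrightarrow> s a (p x y) = p (s a x) (s a y)"
    and "\<And>a b x. a \<in> carrier R \<Longrightarrow> b \<in> carrier R \<Longrightarrow> x \<in> U \<Longrightarrow> s (a \<otimes>\<^bsub>R\<^esub> b) x = s a (s b x)"
    and "\<And>x. x \<in> U \<Longrightarrow> s \<one>\<^bsub>R\<^esub> x = x"
  shows "module R (module_of U z p s)"
  by (rule moduleI; (rule abelian_groupI)?; (simp add: module_of_def)?; (rule assms; assumption)?)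

lemma direct_sum_carrier: "carrier (direct_sum I M) = {x \<in> \<Pi>\<^sub>E i\<in>I. carrier (M i). finite {i \<in> I. x i \<noteq> \<zero>\<^bsub>M i\<^esub>}}"
  by (simp add: direct_sum_def module_of_def)
lemma direct_sum_add: "x \<oplus>\<^bsub>direct_sum I M\<^esub> y = (\<lambda>i\<in>I. x i \<oplus>\<^bsub>M i\<^esub> y i)"
  by (simp add: direct_sum_def module_of_def)
lemma direct_sum_smult: "a \<odot>\<^bsub>direct_sum I M\<^esub> x = (\<lambda>i\<in>I. a \<odot>\<^bsub>M i\<^esub> x i)"
  by (simp add: direct_sum_def module_of_def)
lemma direct_sum_zero: "\<zero>\<^bsub>direct_sum I M\<^esub> = (\<lambda>i\<in>I. \<zero>\<^bsub>M i\<^esub>)"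
  by (simp add: direct_sum_def module_of_def)

lemma module_direct_sum:
  assumes "cring R" and m: "\<And>i. i \<in> I \<Longrightarrow> module R (M i)"
  shows "module R (direct_sum I M)"
proof -
  have ag: "abelian_group (M i)" if "i \<in> I" for i using m[OF that] by (simp add: module_def)
  have am: "abelian_monoid (M i)" if "i \<in> I" for i using ag[OF that] by (simp add: abelian_group_def)
  note cl = abelian_monoid.zero_closed[OF am] abelian_monoid.a_closed[OF am] abelian_monoid.l_zero[OF am] abelian_monoid.r_zero[OF am]
     module.smult_closed[OF m] module.smult_r_null[OF m]
  show ?thesis
    unfolding direct_sum_def
  proof (rule module_ofI[OF assms(1)], goal_cases)
    case 1 then show ?case by (auto simp: cl)
  next
    case (2 x y)
    have "{i \<in> I. (\<lambda>i\<in>I. x i \<oplus>\<^bsub>M i\<^esub> y i) i \<noteq> \<zero>\<^bsub>M i\<^esub>} \<subseteq> {i \<in> I. x i \<noteq> \<zero>\<^bsub>M i\<^esub>} \<union> {i \<in> I. y i \<noteq> \<zero>\<^bsub>M i\<^esub>}"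
      by (auto simp: cl)
    from finite_subset[OF this] 2 have f: "finite {i \<in> I. (\<lambda>i\<in>I. x i \<oplus>\<^bsub>M i\<^esub> y i) i \<noteq> \<zero>\<^bsub>M i\<^esub>}" by auto
    show ?case by (rule CollectI, rule conjI[OF _ f]) (use 2 in \<open>auto simp: PiE_iff cl\<close>)
  next
    case (3 x y w) then show ?case by (auto simp: PiE_iff intro!: restrict_ext abelian_monoid.a_assoc[OF am])
  next
    case (4 x y) then show ?case by (auto simp: PiE_iff intro!: restrict_ext abelian_monoid.a_comm[OF am])
  next
    case (5 x) then show ?case by (auto simp: PiE_iff cl extensional_def)
  next
    case (6 x)
    have "{i \<in> I. (\<lambda>i\<in>I. \<ominus>\<^bsub>M i\<^esub> x i) i \<noteq> \<zero>\<^bsub>M i\<^esub>} \<subseteq> {i \<in> I. x i \<noteq> \<zero>\<^bsub>M i\<^esub>}"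
      using abelian_group.l_neg[OF ag] abelian_group.a_inv_closed[OF ag] cl by (smt (verit) Collect_mono restrict_apply)
    from finite_subset[OF this] 6 have f: "finite {i \<in> I. (\<lambda>i\<in>I. \<ominus>\<^bsub>M i\<^esub> x i) i \<noteq> \<zero>\<^bsub>M i\<^esub>}" by auto
    show ?case
      apply (rule bexI[of _ "\<lambda>i\<in>I. \<ominus>\<^bsub>M i\<^esub> x i"])
       apply (rule ext) using 6 apply (simp add: PiE_iff abelian_group.l_neg[OF ag] restrict_def)
      apply (rule CollectI, rule conjI[OF _ f]) using 6 by (simp add: PiE_iff abelian_group.a_inv_closed[OF ag])
  next
    case (7 a x)
    have "{i \<in> I. (\<lambda>i\<in>I. a \<odot>\<^bsub>M i\<^esub> x i) i \<noteq> \<zero>\<^bsub>M i\<^esub>} \<subseteq> {i \<in> I. x i \<noteq> \<zero>\<^bsub>M i\<^esub>}"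
      using 7 by (auto simp: cl)
    from finite_subset[OF this] 7 have f: "finite {i \<in> I. (\<lambda>i\<in>I. a \<odot>\<^bsub>M i\<^esub> x i) i \<noteq> \<zero>\<^bsub>M i\<^esub>}" by auto
    show ?case by (rule CollectI, rule conjI[OF _ f]) (use 7 in \<open>auto simp: PiE_iff cl\<close>)
  next
    case (8 a b x) then show ?case by (auto simp: PiE_iff intro!: restrict_ext module.smult_l_distr[OF m])
  next
    case (9 a x y) then show ?case by (auto simp: PiE_iff intro!: restrict_ext module.smult_r_distr[OF m])
  next
    case (10 a x y) then show ?case by (auto simp: PiE_iff intro!: restrict_ext module.smult_assoc1[OF m])
  next
    case (11 x) then show ?case by (auto simp: PiE_iff extensional_def module.smult_one[OF m])
  qed
qed

lemma module_self: "cring R \<Longrightarrow> module R (self_module R)"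
proof -
  assume c: "cring R"
  interpret cring R by fact
  show ?thesis unfolding self_module_def
    by (rule module_ofI[OF c]) (auto simp: a_ac m_assoc l_distr r_distr intro: bexI[of _ "\<ominus>\<^bsub>R\<^esub> _"] l_neg)
qed

lemma module_free: "cring R \<Longrightarrow> module R (free_module R S)"
  unfolding free_module_def by (rule module_direct_sum) (auto simp: module_self)

lemma module_hom_in: "h \<in> module_hom R M N \<Longrightarrow> x \<in> carrier M \<Longrightarrow> h x \<in> carrier N"
  by (auto simp: module_hom_def)
lemma module_hom_add: "h \<in> module_hom R M N \<Longrightarrow> x \<in> carrier M \<Longrightarrow> y \<in> carrier M \<Longrightarrow> h (x \<oplus>\<^bsub>M\<^esub> y) = h x \<oplus>\<^bsub>N\<^esub> h y"
  by (auto simp: module_hom_def)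
lemma module_hom_smult: "h \<in> module_hom R M N \<Longrightarrow> x \<in> carrier M \<Longrightarrow> a \<in> carrier R \<Longrightarrow> h (a \<odot>\<^bsub>M\<^esub> x) = a \<odot>\<^bsub>N\<^esub> h x"
  by (auto simp: module_hom_def)

lemma module_hom_zero:
  assumes "module R M" "module R N" "h \<in> module_hom R M N"
  shows "h \<zero>\<^bsub>M\<^esub> = \<zero>\<^bsub>N\<^esub>"
proof -
  interpret M: module R M by fact
  interpret N: module R N by fact
  have "h (\<zero>\<^bsub>R\<^esub> \<odot>\<^bsub>M\<^esub> \<zero>\<^bsub>M\<^esub>) = \<zero>\<^bsub>R\<^esub> \<odot>\<^bsub>N\<^esub> h \<zero>\<^bsub>M\<^esub>"
    using assms(3) M.R.zero_closed M.zero_closed unfolding module_hom_def by blast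
  then show ?thesis using assms by (auto simp: module_hom_def Pi_iff)
qed

definition sum_extend ::
    "'i set \<Rightarrow> ('i \<Rightarrow> ('k, 'm) module) \<Rightarrow> ('k, 'n) module \<Rightarrow> ('i \<Rightarrow> 'm \<Rightarrow> 'n) \<Rightarrow> ('i \<Rightarrow> 'm) \<Rightarrow> 'n"
  where "sum_extend I M N h x = (\<Oplus>\<^bsub>N\<^esub>i\<in>{i\<in>I. x i \<noteq> \<zero>\<^bsub>M i\<^esub>}. h i (x i))"

lemma sum_extend_alt:
  assumes "cring R" and m: "\<And>i. i \<in> I \<Longrightarrow> module R (M i)" and n: "module R N"
   and h: "\<And>i. i \<in> I \<Longrightarrow> h i \<in> module_hom R (M i) N"
   and x: "\<And>i. i\<in>I \<Longrightarrow> x i \<in> carrier (M i)" and J: "finite J" "J \<subseteq> I" "{i\<in>I. x i \<noteq> \<zero>\<^bsub>M i\<^esub>} \<subseteq> J"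
  shows "sum_extend I M N h x = (\<Oplus>\<^bsub>N\<^esub>i\<in>J. h i (x i))"
proof -
  interpret N: module R N by fact
  show ?thesis unfolding sum_extend_def
    apply (rule N.add.finprod_mono_neutral_cong_left[OF J(1,3)])
    using J x h module_hom_zero[OF m n h] by (auto simp: module_hom_def Pi_iff)
qed

lemma direct_sum_universal:
  assumes c: "cring R" and m: "\<And>i. i \<in> I \<Longrightarrow> module R (M i)" and n: "module R N"
   and h: "\<And>i. i \<in> I \<Longrightarrow> h i \<in> module_hom R (M i) N"
  shows "sum_extend I M N h \<in> module_hom R (direct_sum I M) N"
   and "\<And>i x. i \<in> I \<Longrightarrow> x \<in> carrier (M i) \<Longrightarrow> sum_extend I M N h (sum_inj I M i x) = h i x"
proof -
  interpret N: module R N by fact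
  interpret D: module R "direct_sum I M" by (rule module_direct_sum[OF c m])
  let ?s = "\<lambda>x. {i\<in>I. x i \<noteq> \<zero>\<^bsub>M i\<^esub>}"
  note alt = sum_extend_alt[OF c m n h]
  have hc: "\<And>i x. i \<in> I \<Longrightarrow> x \<in> carrier (M i) \<Longrightarrow> h i x \<in> carrier N" using module_hom_in[OF h] by blast
  have z: "\<And>i. i \<in> I \<Longrightarrow> \<zero>\<^bsub>M i\<^esub> \<in> carrier (M i)" using m by (simp add: module_def abelian_group_def abelian_monoid.zero_closed)
  show "sum_extend I M N h \<in> module_hom R (direct_sum I M) N"
    unfolding module_hom_def
  proof (clarsimp, intro conjI ballI funcsetI)
    fix x assume "x \<in> carrier (direct_sum I M)"
    then show "sum_extend I M N h x \<in> carrier N" unfolding sum_extend_def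
      by (intro N.finsum_closed) (auto simp: direct_sum_carrier PiE_iff hc)
  next
    fix x y assume x: "x \<in> carrier (direct_sum I M)" and y: "y \<in> carrier (direct_sum I M)"
    let ?z = "x \<oplus>\<^bsub>direct_sum I M\<^esub> y"
    have zz: "?z \<in> carrier (direct_sum I M)" using x y by simp
    let ?J = "?s x \<union> ?s y \<union> ?s ?z"
    have J: "finite ?J" "?J \<subseteq> I" using x y zz by (auto simp: direct_sum_carrier)
    have e: "sum_extend I M N h u = (\<Oplus>\<^bsub>N\<^esub>i\<in>?J. h i (u i))" if "u \<in> {x,y,?z}" for u
      by (rule alt[OF _ _ _ J]) (use that x y zz in \<open>auto simp: direct_sum_carrier PiE_iff\<close>)
    have "sum_extend I M N h ?z = (\<Oplus>\<^bsub>N\<^esub>i\<in>?J. h i (x i) \<oplus>\<^bsub>N\<^esub> h i (y i))"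
      unfolding e[of ?z, simplified] using x y h
      by (intro N.add.finprod_cong) (auto simp: direct_sum_add direct_sum_carrier PiE_iff module_hom_add[OF h] module_hom_smult[OF h] hc simp_implies_def)
    also have "\<dots> = sum_extend I M N h x \<oplus>\<^bsub>N\<^esub> sum_extend I M N h y"
      unfolding e[of x, simplified] e[of y, simplified] using x y
      by (intro N.finsum_addf) (auto simp: direct_sum_carrier PiE_iff hc)
    finally show "sum_extend I M N h ?z = sum_extend I M N h x \<oplus>\<^bsub>N\<^esub> sum_extend I M N h y" .
  next
    fix a x assume a: "a \<in> carrier R" and x: "x \<in> carrier (direct_sum I M)"
    let ?z = "a \<odot>\<^bsub>direct_sum I M\<^esub> x"
    have zz: "?z \<in> carrier (direct_sum I M)" using a x by simp
    let ?J = "?s x \<union> ?s ?z"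
    have J: "finite ?J" "?J \<subseteq> I" using x zz by (auto simp: direct_sum_carrier)
    have e: "sum_extend I M N h u = (\<Oplus>\<^bsub>N\<^esub>i\<in>?J. h i (u i))" if "u \<in> {x,?z}" for u
      by (rule alt[OF _ _ _ J]) (use that x zz in \<open>auto simp: direct_sum_carrier PiE_iff\<close>)
    have "sum_extend I M N h ?z = (\<Oplus>\<^bsub>N\<^esub>i\<in>?J. a \<odot>\<^bsub>N\<^esub> h i (x i))"
      unfolding e[of ?z, simplified] using x a h
      by (intro N.add.finprod_cong) (auto simp: direct_sum_smult direct_sum_carrier PiE_iff module_hom_add[OF h] module_hom_smult[OF h] hc simp_implies_def)
    also have "\<dots> = a \<odot>\<^bsub>N\<^esub> sum_extend I M N h x"
      unfolding e[of x, simplified] using x a J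
      by (intro N.finsum_smult_ldistr[symmetric]) (auto simp: direct_sum_carrier PiE_iff hc)
    finally show "sum_extend I M N h ?z = a \<odot>\<^bsub>N\<^esub> sum_extend I M N h x" .
  qed
  fix i x assume i: "i \<in> I" and x: "x \<in> carrier (M i)"
  have "sum_extend I M N h (sum_inj I M i x) = (\<Oplus>\<^bsub>N\<^esub>j\<in>{i}. h j (sum_inj I M i x j))"
    by (rule alt) (use i x z in \<open>auto simp: sum_inj_def split: if_splits\<close>)
  then show "sum_extend I M N h (sum_inj I M i x) = h i x" using i x by (simp add: sum_inj_def hc)
qed

lemma sum_inj_hom:
  assumes c: "cring R" and m: "\<And>i. i \<in> I \<Longrightarrow> module R (M i)" and i: "i \<in> I"
  shows "sum_inj I M i \<in> module_hom R (M i) (direct_sum I M)"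
proof -
  have am: "abelian_monoid (M i)" if "i \<in> I" for i using m[OF that] by (simp add: module_def abelian_group_def)
  note cl = abelian_monoid.zero_closed[OF am] abelian_monoid.l_zero[OF am] module.smult_r_null[OF m]
  have "finite {j \<in> I. (if j = i then x else \<zero>\<^bsub>M j\<^esub>) \<noteq> \<zero>\<^bsub>M j\<^esub>}" for x
    by (rule finite_subset[of _ "{i}"]) auto
  then show ?thesis using i
    by (auto simp: module_hom_def direct_sum_carrier direct_sum_add direct_sum_smult sum_inj_def cl intro!: restrict_ext cong: conj_cong)
qed

lemma direct_sum_unique:
  assumes c: "cring R" and m: "\<And>i. i \<in> I \<Longrightarrow> module R (M i)" and n: "module R N"
   and h: "h \<in> module_hom R (direct_sum I M) N" "h' \<in> module_hom R (direct_sum I M) N"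
   and e: "\<And>i x. i \<in> I \<Longrightarrow> x \<in> carrier (M i) \<Longrightarrow> h (sum_inj I M i x) = h' (sum_inj I M i x)"
   and x: "x \<in> carrier (direct_sum I M)"
  shows "h x = h' x"
proof -
  interpret D: module R "direct_sum I M" by (rule module_direct_sum[OF c m])
  let ?D = "direct_sum I M"
  have am: "abelian_monoid (M i)" if "i \<in> I" for i using m[OF that] by (simp add: module_def abelian_group_def)
  note cl = abelian_monoid.zero_closed[OF am] abelian_monoid.l_zero[OF am] abelian_monoid.r_zero[OF am]
  have "\<forall>x\<in>carrier ?D. {i\<in>I. x i \<noteq> \<zero>\<^bsub>M i\<^esub>} = J \<longrightarrow> h x = h' x" if "finite J" for J
    using that
  proof (induction J rule: finite_induct)
    case empty
    { fix x assume "x \<in> carrier ?D" "{i\<in>I. x i \<noteq> \<zero>\<^bsub>M i\<^esub>} = {}"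
      then have "x = \<zero>\<^bsub>?D\<^esub>" by (auto simp: direct_sum_zero direct_sum_carrier PiE_iff extensional_def)
    }
    note emp = this
    show ?case
    proof (intro ballI impI)
      fix x assume "x \<in> carrier ?D" "{i\<in>I. x i \<noteq> \<zero>\<^bsub>M i\<^esub>} = {}"
      then have "x = \<zero>\<^bsub>?D\<^esub>" by (rule emp)
      then show "h x = h' x" using module_hom_zero[OF D.module_axioms n h(1)] module_hom_zero[OF D.module_axioms n h(2)] by simp
    qed
  next
    case (insert j J)
    show ?case
    proof (intro ballI impI)
      fix x assume x: "x \<in> carrier ?D" and s: "{i\<in>I. x i \<noteq> \<zero>\<^bsub>M i\<^esub>} = insert j J"
      have j: "j \<in> I" "x j \<in> carrier (M j)" using x s by (auto simp: direct_sum_carrier PiE_iff)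
      let ?y = "x(j := \<zero>\<^bsub>M j\<^esub>)"
      have sy: "{i\<in>I. ?y i \<noteq> \<zero>\<^bsub>M i\<^esub>} = J" using s insert.hyps by auto
      have y: "?y \<in> carrier ?D" using x sy insert.hyps j by (auto simp: direct_sum_carrier PiE_iff cl extensional_def)
      have si: "sum_inj I M j (x j) \<in> carrier ?D" using module_hom_in[OF sum_inj_hom[where M=M, OF c m j(1)], of "x j"] j(2) by simp
      have xe: "x = ?y \<oplus>\<^bsub>?D\<^esub> sum_inj I M j (x j)"
      proof (rule ext)
        fix i show "x i = (?y \<oplus>\<^bsub>?D\<^esub> sum_inj I M j (x j)) i"
         using x j by (cases "i = j"; cases "i \<in> I") (auto simp: direct_sum_carrier PiE_iff direct_sum_add sum_inj_def extensional_def cl)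
      qed
      have "h x = h ?y \<oplus>\<^bsub>N\<^esub> h (sum_inj I M j (x j))" by (subst xe) (rule module_hom_add[OF h(1) y si])
      also have "\<dots> = h' ?y \<oplus>\<^bsub>N\<^esub> h' (sum_inj I M j (x j))" proof -
        have "h ?y = h' ?y" using insert.IH y sy by blast
        then show ?thesis by (simp only: e[OF j])
      qed
      also have "\<dots> = h' x"  by (subst (3) xe) (rule module_hom_add[OF h(2) y si, symmetric])
      finally show "h x = h' x" .
    qed
  qed
  then show ?thesis using x by (auto simp: direct_sum_carrier)
qed



lemma module_hom_kernel_submodule:
  assumes "module R M" "module R N" "h \<in> module_hom R M N"
  shows "submodule {x\<in>carrier M. h x = \<zero>\<^bsub>N\<^esub>} R M"
proof -
  interpret M: module R M by fact
  interpret N: module R N by fact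
  note hz = module_hom_zero[OF assms]
  have neg: "h (\<ominus>\<^bsub>M\<^esub> x) = \<zero>\<^bsub>N\<^esub>" if "x \<in> carrier M" "h x = \<zero>\<^bsub>N\<^esub>" for x
  proof -
    have "h (\<ominus>\<^bsub>M\<^esub> x \<oplus>\<^bsub>M\<^esub> x) = h (\<ominus>\<^bsub>M\<^esub> x) \<oplus>\<^bsub>N\<^esub> h x" by (rule module_hom_add[OF assms(3)]) (use that in auto)
    then show ?thesis using that hz module_hom_in[OF assms(3)] by (simp add: M.l_neg)
  qed
  show ?thesis
    by (rule M.submoduleI) (auto simp: hz neg module_hom_add[OF assms(3)] module_hom_smult[OF assms(3)])
qed

lemma span_submodule:
  assumes "module R M" "S \<subseteq> carrier M"
  shows "submodule (submodule_span R M S) R M"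
proof -
  interpret M: module R M by fact
  have c: "submodule (carrier M) R M" by (rule M.carrier_is_submodule)
  show ?thesis unfolding submodule_span_def
  proof (rule M.submoduleI, goal_cases)
    case 1 then show ?case using c assms by auto
  next
    case 2 then show ?case using subgroup.one_closed[OF submodule.axioms(1)] by fastforce
  next
    case (3 a) then show ?case by (auto intro: M.submoduleE(3))
  next
    case (4 a b) then show ?case by (auto intro: M.submoduleE(5))
  next
    case (5 a b) then show ?case by (auto intro: M.submoduleE(4))
  qed
qed

lemma quotient_module_props:
  assumes "module R M" "submodule H R M"
  shows "module R (quotient_module M H)"
   and "(\<lambda>x. H +>\<^bsub>M\<^esub> x) \<in> module_hom R M (quotient_module M H)"
   and "carrier (quotient_module M H) = (\<lambda>x. H +>\<^bsub>M\<^esub> x) ` carrier M"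
   and "\<zero>\<^bsub>quotient_module M H\<^esub> = H"
   and "\<And>x y. x\<in>carrier M \<Longrightarrow> y \<in> carrier M \<Longrightarrow> (H +>\<^bsub>M\<^esub> x = H +>\<^bsub>M\<^esub> y) \<longleftrightarrow> x \<ominus>\<^bsub>M\<^esub> y \<in> H"
proof -
  interpret M: module R M by fact
  interpret as: abelian_subgroup H M
    by (rule abelian_subgroupI3) (use assms M.abelian_group_axioms in \<open>auto intro: additive_subgroup.intro simp: submodule_def\<close>)
  let ?c = "\<lambda>x. H +>\<^bsub>M\<^esub> x"
  have H: "H \<subseteq> carrier M" using as.a_subset .
  show car: "carrier (quotient_module M H) = ?c ` carrier M"
    by (auto simp: quotient_module_def module_of_def A_RCOSETS_def' )
  show z: "\<zero>\<^bsub>quotient_module M H\<^esub> = H" by (simp add: quotient_module_def module_of_def)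
  show eq: "(?c x = ?c y) \<longleftrightarrow> x \<ominus>\<^bsub>M\<^esub> y \<in> H" if "x\<in>carrier M" "y \<in> carrier M" for x y
  proof -
    have "(?c x = ?c y) \<longleftrightarrow> x \<in> ?c y"
      using as.a_repr_independence'[of x y] as.a_rcos_self[of x] that by auto
    then show ?thesis using as.a_rcos_module[of y x] that by (simp add: M.minus_eq)
  qed
  have add: "?c x \<oplus>\<^bsub>quotient_module M H\<^esub> ?c y = ?c (x \<oplus>\<^bsub>M\<^esub> y)" if "x\<in>carrier M" "y \<in> carrier M" for x y
    using that by (simp add: quotient_module_def module_of_def as.a_rcos_sum)
  have sm: "a \<odot>\<^bsub>quotient_module M H\<^esub> ?c x = ?c (a \<odot>\<^bsub>M\<^esub> x)" if "x\<in>carrier M" "a \<in> carrier R" for x a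
  proof -
    have "?c (a \<odot>\<^bsub>M\<^esub> y) = ?c (a \<odot>\<^bsub>M\<^esub> x)" if y: "y \<in> ?c x" for y
    proof -
      have yc: "y \<in> carrier M" using y \<open>x\<in>carrier M\<close> H by (auto simp: a_r_coset_def')
      have "?c y = ?c x" using y \<open>x\<in>carrier M\<close> as.a_repr_independence'[of y x] by auto
      then have "y \<ominus>\<^bsub>M\<^esub> x \<in> H" using eq yc that \<open>x\<in>carrier M\<close> by auto
      then have "a \<odot>\<^bsub>M\<^esub> (y \<ominus>\<^bsub>M\<^esub> x) \<in> H" using M.submoduleE(4)[OF assms(2)] \<open>a\<in>_\<close> by auto
      then have "a \<odot>\<^bsub>M\<^esub> y \<ominus>\<^bsub>M\<^esub> a \<odot>\<^bsub>M\<^esub> x \<in> H" using yc \<open>x\<in>carrier M\<close> \<open>a\<in>_\<close>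
        by (simp add: M.minus_eq M.smult_r_distr M.smult_r_minus)
      then show ?thesis using eq yc \<open>x\<in>carrier M\<close> \<open>a\<in>_\<close> by auto
    qed
    moreover have "x \<in> ?c x" using that as.a_rcos_self by auto
    ultimately have "(\<Union>y\<in>?c x. ?c (a \<odot>\<^bsub>M\<^esub> y)) = ?c (a \<odot>\<^bsub>M\<^esub> x)" by blast
    then show ?thesis by (simp add: quotient_module_def module_of_def)
  qed
  show "?c \<in> module_hom R M (quotient_module M H)"
    by (auto simp: module_hom_def car add sm)
  show "module R (quotient_module M H)"
  proof -
    have zc: "?c \<zero>\<^bsub>M\<^esub> = H" by (rule M.a_coset_add_zero[OF H])
    have zz: "\<zero>\<^bsub>quotient_module M H\<^esub> = ?c \<zero>\<^bsub>M\<^esub>" using z zc by simp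
    show ?thesis
    proof (rule moduleI[OF M.R.cring_axioms], goal_cases)
      case 1 show ?case
      proof (rule abelian_groupI, goal_cases)
        case (1 x y) then show ?case unfolding car by (auto simp: add)
      next
        case 2 show ?case unfolding car zz by auto
      next
        case (3 x y z) then show ?case unfolding car by (auto simp: add M.a_assoc)
      next
        case (4 x y) then show ?case unfolding car by (auto simp: add M.a_comm)
      next
        case (5 x) then show ?case unfolding car zz by (auto simp: add)
      next
        case (6 x) then obtain y where y: "y \<in> carrier M" "x = ?c y" unfolding car by auto
        show ?case unfolding car zz
          by (rule bexI[of _ "?c (\<ominus>\<^bsub>M\<^esub> y)"]) (use y in \<open>auto simp: add M.l_neg\<close>)
      qed
    next
      case (2 a x) then show ?case unfolding car by (auto simp: sm)
    next
      case (3 a b x) then show ?case unfolding car by (auto simp: sm add M.smult_l_distr)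
    next
      case (4 a x y) then show ?case unfolding car by (auto simp: sm add M.smult_r_distr)
    next
      case (5 a b x) then show ?case unfolding car by (auto simp: sm add M.smult_assoc1)
    next
      case (6 x) then show ?case unfolding car by (auto simp: sm)
    qed
  qed
qed

lemma quotient_module_lift:
  assumes "module R M" "submodule H R M" "module R N" "h \<in> module_hom R M N" "\<And>x. x \<in> H \<Longrightarrow> h x = \<zero>\<^bsub>N\<^esub>"
  obtains k where "k \<in> module_hom R (quotient_module M H) N" "\<And>x. x \<in> carrier M \<Longrightarrow> k (H +>\<^bsub>M\<^esub> x) = h x"
proof -
  interpret M: module R M by fact
  interpret N: module R N by fact
  let ?c = "\<lambda>x. H +>\<^bsub>M\<^esub> x"
  define k where "k C = h (SOME x. x \<in> carrier M \<and> ?c x = C)" for C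
  note q = quotient_module_props[OF assms(1,2)]
  have k: "k (?c x) = h x" if x: "x \<in> carrier M" for x
  proof -
    let ?y = "SOME y. y \<in> carrier M \<and> ?c y = ?c x"
    have y: "?y \<in> carrier M" "?c ?y = ?c x" using someI[of "\<lambda>y. y \<in> carrier M \<and> ?c y = ?c x" x] x by auto
    then have "?y \<ominus>\<^bsub>M\<^esub> x \<in> H" using q(5) x by blast
    then have e: "h (?y \<ominus>\<^bsub>M\<^esub> x) = \<zero>\<^bsub>N\<^esub>" by (rule assms(5))
    have "?y = (?y \<ominus>\<^bsub>M\<^esub> x) \<oplus>\<^bsub>M\<^esub> x" using y x by (simp add: M.minus_eq M.a_assoc M.l_neg)
    then have "h ?y = h (?y \<ominus>\<^bsub>M\<^esub> x) \<oplus>\<^bsub>N\<^esub> h x" using module_hom_add[OF assms(4), of "?y \<ominus>\<^bsub>M\<^esub> x" x] y x by auto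
    then show ?thesis using e x module_hom_in[OF assms(4)] by (simp add: k_def)
  qed
  have "k \<in> module_hom R (quotient_module M H) N"
    using module_hom_add[OF q(2), symmetric] module_hom_smult[OF q(2), symmetric]
    by (auto simp: module_hom_def q(3) k module_hom_in[OF assms(4)] module_hom_add[OF assms(4)] module_hom_smult[OF assms(4)])
  then show ?thesis using k that by blast
qed


definition multilinear ::
    "'k ring \<Rightarrow> ('k, 'm) module list \<Rightarrow> ('k, 'n) module \<Rightarrow> ('m list \<Rightarrow> 'n) \<Rightarrow> bool" where
 "multilinear R Ms N g \<longleftrightarrow> (\<forall>fs\<in>tensor_words Ms. g fs \<in> carrier N \<and> (\<forall>i<length Ms.
    (\<forall>x\<in>carrier (Ms!i). \<forall>y\<in>carrier (Ms!i). g (fs[i := x \<oplus>\<^bsub>Ms ! i\<^esub> y]) = g (fs[i := x]) \<oplus>\<^bsub>N\<^esub> g (fs[i:=y])) \<and>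
    (\<forall>a\<in>carrier R. \<forall>x\<in>carrier (Ms!i). g (fs[i := a \<odot>\<^bsub>Ms ! i\<^esub> x]) = a \<odot>\<^bsub>N\<^esub> g (fs[i := x]))))"

lemma tensor_words_update: "fs \<in> tensor_words Ms \<Longrightarrow> x \<in> carrier (Ms!i) \<Longrightarrow> fs[i := x] \<in> tensor_words Ms"
  unfolding tensor_words_def list_all2_conv_all_nth by simp (metis nth_list_update nth_list_update_neq)

lemma free_gen_in: assumes "cring R" "s \<in> S" shows "free_gen R S s \<in> carrier (free_module R S)"
proof -
  interpret cring R by fact
  show ?thesis
  unfolding free_gen_def free_module_def
  by (rule module_hom_in[OF sum_inj_hom[where M="\<lambda>_. self_module R"]]) (use assms in \<open>auto simp: module_self, simp add: self_module_def module_of_def\<close>)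
qed

lemma free_module_universal:
  assumes c: "cring R" and n: "module R N" and g: "\<And>s. s \<in> S \<Longrightarrow> g s \<in> carrier N"
  obtains h where "h \<in> module_hom R (free_module R S) N" "\<And>s. s \<in> S \<Longrightarrow> h (free_gen R S s) = g s"
proof -
  interpret R: cring R by fact
  interpret N: module R N by fact
  let ?M = "\<lambda>_. self_module R"
  have h: "(\<lambda>a. a \<odot>\<^bsub>N\<^esub> g s) \<in> module_hom R (self_module R) N" if "s \<in> S" for s
    using g[OF that] by (auto simp: module_hom_def self_module_def module_of_def N.smult_l_distr N.smult_assoc1)
  note u = direct_sum_universal[where M="?M" and I=S and h="\<lambda>s a. a \<odot>\<^bsub>N\<^esub> g s", OF c module_self[OF c] n h]
  show ?thesis
    apply (rule that[of "sum_extend S ?M N (\<lambda>s a. a \<odot>\<^bsub>N\<^esub> g s)"])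
    subgoal unfolding free_module_def using u(1) by blast
    subgoal for s unfolding free_gen_def using u(2)[of s "\<one>\<^bsub>R\<^esub>"] g by (simp add: self_module_def module_of_def)
    done
qed

lemma free_module_unique:
  assumes c: "cring R" and n: "module R N"
   and h: "h \<in> module_hom R (free_module R S) N" "h' \<in> module_hom R (free_module R S) N"
   and e: "\<And>s. s \<in> S \<Longrightarrow> h (free_gen R S s) = h' (free_gen R S s)"
   and x: "x \<in> carrier (free_module R S)"
  shows "h x = h' x"
proof (rule direct_sum_unique[where M="\<lambda>_. self_module R" and I=S, OF c _ n])
  interpret R: cring R by fact
  show "h \<in> module_hom R (direct_sum S (\<lambda>_. self_module R)) N" "h' \<in> module_hom R (direct_sum S (\<lambda>_. self_module R)) N" "x \<in> carrier (direct_sum S (\<lambda>_. self_module R))" using h x by (auto simp: free_module_def)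
  show "module R (self_module R)" by (rule module_self[OF c])
  fix s x assume s: "s \<in> S" and x: "x \<in> carrier (self_module R)"
  then have xr: "x \<in> carrier R" by (simp add: self_module_def module_of_def)
  have "sum_inj S (\<lambda>_. self_module R) s x = x \<odot>\<^bsub>free_module R S\<^esub> free_gen R S s"
    using xr s by (auto simp: sum_inj_def free_gen_def free_module_def direct_sum_smult self_module_def module_of_def intro!: restrict_ext)
  then show "h (sum_inj S (\<lambda>_. self_module R) s x) = h' (sum_inj S (\<lambda>_. self_module R) s x)"
    using module_hom_smult[OF h(1) free_gen_in[OF c s] xr] module_hom_smult[OF h(2) free_gen_in[OF c s] xr] e[OF s] by simp
qed

lemma tensor_relations_carrier: assumes "cring R" and m: "\<And>M. M \<in> set Ms \<Longrightarrow> module R M"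
  shows "tensor_relations R Ms \<subseteq> carrier (free_module R (tensor_words Ms))"
proof -
  interpret F: module R "free_module R (tensor_words Ms)" by (rule module_free[OF assms(1)])
  have "abelian_monoid (Ms ! i)" "module R (Ms!i)" if "i < length Ms" for i using m[of "Ms!i"] that by (auto simp: module_def abelian_group_def)
  note cl = abelian_monoid.a_closed[OF this(1)] module.smult_closed[OF this(2)]
  note fg = free_gen_in[OF assms(1)]
  show ?thesis unfolding tensor_relations_def Let_def
    by (auto intro!: F.minus_closed F.a_closed F.smult_closed fg tensor_words_update cl)
qed

lemma tensor_module: assumes "cring R" and m: "\<And>M. M \<in> set Ms \<Longrightarrow> module R M"
  shows "module R (tensor_product R Ms)" "submodule (tensor_kernel R Ms) R (free_module R (tensor_words Ms))"
proof -
  show s: "submodule (tensor_kernel R Ms) R (free_module R (tensor_words Ms))" unfolding tensor_kernel_def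
   by (rule span_submodule[OF module_free[OF assms(1)] tensor_relations_carrier[OF assms(1) m]])
  show "module R (tensor_product R Ms)" unfolding tensor_product_def
    by (rule quotient_module_props(1)[OF module_free[OF assms(1)] s])
qed

lemma tensor_universal:
  assumes c: "cring R" and m: "\<And>M. M \<in> set Ms \<Longrightarrow> module R M" and n: "module R N" and g: "multilinear R Ms N g"
  obtains h where "h \<in> module_hom R (tensor_product R Ms) N" "\<And>fs. fs \<in> tensor_words Ms \<Longrightarrow> h (pure_tensor R Ms fs) = g fs"
proof -
  let ?F = "free_module R (tensor_words Ms)" and ?e = "free_gen R (tensor_words Ms)"
  interpret F: module R ?F by (rule module_free[OF c])
  interpret N: module R N by fact
  have gc: "\<And>s. s \<in> tensor_words Ms \<Longrightarrow> g s \<in> carrier N" using g by (auto simp: multilinear_def)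
  obtain h where h: "h \<in> module_hom R ?F N" and hg: "\<And>s. s \<in> tensor_words Ms \<Longrightarrow> h (?e s) = g s"
    by (rule free_module_universal[OF c n gc]) auto
  have ab: "abelian_monoid (Ms ! i)" "module R (Ms!i)" if "i < length Ms" for i using m[of "Ms!i"] that by (auto simp: module_def abelian_group_def)
  note cl = abelian_monoid.a_closed[OF ab(1)] module.smult_closed[OF ab(2)]
  let ?K = "{x\<in>carrier ?F. h x = \<zero>\<^bsub>N\<^esub>}"
  have hm: "h (x \<ominus>\<^bsub>?F\<^esub> y) = \<zero>\<^bsub>N\<^esub>" if xy: "x \<in> carrier ?F" "y \<in> carrier ?F" "h x = h y" for x y
  proof -
    have "h x = h ((x \<ominus>\<^bsub>?F\<^esub> y) \<oplus>\<^bsub>?F\<^esub> y)" using xy by (simp add: F.minus_eq F.a_assoc F.l_neg)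
    also have "\<dots> = h (x \<ominus>\<^bsub>?F\<^esub> y) \<oplus>\<^bsub>N\<^esub> h y" by (rule module_hom_add[OF h]) (use xy in auto)
    finally have "h (x \<ominus>\<^bsub>?F\<^esub> y) \<oplus>\<^bsub>N\<^esub> h y = \<zero>\<^bsub>N\<^esub> \<oplus>\<^bsub>N\<^esub> h y" using xy module_hom_in[OF h] by simp
    then show ?thesis using xy module_hom_in[OF h] N.add.right_cancel[of "h y" "h (x \<ominus>\<^bsub>?F\<^esub> y)" "\<zero>\<^bsub>N\<^esub>"] by simp
  qed
  have "tensor_relations R Ms \<subseteq> ?K"
  proof
    fix z assume z: "z \<in> tensor_relations R Ms"
    then have zc: "z \<in> carrier ?F" using tensor_relations_carrier[OF c m] by blast
    from z consider fs i x y where "fs \<in> tensor_words Ms" "i < length Ms" "x \<in> carrier (Ms ! i)" "y \<in> carrier (Ms ! i)"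
       "z = ?e (fs[i := x \<oplus>\<^bsub>Ms ! i\<^esub> y]) \<ominus>\<^bsub>?F\<^esub> (?e (fs[i := x]) \<oplus>\<^bsub>?F\<^esub> ?e (fs[i := y]))"
      | fs i a x where "fs \<in> tensor_words Ms" "i < length Ms" "x \<in> carrier (Ms ! i)" "a \<in> carrier R"
       "z = ?e (fs[i := a \<odot>\<^bsub>Ms ! i\<^esub> x]) \<ominus>\<^bsub>?F\<^esub> (a \<odot>\<^bsub>?F\<^esub> ?e (fs[i := x]))"
      unfolding tensor_relations_def Let_def by blast
    then have "h z = \<zero>\<^bsub>N\<^esub>"
    proof cases
      case 1
      have w: "fs[i := x \<oplus>\<^bsub>Ms ! i\<^esub> y] \<in> tensor_words Ms" "fs[i := x] \<in> tensor_words Ms" "fs[i := y] \<in> tensor_words Ms"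
        using 1 by (auto intro!: tensor_words_update cl)
      show ?thesis unfolding 1(5)
        apply (rule hm)
        using w g 1 by (simp_all add: free_gen_in[OF c] module_hom_add[OF h] hg multilinear_def)
    next
      case 2
      have w: "fs[i := a \<odot>\<^bsub>Ms ! i\<^esub> x] \<in> tensor_words Ms" "fs[i := x] \<in> tensor_words Ms"
        using 2 by (auto intro!: tensor_words_update cl)
      show ?thesis unfolding 2(5)
        apply (rule hm)
        using w g 2 by (simp_all add: free_gen_in[OF c] module_hom_smult[OF h] hg multilinear_def)
    qed
    then show "z \<in> ?K" using zc by simp
  qed
  then have "tensor_kernel R Ms \<subseteq> ?K" unfolding tensor_kernel_def submodule_span_def
    using module_hom_kernel_submodule[OF F.module_axioms n h] by blast
  then have k: "\<And>x. x \<in> tensor_kernel R Ms \<Longrightarrow> h x = \<zero>\<^bsub>N\<^esub>" by blast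
  obtain k where "k \<in> module_hom R (tensor_product R Ms) N" "\<And>x. x \<in> carrier ?F \<Longrightarrow> k (tensor_kernel R Ms +>\<^bsub>?F\<^esub> x) = h x"
    unfolding tensor_product_def
    using quotient_module_lift[OF F.module_axioms tensor_module(2)[OF c m] n h k] by blast
  note kk = this
  show ?thesis by (rule that[OF kk(1)]) (use kk(2)[OF free_gen_in[OF c]] hg in \<open>simp add: pure_tensor_def\<close>)
qed

lemma tensor_unique:
  assumes c: "cring R" and m: "\<And>M. M \<in> set Ms \<Longrightarrow> module R M" and n: "module R N"
   and h: "h \<in> module_hom R (tensor_product R Ms) N" "h' \<in> module_hom R (tensor_product R Ms) N"
   and e: "\<And>s. s \<in> tensor_words Ms \<Longrightarrow> h (pure_tensor R Ms s) = h' (pure_tensor R Ms s)"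
   and x: "x \<in> carrier (tensor_product R Ms)"
  shows "h x = h' x"
proof -
  let ?F = "free_module R (tensor_words Ms)" and ?c = "\<lambda>x. tensor_kernel R Ms +>\<^bsub>free_module R (tensor_words Ms)\<^esub> x"
  note q = quotient_module_props[OF module_free[OF c] tensor_module(2)[OF c m], folded tensor_product_def]
  obtain y where y: "y \<in> carrier ?F" "x = ?c y" using x q(3) by auto
  have comp: "(\<lambda>y. k (?c y)) \<in> module_hom R ?F N" if "k \<in> module_hom R (tensor_product R Ms) N" for k
    using q(2) that by (auto simp: module_hom_def Pi_iff)
  have "(\<lambda>y. h (?c y)) y = (\<lambda>y. h' (?c y)) y"
    by (rule free_module_unique[OF c n comp[OF h(1)] comp[OF h(2)] _ y(1)]) (use e in \<open>auto simp: pure_tensor_def\<close>)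
  then show ?thesis using y by simp
qed

lemma (in linear_category) bar_mors_module: "X \<in> Ob C \<Longrightarrow> X' \<in> Ob C \<Longrightarrow> set Xs \<subseteq> Ob C \<Longrightarrow> M \<in> set (bar_mors C X X' Xs) \<Longrightarrow> module R M"
proof -
  assume a: "X \<in> Ob C" "X' \<in> Ob C" "set Xs \<subseteq> Ob C" and M: "M \<in> set (bar_mors C X X' Xs)"
  let ?Y = "X # Xs @ [X']"
  have y: "i < length ?Y \<Longrightarrow> ?Y ! i \<in> Ob C" for i using a nth_mem[of i ?Y] by auto
  obtain i where "i < length ?Y - 1" "M = Mor C (?Y ! Suc i) (?Y ! i)"
    using M unfolding bar_mors_def chain_mors_def set_map set_upt image_iff Bex_def atLeastLessThan_iff by blast
  then show "module R M" using y[of i] y[of "Suc i"] mor_module by simp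
qed

theorem bar_extend_unique_existence:
 assumes "linear_category R C"

  and X: "X \<in> Ob C" "X' \<in> Ob C" and n: "module R N"
   and g: "\<And>Xs. Xs \<in> bar_index C n \<Longrightarrow> multilinear R (bar_mors C X X' Xs) N (g Xs)"
  shows "\<exists>!h. h \<in> module_hom R (bar_module R C X X' n) N \<and>
        h \<in> extensional (carrier (bar_module R C X X' n)) \<and>
        (\<forall>Xs\<in>bar_index C n. \<forall>fs\<in>tensor_words (bar_mors C X X' Xs).
           h (bar_elem R C X X' n Xs fs) = g Xs fs)"
proof -
  interpret linear_category R C by fact
  let ?I = "bar_index C n" and ?T = "\<lambda>Xs. tensor_product R (bar_mors C X X' Xs)" and ?B = "bar_module R C X X' n"
  note c = base_ring
  have m: "M \<in> set (bar_mors C X X' Xs) \<Longrightarrow> module R M" if "Xs \<in> ?I" for M Xs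
    using bar_mors_module X that by (auto simp: bar_index_def)
  have t: "module R (?T Xs)" if "Xs \<in> ?I" for Xs by (rule tensor_module(1)[OF c m[OF that]])
  have b: "module R ?B" unfolding bar_module_def by (rule module_direct_sum[OF c t])
  have pc: "pure_tensor R (bar_mors C X X' Xs) fs \<in> carrier (?T Xs)" if "Xs \<in> ?I" "fs \<in> tensor_words (bar_mors C X X' Xs)" for Xs fs
    using module_hom_in[OF quotient_module_props(2)[OF module_free[OF c] tensor_module(2)[OF c m[OF that(1)]]] free_gen_in[OF c that(2)]]
     by (simp add: tensor_product_def pure_tensor_def)
  have "\<forall>Xs\<in>?I. \<exists>h. h \<in> module_hom R (?T Xs) N \<and> (\<forall>fs\<in>tensor_words (bar_mors C X X' Xs). h (pure_tensor R (bar_mors C X X' Xs) fs) = g Xs fs)"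
  proof
    fix Xs assume "Xs \<in> ?I"
    note ii = this
    show "\<exists>h. h \<in> module_hom R (?T Xs) N \<and> (\<forall>fs\<in>tensor_words (bar_mors C X X' Xs). h (pure_tensor R (bar_mors C X X' Xs) fs) = g Xs fs)"
      by (rule tensor_universal[OF c m[OF ii] n g[OF ii]]) blast+
  qed
  then obtain h where h: "\<And>Xs. Xs \<in> ?I \<Longrightarrow> h Xs \<in> module_hom R (?T Xs) N"
    and hg: "\<And>Xs fs. Xs \<in> ?I \<Longrightarrow> fs\<in>tensor_words (bar_mors C X X' Xs) \<Longrightarrow> h Xs (pure_tensor R (bar_mors C X X' Xs) fs) = g Xs fs"
    by metis
  have bc: "bar_elem R C X X' n Xs fs \<in> carrier ?B" if "Xs \<in> ?I" "fs \<in> tensor_words (bar_mors C X X' Xs)" for Xs fs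
    unfolding bar_elem_def bar_module_def
    using module_hom_in[OF sum_inj_hom[where M="?T", OF c t that(1)] pc[OF that]] .
  let ?h = "restrict (sum_extend ?I ?T N h) (carrier ?B)"
  interpret B: module R ?B by (rule b)
  show ?thesis
  proof (rule ex1I[of _ ?h], intro conjI ballI)
    have e: "sum_extend ?I ?T N h \<in> module_hom R ?B N" unfolding bar_module_def by (rule direct_sum_universal(1)[OF c t n h])
    show "?h \<in> module_hom R ?B N" using e by (auto simp: module_hom_def)
    show "?h \<in> extensional (carrier ?B)" by simp
    fix Xs fs assume "Xs \<in> ?I" "fs \<in> tensor_words (bar_mors C X X' Xs)"
    then show "?h (bar_elem R C X X' n Xs fs) = g Xs fs"
      using bc direct_sum_universal(2)[where M="?T", OF c t n h] pc hg by (simp add: bar_elem_def)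
  next
    fix k assume k: "k \<in> module_hom R ?B N \<and> k \<in> extensional (carrier ?B) \<and> (\<forall>Xs\<in>?I. \<forall>fs\<in>tensor_words (bar_mors C X X' Xs). k (bar_elem R C X X' n Xs fs) = g Xs fs)"
    have e: "sum_extend ?I ?T N h \<in> module_hom R ?B N" unfolding bar_module_def by (rule direct_sum_universal(1)[OF c t n h])
    have "k x = sum_extend ?I ?T N h x" if x: "x \<in> carrier ?B" for x
    proof (rule direct_sum_unique[where M="?T" and I="?I", OF c t n])
      show kk: "k \<in> module_hom R (direct_sum ?I ?T) N" "sum_extend ?I ?T N h \<in> module_hom R (direct_sum ?I ?T) N" "x \<in> carrier (direct_sum ?I ?T)" using k e x by (auto simp: bar_module_def)
      fix Xs y assume Xs: "Xs \<in> ?I" and y: "y \<in> carrier (?T Xs)"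
      have comp: "(\<lambda>y. f (sum_inj ?I ?T Xs y)) \<in> module_hom R (?T Xs) N" if "f \<in> module_hom R (direct_sum ?I ?T) N" for f
        using sum_inj_hom[where M="?T", OF c t Xs] that by (auto simp: module_hom_def Pi_iff)
      have "(\<lambda>y. k (sum_inj ?I ?T Xs y)) y = (\<lambda>y. sum_extend ?I ?T N h (sum_inj ?I ?T Xs y)) y"
        apply (rule tensor_unique[OF c m[OF Xs] n comp[OF kk(1)] comp[OF kk(2)] _ y])
        using k Xs pc hg direct_sum_universal(2)[where M="?T", OF c t n h Xs] by (auto simp: bar_elem_def)
      then show "k (sum_inj ?I ?T Xs y) = sum_extend ?I ?T N h (sum_inj ?I ?T Xs y)" .
    qed
    then show "k = ?h" using k by (auto simp: extensional_def restrict_def)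
  qed
qed

end

theory Submission
  imports Defs
begin

text \<open>By freeness of the bar complex as a bimodule, a bimodule map out of it is determined by its values on
  the elements \<open>[id, f\<^sub>1, \<dots>, f\<^sub>r, id]\<close>, where it may be any multilinear function. Over projective
  hom modules, a bimodule map with values in coboundaries therefore lifts through the differential of the
  target. Existence and uniqueness are two instances of solving \<open>D h = \<sigma>\<close> for a closed \<open>\<sigma>\<close> of degree
  \<open>l + 1\<close>: existence is \<open>l = 0\<close> and \<open>\<sigma> = 0\<close>, starting from representatives of \<open>\<eta>\<close>; uniqueness is \<open>l = -1\<close> and
  \<open>\<sigma>\<close> the difference of two extensions, which is exact on \<open>[id, id]\<close>. In bar degree \<open>-r < 0\<close> the obstruction is a cocycle
  of degree \<open>l + 1 - r\<close>, hence exact for \<open>l + 1 < r\<close> by unobstructedness; the remaining case, \<open>l = 0\<close> and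
  \<open>r = 1\<close>, is naturality of \<open>\<eta>\<close> up to homotopy.\<close>

section \<open>Module homomorphisms\<close>

text \<open>Projectivity is given for the hom modules, while the bar complex consists of tensor
  products of them. Multilinear functions are therefore lifted directly, without passing through
  projectivity of tensor products: a splitting of the free module on \<open>carrier P\<close>
  provides coordinates on \<open>P\<close>, and with these a mere choice of preimages is made linear
  one slot at a time. The coordinates also bridge the gap between the element types fixed in
  \<open>projective_module\<close> and the targets that occur here. The equation
  \<open>D h = \<sigma>\<close> reads \<open>d h = \<sigma> + (-1)^l h d\<close>. Its right-hand
  side in one bar degree is a cocycle because of closedness of \<sigma>, of \<open>d d = 0\<close>
  in the bar complex, and of the equation in the preceding bar degree alone. Hence each component
  has to remember only its predecessor, and the family arises by dependent choice. Naturality in the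
  homotopy category is an equality of unions of cosets over all representatives. It has to be turned
  into exactness of a difference for one fixed choice of representatives before it can serve as the
  vanishing of an obstruction.\<close>

lemma module_homI:
  assumes "\<And>x. x \<in> carrier M \<Longrightarrow> h x \<in> carrier N"
    and "\<And>x y. x \<in> carrier M \<Longrightarrow> y \<in> carrier M \<Longrightarrow> h (x \<oplus>\<^bsub>M\<^esub> y) = h x \<oplus>\<^bsub>N\<^esub> h y"
    and "\<And>a x. a \<in> carrier R \<Longrightarrow> x \<in> carrier M \<Longrightarrow> h (a \<odot>\<^bsub>M\<^esub> x) = a \<odot>\<^bsub>N\<^esub> h x"
  shows "h \<in> module_hom R M N"
  using assms by (auto simp: module_hom_def)

lemma module_hom_cong:
  assumes "module R M" "h \<in> module_hom R M N" "\<And>x. x \<in> carrier M \<Longrightarrow> k x = h x"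
  shows "k \<in> module_hom R M N"
proof -
  interpret M: module R M by fact
  show ?thesis using assms(2,3) by (auto simp: module_hom_def Pi_iff)
qed

lemma module_hom_restrict:
  "module R M \<Longrightarrow> h \<in> module_hom R M N \<Longrightarrow> restrict h (carrier M) \<in> module_hom R M N"
  by (rule module_hom_cong) auto

lemma module_hom_id: "(\<lambda>x. x) \<in> module_hom R M M"
  by (rule module_homI) auto

lemma module_hom_compose:
  assumes "h \<in> module_hom R M N" "k \<in> module_hom R N P"
  shows "(\<lambda>x. k (h x)) \<in> module_hom R M P"
  using assms by (auto simp: module_hom_def Pi_iff)

lemma module_hom_const_zero:
  assumes "module R M" "module R N"
  shows "(\<lambda>x. \<zero>\<^bsub>N\<^esub>) \<in> module_hom R M N"
proof -
  interpret N: module R N by fact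
  show ?thesis by (rule module_homI) auto
qed

lemma module_hom_uminus:
  assumes "module R M" "module R N" "h \<in> module_hom R M N" "x \<in> carrier M"
  shows "h (\<ominus>\<^bsub>M\<^esub> x) = \<ominus>\<^bsub>N\<^esub> h x"
proof -
  interpret M: module R M by fact
  interpret N: module R N by fact
  have "h (\<ominus>\<^bsub>M\<^esub> x) \<oplus>\<^bsub>N\<^esub> h x = \<zero>\<^bsub>N\<^esub>"
    using assms(4) module_hom_add[OF assms(3), of "\<ominus>\<^bsub>M\<^esub> x" x] module_hom_zero[OF assms(1-3)]
    by (simp add: M.l_neg)
  then show ?thesis
    using assms(4) module_hom_in[OF assms(3)] by (metis M.a_inv_closed N.minus_equality)
qed

lemma module_hom_minus:
  assumes "module R M" "module R N" "h \<in> module_hom R M N" "x \<in> carrier M" "y \<in> carrier M"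
  shows "h (x \<ominus>\<^bsub>M\<^esub> y) = h x \<ominus>\<^bsub>N\<^esub> h y"
proof -
  interpret M: module R M by fact
  interpret N: module R N by fact
  show ?thesis
    using assms(4,5) module_hom_add[OF assms(3)] module_hom_uminus[OF assms(1-3)]
    by (simp add: M.minus_eq N.minus_eq)
qed

lemma module_hom_signed:
  assumes "module R M" "module R N" "h \<in> module_hom R M N" "x \<in> carrier M"
  shows "h (signed M n x) = signed N n (h x)"
  using module_hom_uminus[OF assms] by (simp add: signed_def)

lemma module_hom_finsum:
  assumes "module R M" "module R N" "h \<in> module_hom R M N" "finite I"
    and "\<And>i. i \<in> I \<Longrightarrow> x i \<in> carrier M"
  shows "h (\<Oplus>\<^bsub>M\<^esub>i\<in>I. x i) = (\<Oplus>\<^bsub>N\<^esub>i\<in>I. h (x i))"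
proof -
  interpret M: module R M by fact
  interpret N: module R N by fact
  show ?thesis
    using assms(4,5)
  proof (induction rule: finite_induct)
    case empty
    show ?case using module_hom_zero[OF assms(1-3)] by simp
  next
    case (insert j J)
    then have "h (\<Oplus>\<^bsub>M\<^esub>i\<in>insert j J. x i) = h (x j \<oplus>\<^bsub>M\<^esub> (\<Oplus>\<^bsub>M\<^esub>i\<in>J. x i))"
      by (simp add: Pi_iff)
    also have "\<dots> = h (x j) \<oplus>\<^bsub>N\<^esub> h (\<Oplus>\<^bsub>M\<^esub>i\<in>J. x i)"
      using insert.prems by (intro module_hom_add[OF assms(3)] M.finsum_closed) auto
    also have "\<dots> = (\<Oplus>\<^bsub>N\<^esub>i\<in>insert j J. h (x i))"
      using insert by (simp add: Pi_iff module_hom_in[OF assms(3)])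
    finally show ?case .
  qed
qed

lemma signed_closed:
  assumes "module R M" "x \<in> carrier M"
  shows "signed M n x \<in> carrier M"
proof -
  interpret M: module R M by fact
  show ?thesis using assms(2) by (simp add: signed_def)
qed

lemma signed_hom:
  assumes "module R M"
  shows "signed M n \<in> module_hom R M M"
proof -
  interpret M: module R M by fact
  show ?thesis by (rule module_homI) (auto simp: signed_def M.minus_add M.smult_r_minus)
qed

lemma module_hom_sum:
  assumes "module R M" "module R N" "h \<in> module_hom R M N" "k \<in> module_hom R M N"
  shows "(\<lambda>x. h x \<oplus>\<^bsub>N\<^esub> k x) \<in> module_hom R M N"
proof -
  interpret N: module R N by fact
  show ?thesis
    using module_hom_in[OF assms(3)] module_hom_in[OF assms(4)]
    by (intro module_homI)
      (auto simp: module_hom_add[OF assms(3)] module_hom_add[OF assms(4)] N.add.m_ac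
        module_hom_smult[OF assms(3)] module_hom_smult[OF assms(4)] N.smult_r_distr)
qed

lemma module_hom_difference:
  assumes "module R M" "module R N" "h \<in> module_hom R M N" "k \<in> module_hom R M N"
  shows "(\<lambda>x. h x \<ominus>\<^bsub>N\<^esub> k x) \<in> module_hom R M N"
proof -
  interpret N: module R N by fact
  have "(\<lambda>x. signed N 1 (k x)) \<in> module_hom R M N"
    by (rule module_hom_compose[OF assms(4) signed_hom[OF assms(2)]])
  from module_hom_sum[OF assms(1-3) this] show ?thesis
    by (simp add: signed_def N.minus_eq)
qed

lemma module_hom_finsum_fun:
  assumes "module R M" "module R N" "finite I" "\<And>i. i \<in> I \<Longrightarrow> h i \<in> module_hom R M N"
  shows "(\<lambda>x. \<Oplus>\<^bsub>N\<^esub>i\<in>I. h i x) \<in> module_hom R M N"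
proof -
  interpret M: module R M by fact
  interpret N: module R N by fact
  note cl = module_hom_in[OF assms(4)]
  show ?thesis
  proof (rule module_homI)
    show "(\<Oplus>\<^bsub>N\<^esub>i\<in>I. h i x) \<in> carrier N" if "x \<in> carrier M" for x
      using that cl by (intro N.finsum_closed) auto
    show "(\<Oplus>\<^bsub>N\<^esub>i\<in>I. h i (x \<oplus>\<^bsub>M\<^esub> y)) = (\<Oplus>\<^bsub>N\<^esub>i\<in>I. h i x) \<oplus>\<^bsub>N\<^esub> (\<Oplus>\<^bsub>N\<^esub>i\<in>I. h i y)"
      if "x \<in> carrier M" "y \<in> carrier M" for x y
    proof -
      have "(\<Oplus>\<^bsub>N\<^esub>i\<in>I. h i (x \<oplus>\<^bsub>M\<^esub> y)) = (\<Oplus>\<^bsub>N\<^esub>i\<in>I. h i x \<oplus>\<^bsub>N\<^esub> h i y)"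
        using that cl by (intro N.finsum_cong') (auto simp: module_hom_add[OF assms(4)])
      then show ?thesis using that cl by (simp add: N.finsum_addf Pi_iff)
    qed
    show "(\<Oplus>\<^bsub>N\<^esub>i\<in>I. h i (a \<odot>\<^bsub>M\<^esub> x)) = a \<odot>\<^bsub>N\<^esub> (\<Oplus>\<^bsub>N\<^esub>i\<in>I. h i x)"
      if "a \<in> carrier R" "x \<in> carrier M" for a x
    proof -
      have "(\<Oplus>\<^bsub>N\<^esub>i\<in>I. h i (a \<odot>\<^bsub>M\<^esub> x)) = (\<Oplus>\<^bsub>N\<^esub>i\<in>I. a \<odot>\<^bsub>N\<^esub> h i x)"
        using that cl by (intro N.finsum_cong') (auto simp: module_hom_smult[OF assms(4)])
      then show ?thesis using that cl assms(3) by (simp add: N.finsum_smult_ldistr Pi_iff)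
    qed
  qed
qed

lemma module_minus_eq_zeroD:
  assumes "module R M" "x \<in> carrier M" "y \<in> carrier M" "x \<ominus>\<^bsub>M\<^esub> y = \<zero>\<^bsub>M\<^esub>"
  shows "x = y"
proof -
  interpret M: module R M by fact
  show ?thesis using assms(2-4) M.minus_equality[of x "\<ominus>\<^bsub>M\<^esub> y"] by (simp add: M.minus_eq)
qed

text \<open>This is the shape that remains of \<open>d (d f)\<close> in a hom complex once the
  squares of the two differentials are zero: the mixed term \<open>x\<close> occurs with the signs
  \<open>-(-1)^k\<close> and \<open>-(-1)^(k + 1)\<close>.\<close>

lemma signed_cancel:
  assumes "module R M" "x \<in> carrier M"
  shows "(\<zero>\<^bsub>M\<^esub> \<ominus>\<^bsub>M\<^esub> signed M k x) \<ominus>\<^bsub>M\<^esub> signed M (k + 1) (x \<ominus>\<^bsub>M\<^esub> signed M k \<zero>\<^bsub>M\<^esub>) = \<zero>\<^bsub>M\<^esub>"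
proof -
  interpret M: module R M by fact
  have z: "\<ominus>\<^bsub>M\<^esub> \<zero>\<^bsub>M\<^esub> = \<zero>\<^bsub>M\<^esub>" by (rule M.minus_equality) auto
  have x: "x \<ominus>\<^bsub>M\<^esub> signed M k \<zero>\<^bsub>M\<^esub> = x" using assms(2) by (simp add: signed_def M.minus_eq z)
  show ?thesis unfolding x using assms(2) by (auto simp: signed_def M.minus_eq M.r_neg M.l_neg)
qed

lemma cocycles_hom: "h \<in> module_hom R M (cocycles K n) \<Longrightarrow> h \<in> module_hom R M (grade K n)"
  by (auto simp: module_hom_def cocycles_def)


section \<open>Lifting multilinear maps out of projective modules\<close>

text \<open>If \<open>s\<close> is a section of the free module on \<^term>\<open>carrier P\<close> over \<open>P\<close>, the coordinates \<open>s x p\<close>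
  turn an arbitrary function \<open>\<phi>\<close> on \<open>P\<close> into a linear map, and they leave linear maps unchanged.\<close>

definition linearize ::
    "'k ring \<Rightarrow> ('k, 'p) module \<Rightarrow> ('p \<Rightarrow> 'p \<Rightarrow> 'k) \<Rightarrow> ('k, 'n) module \<Rightarrow> ('p \<Rightarrow> 'n) \<Rightarrow> 'p \<Rightarrow> 'n"
  where
  "linearize R P s N \<phi> x =
     sum_extend (carrier P) (\<lambda>_. self_module R) N (\<lambda>p a. a \<odot>\<^bsub>N\<^esub> \<phi> p) (s x)"

text \<open>The second clause is the dual basis identity: \<open>x\<close> is the sum of the
  \<open>s x p\<close> times \<open>p\<close>, that is, \<open>s\<close> splits the canonical
  surjection from the free module.\<close>

definition projective_section :: "'k ring \<Rightarrow> ('k, 'p) module \<Rightarrow> ('p \<Rightarrow> 'p \<Rightarrow> 'k) \<Rightarrow> bool" where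
  "projective_section R P s \<longleftrightarrow>
     s \<in> module_hom R P (free_module R (carrier P)) \<and>
     (\<forall>x\<in>carrier P. linearize R P s P (\<lambda>p. p) x = x)"

text \<open>Unlike in \<open>free_module_universal\<close>, the extension is here an explicit finite
  sum, the one to which \<open>linearize\<close> unfolds.\<close>

lemma free_extend_hom:
  assumes c: "cring R" and N: "module R N" and g: "\<And>p. p \<in> S \<Longrightarrow> g p \<in> carrier N"
  defines "L \<equiv> sum_extend S (\<lambda>_. self_module R) N (\<lambda>p a. a \<odot>\<^bsub>N\<^esub> g p)"
  shows "L \<in> module_hom R (free_module R S) N" "\<And>p. p \<in> S \<Longrightarrow> L (free_gen R S p) = g p"
proof -
  interpret N: module R N by fact
  have h: "(\<lambda>a. a \<odot>\<^bsub>N\<^esub> g p) \<in> module_hom R (self_module R) N" if "p \<in> S" for p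
    using g[OF that] by (auto simp: module_hom_def self_module_def module_of_def N.smult_l_distr N.smult_assoc1)
  note u = direct_sum_universal[where M="\<lambda>_. self_module R" and I=S
      and h="\<lambda>p a. a \<odot>\<^bsub>N\<^esub> g p", OF c module_self[OF c] N h]
  show "L \<in> module_hom R (free_module R S) N"
    unfolding L_def free_module_def by (rule u(1))
  show "L (free_gen R S p) = g p" if "p \<in> S" for p
    unfolding L_def free_gen_def using u(2)[of p "\<one>\<^bsub>R\<^esub>"] that g
    by (simp add: self_module_def module_of_def)
qed

text \<open>The lifting property is applied to the canonical surjection from the free module on
  \<open>carrier P\<close> and to the identity of \<open>P\<close>. All later lifts go through the
  section obtained here.\<close>

lemma projective_section_exists:
  assumes c: "cring R" and P: "projective_module R P"
  shows "\<exists>s. projective_section R P s"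
proof -
  let ?F = "free_module R (carrier P)"
  let ?\<pi> = "sum_extend (carrier P) (\<lambda>_. self_module R) P (\<lambda>p a. a \<odot>\<^bsub>P\<^esub> p)"
  have m: "module R P" using P by (simp add: projective_module_def)
  have \<pi>: "?\<pi> \<in> module_hom R ?F P"
    by (rule free_extend_hom(1)[OF c m])
  have gen: "?\<pi> (free_gen R (carrier P) p) = p" if "p \<in> carrier P" for p
    by (rule free_extend_hom(2)[OF c m _ that])
  have "?\<pi> ` carrier ?F = carrier P"
  proof
    show "?\<pi> ` carrier ?F \<subseteq> carrier P" using module_hom_in[OF \<pi>] by auto
    show "carrier P \<subseteq> ?\<pi> ` carrier ?F"
    proof
      fix x assume x: "x \<in> carrier P"
      have "?\<pi> (free_gen R (carrier P) x) \<in> ?\<pi> ` carrier ?F"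
        by (rule imageI[OF free_gen_in[OF c x]])
      then show "x \<in> ?\<pi> ` carrier ?F" by (simp only: gen[OF x])
    qed
  qed
  then have "\<exists>s \<in> module_hom R P ?F. \<forall>x\<in>carrier P. ?\<pi> (s x) = x"
    using P \<pi> m module_free[OF c] module_hom_id[of R P] unfolding projective_module_def by meson
  then show ?thesis unfolding projective_section_def linearize_def by blast
qed

context
  fixes R :: "'k ring" and P :: "('k, 'p) module" and s :: "'p \<Rightarrow> 'p \<Rightarrow> 'k"
  assumes c: "cring R" and P: "module R P" and s: "projective_section R P s"
begin

lemma linearize_hom:
  assumes "module R N" "\<And>p. p \<in> carrier P \<Longrightarrow> \<phi> p \<in> carrier N"
  shows "linearize R P s N \<phi> \<in> module_hom R P N"
  using module_hom_compose[where h=s and M=P, OF _ free_extend_hom(1)[OF c assms]] s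
  by (simp add: projective_section_def linearize_def[abs_def])

lemma section_coeff:
  assumes "x \<in> carrier P"
  shows "finite {p \<in> carrier P. s x p \<noteq> \<zero>\<^bsub>self_module R\<^esub>}" "\<And>p. p \<in> carrier P \<Longrightarrow> s x p \<in> carrier R"
proof -
  have "s x \<in> carrier (free_module R (carrier P))"
    using assms s module_hom_in by (auto simp: projective_section_def)
  then show "finite {p \<in> carrier P. s x p \<noteq> \<zero>\<^bsub>self_module R\<^esub>}"
    "\<And>p. p \<in> carrier P \<Longrightarrow> s x p \<in> carrier R"
    by (auto simp: free_module_def direct_sum_carrier self_module_def module_of_def)
qed

text \<open>The coefficients depend on \<open>x\<close> but not on the target, so \<open>h\<close>
  passes through the finite sum.\<close>

lemma linearize_compose:
  assumes "module R N" "module R Q" "h \<in> module_hom R N Q"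
    and "\<And>p. p \<in> carrier P \<Longrightarrow> \<phi> p \<in> carrier N" "x \<in> carrier P"
  shows "h (linearize R P s N \<phi> x) = linearize R P s Q (\<lambda>p. h (\<phi> p)) x"
proof -
  interpret N: module R N by fact
  interpret Q: module R Q by fact
  note sc = section_coeff[OF assms(5)]
  show ?thesis
    unfolding linearize_def sum_extend_def
    using sc assms(4) module_hom_in[OF assms(3)]
    by (subst module_hom_finsum[OF assms(1-3)])
      (auto intro!: Q.finsum_cong' simp: module_hom_smult[OF assms(3)])
qed

text \<open>A homomorphism \<phi> carries the dual basis expansion of \<open>x\<close> to the
  expansion of \<open>\<phi> x\<close>.\<close>

lemma linearize_of_hom:
  assumes "module R N" "\<phi> \<in> module_hom R P N" "x \<in> carrier P"
  shows "linearize R P s N \<phi> x = \<phi> x"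
  using linearize_compose[OF P assms(1,2), of "\<lambda>p. p" x] assms(3) s
  by (simp add: projective_section_def)

lemma linearize_cong:
  assumes "module R N" "\<And>p. p \<in> carrier P \<Longrightarrow> \<phi> p = \<psi> p" "\<And>p. p \<in> carrier P \<Longrightarrow> \<psi> p \<in> carrier N"
    and "x \<in> carrier P"
  shows "linearize R P s N \<phi> x = linearize R P s N \<psi> x"
proof -
  interpret N: module R N by fact
  show ?thesis unfolding linearize_def sum_extend_def
    using assms section_coeff[OF assms(4)] by (intro N.finsum_cong') auto
qed

text \<open>For fixed \<open>x\<close> both the summation range and the coefficients are fixed, so
  this is one finite linear combination of homomorphisms. Scalar multiplication is itself linear
  because \<open>R\<close> is commutative.\<close>

lemma linearize_family_hom:
  assumes "module R M" "module R N" "x \<in> carrier P"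
    and "\<And>p. p \<in> carrier P \<Longrightarrow> (\<lambda>y. \<phi> y p) \<in> module_hom R M N"
  shows "(\<lambda>y. linearize R P s N (\<phi> y) x) \<in> module_hom R M N"
proof -
  interpret N: module R N by fact
  have sm: "(\<lambda>y. a \<odot>\<^bsub>N\<^esub> y) \<in> module_hom R N N" if "a \<in> carrier R" for a
    using that by (intro module_homI) (auto simp: N.smult_r_distr N.smult_assoc1[symmetric] N.m_comm)
  show ?thesis unfolding linearize_def sum_extend_def
    using assms(4) section_coeff[OF assms(3)]
    by (intro module_hom_finsum_fun[OF assms(1,2)] module_hom_compose[OF _ sm]) auto
qed

end

section \<open>Multilinear functions on words\<close>

lemma tensor_words_nth: "fs \<in> tensor_words Ms \<Longrightarrow> i < length Ms \<Longrightarrow> fs ! i \<in> carrier (Ms ! i)"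
  by (simp add: tensor_words_def list_all2_conv_all_nth)

lemma tensor_words_length: "fs \<in> tensor_words Ms \<Longrightarrow> length fs = length Ms"
  by (simp add: tensor_words_def list_all2_conv_all_nth)

lemma multilinear_iff:
  "multilinear R Ms N g \<longleftrightarrow>
     (\<forall>fs\<in>tensor_words Ms. g fs \<in> carrier N) \<and>
     (\<forall>fs\<in>tensor_words Ms. \<forall>i<length Ms. (\<lambda>x. g (fs[i := x])) \<in> module_hom R (Ms ! i) N)"
  by (auto simp: multilinear_def module_hom_def Pi_iff tensor_words_update)

lemma multilinear_slot:
  "multilinear R Ms N g \<Longrightarrow> fs \<in> tensor_words Ms \<Longrightarrow> i < length Ms \<Longrightarrow>
    (\<lambda>x. g (fs[i := x])) \<in> module_hom R (Ms ! i) N"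
  by (simp add: multilinear_iff)

lemma multilinear_compose:
  assumes g: "multilinear R Ms N g" and h: "h \<in> module_hom R N P"
  shows "multilinear R Ms P (\<lambda>fs. h (g fs))"
  unfolding multilinear_iff
proof (intro conjI ballI allI impI)
  show "h (g fs) \<in> carrier P" if "fs \<in> tensor_words Ms" for fs
    using g that by (auto simp: multilinear_iff intro: module_hom_in[OF h])
  show "(\<lambda>x. h (g (fs[i := x]))) \<in> module_hom R (Ms ! i) P"
    if "fs \<in> tensor_words Ms" "i < length Ms" for fs i
    by (rule module_hom_compose[OF multilinear_slot[OF g that] h])
qed

lemma multilinear_cong:
  assumes "multilinear R Ms N g" "\<And>fs. fs \<in> tensor_words Ms \<Longrightarrow> k fs = g fs"
    and m: "\<And>M. M \<in> set Ms \<Longrightarrow> module R M"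
  shows "multilinear R Ms N k"
  unfolding multilinear_iff
proof (intro conjI ballI allI impI)
  show "k fs \<in> carrier N" if "fs \<in> tensor_words Ms" for fs
    using assms(1,2) that by (simp add: multilinear_iff)
  show "(\<lambda>x. k (fs[i := x])) \<in> module_hom R (Ms ! i) N"
    if "fs \<in> tensor_words Ms" "i < length Ms" for fs i
    by (rule module_hom_cong[OF m multilinear_slot[OF assms(1) that]])
      (use that in \<open>auto intro: assms(2) tensor_words_update\<close>)
qed

text \<open>Precomposition in slot \<open>j\<close> exchanges the module of that slot, which is why
  \<open>T\<close> lives over the updated list. The bar action is obtained from this, once for each
  of the two end slots.\<close>

lemma multilinear_update:
  assumes T: "multilinear R (Ms[j := P]) N T" and u: "u \<in> module_hom R (Ms ! j) P"
    and j: "j < length Ms"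
  shows "multilinear R Ms N (\<lambda>fs. T (fs[j := u (fs ! j)]))"
  unfolding multilinear_iff
proof (intro conjI ballI allI impI)
  have W: "fs[j := u (fs ! j)] \<in> tensor_words (Ms[j := P])" if "fs \<in> tensor_words Ms" for fs
    using that module_hom_in[OF u] j
    by (auto simp: tensor_words_def list_all2_conv_all_nth nth_list_update)
  fix fs assume fs: "fs \<in> tensor_words Ms"
  show "T (fs[j := u (fs ! j)]) \<in> carrier N" using T W[OF fs] by (simp add: multilinear_iff)
  have len: "length fs = length Ms" by (rule tensor_words_length[OF fs])
  fix i assume i: "i < length Ms"
  have s: "(\<lambda>x. T (fs[j := u (fs ! j), i := x])) \<in> module_hom R (Ms[j := P] ! i) N"
    by (rule multilinear_slot[OF T W[OF fs]]) (use i in simp)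
  show "(\<lambda>x. T (fs[i := x, j := u (fs[i := x] ! j)])) \<in> module_hom R (Ms ! i) N"
  proof (cases "i = j")
    case True
    with s j have s': "(\<lambda>x. T (fs[j := x])) \<in> module_hom R P N" by simp
    show ?thesis using module_hom_compose[OF u s'] True j len by simp
  next
    case False
    then show ?thesis using s by (simp add: list_update_swap[of i j])
  qed
qed

text \<open>An arbitrary lift is made linear in one slot after the other; linearity in the earlier slots
  survives because \<^const>\<open>linearize\<close> is itself linear in the function.\<close>

lemma multilinear_lift:
  assumes c: "cring R" and proj: "\<And>M. M \<in> set Ms \<Longrightarrow> projective_module R M"
    and N: "module R N" and Q: "module R Q" and p: "p \<in> module_hom R N Q"
    and g: "multilinear R Ms Q g" and im: "\<And>fs. fs \<in> tensor_words Ms \<Longrightarrow> g fs \<in> p ` carrier N"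
  shows "\<exists>\<phi>. multilinear R Ms N \<phi> \<and> (\<forall>fs\<in>tensor_words Ms. p (\<phi> fs) = g fs)"
proof -
  let ?W = "tensor_words Ms"
  have M: "module R (Ms ! i)" if "i < length Ms" for i
    using proj[of "Ms ! i"] that by (simp add: projective_module_def)
  \<comment> \<open>The invariant is a lift that is linear in the first \<open>k\<close> slots. For
    \<open>k = 0\<close> any choice of preimages will do.\<close>
  have "\<exists>\<phi>. (\<forall>fs\<in>?W. \<phi> fs \<in> carrier N \<and> p (\<phi> fs) = g fs) \<and>
      (\<forall>fs\<in>?W. \<forall>i<k. (\<lambda>x. \<phi> (fs[i := x])) \<in> module_hom R (Ms ! i) N)" if "k \<le> length Ms" for k
    using that
  proof (induction k)
    case 0
    have "\<forall>fs\<in>?W. \<exists>y. y \<in> carrier N \<and> p y = g fs" using im by force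
    then show ?case by (metis not_less_zero)
  next
    case (Suc k)
    have "k \<le> length Ms" using Suc.prems by simp
    from Suc.IH[OF this] obtain \<phi> where \<phi>: "\<And>fs. fs \<in> ?W \<Longrightarrow> \<phi> fs \<in> carrier N" "\<And>fs. fs \<in> ?W \<Longrightarrow> p (\<phi> fs) = g fs"
      and lin: "\<And>fs i. fs \<in> ?W \<Longrightarrow> i < k \<Longrightarrow> (\<lambda>x. \<phi> (fs[i := x])) \<in> module_hom R (Ms ! i) N"
      by blast
    have k: "k < length Ms" using Suc.prems by simp
    let ?P = "Ms ! k"
    obtain s where s: "projective_section R ?P s"
      using projective_section_exists[OF c proj[OF nth_mem[OF k]]] by blast
    \<comment> \<open>The old values with slot \<open>k\<close> overwritten by the various
      \<open>q\<close>, weighted by the coordinates of the actual entry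
      \<open>fs ! k\<close>.\<close>
    define \<psi> where "\<psi> fs = linearize R ?P s N (\<lambda>q. \<phi> (fs[k := q])) (fs ! k)" for fs
    have up: "\<phi> (fs[k := q]) \<in> carrier N" if "fs \<in> ?W" "q \<in> carrier ?P" for fs q
      by (rule \<phi>(1)[OF tensor_words_update[OF that]])
    note lh = linearize_hom[OF c M[OF k] s N]
    show ?case
    proof (intro exI[of _ \<psi>] conjI ballI allI impI)
      fix fs assume fs: "fs \<in> ?W"
      have x: "fs ! k \<in> carrier ?P" by (rule tensor_words_nth[OF fs k])
      show "\<psi> fs \<in> carrier N" unfolding \<psi>_def by (rule module_hom_in[OF lh[OF up[OF fs]] x])
      \<comment> \<open>The new function is still a lift: \<open>p\<close> passes through
        \<open>linearize\<close>, and \<open>g\<close> is already linear in slot \<open>k\<close>,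
        so that linearizing it changes nothing.\<close>
      have "p (\<psi> fs) = linearize R ?P s Q (\<lambda>q. p (\<phi> (fs[k := q]))) (fs ! k)"
        unfolding \<psi>_def by (rule linearize_compose[OF c M[OF k] s N Q p up[OF fs] x])
      also have "\<dots> = linearize R ?P s Q (\<lambda>q. g (fs[k := q])) (fs ! k)"
        by (rule linearize_cong[OF c M[OF k] s Q _ _ x])
          (use fs \<phi>(2) g in \<open>auto simp: tensor_words_update multilinear_iff\<close>)
      also have "\<dots> = g fs"
        using linearize_of_hom[OF c M[OF k] s Q multilinear_slot[OF g fs k] x] by simp
      finally show "p (\<psi> fs) = g fs" .
      fix i assume "i < Suc k"
      then consider "i = k" | "i < k" by linarith
      then show "(\<lambda>x. \<psi> (fs[i := x])) \<in> module_hom R (Ms ! i) N"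
      proof cases
        case 1
        have "(\<lambda>x. \<psi> (fs[i := x])) = linearize R ?P s N (\<lambda>q. \<phi> (fs[k := q]))"
          using tensor_words_length[OF fs] k 1 by (simp add: \<psi>_def fun_eq_iff)
        then show ?thesis using lh[OF up[OF fs]] 1 by simp
      next
        case 2
        have "(\<lambda>x. linearize R ?P s N (\<lambda>q. \<phi> (fs[k := q, i := x])) (fs ! k)) \<in> module_hom R (Ms ! i) N"
          using 2 k fs
          by (intro linearize_family_hom[OF c M[OF k] s M N x] lin) (auto intro: tensor_words_update)
        then show ?thesis using 2 by (simp add: \<psi>_def list_update_swap[of i k])
      qed
    qed
  qed
  from this[OF order_refl] show ?thesis by (auto simp: multilinear_iff)
qed

section \<open>Words in a linear category\<close>

lemma chain_mors_length [simp]: "length (chain_mors A Ys) = length Ys - 1"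
  by (simp add: chain_mors_def)

lemma chain_mors_nth: "Suc i < length Ys \<Longrightarrow> chain_mors A Ys ! i = Mor A (Ys ! Suc i) (Ys ! i)"
  by (simp add: chain_mors_def)

lemma chain_mors_single [simp]: "chain_mors A [Y] = []"
  by (simp add: chain_mors_def)

lemma chain_mors_Cons [simp]: "chain_mors A (Y # Z # Ys) = Mor A Z Y # chain_mors A (Z # Ys)"
  by (rule nth_equalityI) (auto simp: chain_mors_nth nth_Cons split: nat.splits)

lemma chain_mors_snoc:
  "Ys \<noteq> [] \<Longrightarrow> chain_mors A (Ys @ [Z]) = chain_mors A Ys @ [Mor A Z (last Ys)]"
proof (induction Ys)
  case (Cons Y Ys)
  then show ?case by (cases Ys) auto
qed simp

lemma tensor_words_Nil [simp]: "tensor_words [] = {[]}"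
  by (simp add: tensor_words_def)

lemma tensor_words_Cons: "fs \<in> tensor_words (M # Ms) \<longleftrightarrow>
    (\<exists>f fs'. fs = f # fs' \<and> f \<in> carrier M \<and> fs' \<in> tensor_words Ms)"
  by (auto simp: tensor_words_def list_all2_Cons2)

lemma tensor_words_Cons_Cons [simp]:
  "f # fs \<in> tensor_words (M # Ms) \<longleftrightarrow> f \<in> carrier M \<and> fs \<in> tensor_words Ms"
  by (auto simp: tensor_words_def)

lemma tensor_words_snoc: "fs \<in> tensor_words (Ms @ [M]) \<longleftrightarrow>
    (\<exists>fs' f. fs = fs' @ [f] \<and> fs' \<in> tensor_words Ms \<and> f \<in> carrier M)"
proof
  assume "fs \<in> tensor_words (Ms @ [M])"
  then obtain us vs where "fs = us @ vs" "list_all2 (\<lambda>f M. f \<in> carrier M) us Ms"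
    "list_all2 (\<lambda>f M. f \<in> carrier M) vs [M]"
    unfolding tensor_words_def by (auto simp: list_all2_append2)
  then show "\<exists>fs' f. fs = fs' @ [f] \<and> fs' \<in> tensor_words Ms \<and> f \<in> carrier M"
    by (auto simp: tensor_words_def list_all2_Cons2)
qed (auto simp: tensor_words_def intro: list_all2_appendI)

lemma bar_mors_eq:
  assumes "Xs \<noteq> []"
  shows "bar_mors A X X' Xs = Mor A (hd Xs) X # chain_mors A Xs @ [Mor A X' (last Xs)]"
proof -
  have "bar_mors A X X' Xs = Mor A (hd Xs) X # chain_mors A (Xs @ [X'])"
    using assms by (cases Xs) (auto simp: bar_mors_def)
  then show ?thesis using assms by (simp add: chain_mors_snoc)
qed

lemma bar_word_iff:
  assumes "Xs \<noteq> []"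
  shows "fs \<in> tensor_words (bar_mors A X X' Xs) \<longleftrightarrow>
    (\<exists>f ms g. fs = f # ms @ [g] \<and> f \<in> carrier (Mor A (hd Xs) X) \<and>
       ms \<in> tensor_words (chain_mors A Xs) \<and> g \<in> carrier (Mor A X' (last Xs)))"
  unfolding bar_mors_eq[OF assms] tensor_words_Cons tensor_words_snoc by blast

section \<open>Faces of words\<close>

abbreviation remove_nth :: "nat \<Rightarrow> 'x list \<Rightarrow> 'x list" where
  "remove_nth i xs \<equiv> take i xs @ drop (i + 1) xs"

text \<open>Here the two outer objects belong to the chain \<open>Ys\<close>. The faces at the ends
  are then no special cases, and identities between faces can be proved by recursion along the
  chain.\<close>

definition merge :: "('o, 'k, 'm) lin_cat \<Rightarrow> 'o list \<Rightarrow> nat \<Rightarrow> 'm list \<Rightarrow> 'm list" where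
  "merge A Ys i fs = take i fs @
     [Comp A (Ys ! (i + 2)) (Ys ! (i + 1)) (Ys ! i) (fs ! i) (fs ! (i + 1))] @ drop (i + 2) fs"

lemma merge_mors_eq: "merge_mors A X X' Xs i fs = merge A (X # Xs @ [X']) i fs"
  by (simp add: merge_mors_def merge_def Let_def)

lemma merge_0 [simp]: "merge A (X # Y # Z # Ys) 0 (f # g # fs) = Comp A Z Y X f g # fs"
  by (simp add: merge_def)

lemma merge_Suc [simp]: "merge A (Y # Ys) (Suc i) (f # fs) = f # merge A Ys i fs"
  by (simp add: merge_def)

lemma merge_append:
  "i + 2 < length Ys \<Longrightarrow> i + 1 < length fs \<Longrightarrow> merge A (Ys @ Zs) i (fs @ gs) = merge A Ys i fs @ gs"
  by (simp add: merge_def nth_append)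

lemma remove_nth_nth:
  "Suc i < length Ys \<Longrightarrow> k < length Ys - 1 \<Longrightarrow>
    remove_nth i Ys ! k = (if k < i then Ys ! k else Ys ! Suc k)"
  by (auto simp: nth_append min_def)

lemma length_gt_2: "2 < length Ys \<Longrightarrow> \<exists>X Y Z Zs. Ys = X # Y # Z # Zs"
  by (auto simp: numeral_2_eq_2 Suc_less_eq2 length_Suc_conv Suc_le_length_iff less_eq_Suc_le)

lemma hd_remove_nth_Suc: "xs \<noteq> [] \<Longrightarrow> hd (remove_nth (Suc i) xs) = hd xs"
  by (cases xs) auto

lemma last_remove_nth: "Suc i < length xs \<Longrightarrow> last (remove_nth i xs) = last xs"
  by (simp add: last_append)

lemma remove_nth_remove_nth:
  "i \<le> j \<Longrightarrow> j + 1 < length Ys \<Longrightarrow> remove_nth j (remove_nth i Ys) = remove_nth i (remove_nth (j + 1) Ys)"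
proof (induction i arbitrary: j Ys)
  case 0
  then show ?case by (cases Ys) auto
next
  case (Suc i)
  then obtain j' Y Ys' where "j = Suc j'" "Ys = Y # Ys'" by (cases j; cases Ys) auto
  then show ?case using Suc.IH[of j' Ys'] Suc.prems by simp
qed

context linear_category
begin

lemma comp_closed:
  "X \<in> Ob C \<Longrightarrow> Y \<in> Ob C \<Longrightarrow> Z \<in> Ob C \<Longrightarrow> f \<in> carrier (Mor C X Y) \<Longrightarrow> g \<in> carrier (Mor C Y Z) \<Longrightarrow>
    Comp C X Y Z g f \<in> carrier (Mor C X Z)"
  using module_hom_in[OF comp_linear_left] by blast

text \<open>The morphisms in slots \<open>i\<close> and \<open>i + 1\<close> meet in the object
  \<open>Ys ! (i + 1)\<close>, which disappears. This accounts for the shift between the index of a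
  face and the index of the removed object.\<close>

lemma merge_word:
  assumes "fs \<in> tensor_words (chain_mors C Ys)" "set Ys \<subseteq> Ob C" "i + 2 < length Ys"
  shows "merge C Ys i fs \<in> tensor_words (chain_mors C (remove_nth (i + 1) Ys))"
  using assms
proof (induction i arbitrary: Ys fs)
  case 0
  then obtain X Y Z Zs where "Ys = X # Y # Z # Zs" using length_gt_2[of Ys] by auto
  with 0 show ?case
    by (cases Zs) (auto simp: tensor_words_Cons comp_closed)
next
  case (Suc i)
  then obtain X Y Z Zs where Y: "Ys = X # Y # Z # Zs" using length_gt_2[of Ys] by auto
  with Suc obtain f gs where f: "fs = f # gs" "f \<in> carrier (Mor C Y X)"
    "gs \<in> tensor_words (chain_mors C (Y # Z # Zs))" by (auto simp: tensor_words_Cons)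
  have "merge C (Y # Z # Zs) i gs \<in> tensor_words (chain_mors C (remove_nth (i + 1) (Y # Z # Zs)))"
    by (rule Suc.IH[OF f(3)]) (use Suc.prems Y in auto)
  then show ?case using Y f by simp
qed

text \<open>The simplicial identity for the faces; the case \<open>i = j\<close> is associativity.\<close>

lemma merge_merge:
  assumes "fs \<in> tensor_words (chain_mors C Ys)" "set Ys \<subseteq> Ob C" "i \<le> j" "j + 3 < length Ys"
  shows "merge C (remove_nth (i + 1) Ys) j (merge C Ys i fs) =
    merge C (remove_nth (j + 2) Ys) i (merge C Ys (j + 1) fs)"
  using assms
proof (induction i arbitrary: j Ys fs)
  case 0
  then obtain X Y Z Zs where Y: "Ys = X # Y # Z # Zs" using length_gt_2[of Ys] by auto
  with 0 obtain W Zs' where Z: "Zs = W # Zs'" by (cases Zs) auto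
  with 0 Y obtain f g h fs' where fs: "fs = f # g # h # fs'" "f \<in> carrier (Mor C Y X)"
    "g \<in> carrier (Mor C Z Y)" "h \<in> carrier (Mor C W Z)" by (auto simp: tensor_words_Cons)
  show ?case
  proof (cases j)
    case 0
    then show ?thesis using fs Y Z \<open>set Ys \<subseteq> Ob C\<close> by (simp add: comp_assoc)
  next
    case (Suc k)
    then show ?thesis using fs Y Z by simp
  qed
next
  case (Suc i)
  then obtain k where j: "j = Suc k" by (cases j) auto
  from Suc.prems obtain X Y Z Zs where Y: "Ys = X # Y # Z # Zs" using length_gt_2[of Ys] by auto
  with Suc.prems obtain f gs where f: "fs = f # gs" "gs \<in> tensor_words (chain_mors C (Y # Z # Zs))"
    by (auto simp: tensor_words_Cons)
  have "merge C (remove_nth (i + 1) (Y # Z # Zs)) k (merge C (Y # Z # Zs) i gs) =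
      merge C (remove_nth (k + 2) (Y # Z # Zs)) i (merge C (Y # Z # Zs) (k + 1) gs)"
    by (rule Suc.IH[OF f(2)]) (use Suc.prems Y j in auto)
  then show ?case using Y f j by simp
qed

text \<open>Linearity of a face in each slot reduces to this case distinction: before the merged
  pair, at either of its members, or behind it, where positions drop by one.\<close>

lemma merge_update:
  assumes "i + 1 < length fs" "k < length fs"
  shows "merge C Ys i (fs[k := x]) =
    (if k < i then (merge C Ys i fs)[k := x]
     else if k = i then (merge C Ys i fs)[i := Comp C (Ys ! (i + 2)) (Ys ! (i + 1)) (Ys ! i) x (fs ! (i + 1))]
     else if k = i + 1 then (merge C Ys i fs)[i := Comp C (Ys ! (i + 2)) (Ys ! (i + 1)) (Ys ! i) (fs ! i) x]
     else (merge C Ys i fs)[k - 1 := x])"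
proof -
  consider "k < i" | "k = i" | "k = i + 1" | j where "k = i + 2 + j"
    by (metis add.assoc add_Suc_right less_iff_Suc_add not_less_less_Suc_eq one_add_one plus_1_eq_Suc
        add.right_neutral Suc_eq_plus1 not_less_eq)
  then show ?thesis
    using assms by cases (auto simp: merge_def list_update_append drop_update_swap take_update_swap list_update_beyond)
qed

text \<open>An entry outside the merged pair stays an entry of the shorter word; inside the pair,
  composition is linear in each factor.\<close>

lemma multilinear_merge:
  assumes Ys: "set Ys \<subseteq> Ob C" "i + 2 < length Ys"
    and T: "multilinear R (chain_mors C (remove_nth (i + 1) Ys)) N T"
  shows "multilinear R (chain_mors C Ys) N (\<lambda>fs. T (merge C Ys i fs))"
  unfolding multilinear_iff
proof (intro conjI ballI allI impI)
  let ?Zs = "remove_nth (i + 1) Ys"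
  fix fs assume fs: "fs \<in> tensor_words (chain_mors C Ys)"
  have m: "merge C Ys i fs \<in> tensor_words (chain_mors C ?Zs)" by (rule merge_word[OF fs Ys])
  show "T (merge C Ys i fs) \<in> carrier N" using T m by (simp add: multilinear_iff)
  have len: "length fs = length Ys - 1" using tensor_words_length[OF fs] by simp
  have Y: "j < length Ys \<Longrightarrow> Ys ! j \<in> Ob C" for j using Ys nth_mem by blast
  have f: "fs ! j \<in> carrier (Mor C (Ys ! Suc j) (Ys ! j))" if "Suc j < length Ys" for j
    using tensor_words_nth[OF fs, of j] that by (simp add: chain_mors_nth)
  have lZ: "length ?Zs = length Ys - 1" using Ys by simp
  have s: "(\<lambda>x. T ((merge C Ys i fs)[j := x])) \<in> module_hom R (Mor C (?Zs ! Suc j) (?Zs ! j)) N"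
    if "Suc j < length Ys - 1" for j
    using multilinear_slot[OF T m, of j] that lZ by (simp only: chain_mors_nth chain_mors_length)
  note Z = remove_nth_nth[of "i + 1" Ys]
  fix k assume "k < length (chain_mors C Ys)"
  then have k: "Suc k < length Ys" by simp
  consider "k < i" | "k = i" | "k = i + 1" | "k > i + 1" by linarith
  then have "(\<lambda>x. T (merge C Ys i (fs[k := x]))) \<in> module_hom R (Mor C (Ys ! Suc k) (Ys ! k)) N"
  proof cases
    case 1
    then show ?thesis using s[of k] k Ys Z[of k] Z[of "Suc k"] by (simp add: merge_update len)
  next
    case 2
    then have s': "(\<lambda>x. T ((merge C Ys i fs)[i := x])) \<in> module_hom R (Mor C (Ys ! (i + 2)) (Ys ! i)) N"
      using s[of i] k Ys Z[of i] Z[of "Suc i"] by simp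
    show ?thesis
      using module_hom_compose[OF comp_linear_left[of "Ys ! (i + 2)" "Ys ! (i + 1)" "Ys ! i" "fs ! (i + 1)"] s']
        2 k Ys Y f[of "i + 1"] by (simp add: merge_update len)
  next
    case 3
    then have s': "(\<lambda>x. T ((merge C Ys i fs)[i := x])) \<in> module_hom R (Mor C (Ys ! (i + 2)) (Ys ! i)) N"
      using s[of i] k Ys Z[of i] Z[of "Suc i"] by simp
    show ?thesis
      using module_hom_compose[OF comp_linear_right[of "Ys ! (i + 2)" "Ys ! (i + 1)" "Ys ! i" "fs ! i"] s']
        3 k Ys Y f[of i] by (simp add: merge_update len)
  next
    case 4
    then obtain k' where "k = Suc k'" by (cases k) auto
    then show ?thesis using 4 s[of k'] k Ys Z[of k'] Z[of k] by (simp add: merge_update len)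
  qed
  then show "(\<lambda>x. T (merge C Ys i (fs[k := x]))) \<in> module_hom R (chain_mors C Ys ! k) N"
    using k by (simp add: chain_mors_nth)
qed

end

section \<open>The bar complex\<close>

text \<open>The defining relations lie in the kernel, so the cosets agree. This is the counterpart
  of the universal property: composing with a linear map out of the tensor product gives a
  multilinear function.\<close>

lemma pure_tensor_multilinear:
  assumes c: "cring R" and m: "\<And>M. M \<in> set Ms \<Longrightarrow> module R M"
  shows "multilinear R Ms (tensor_product R Ms) (pure_tensor R Ms)"
proof -
  let ?F = "free_module R (tensor_words Ms)" and ?e = "free_gen R (tensor_words Ms)"
  let ?K = "tensor_kernel R Ms"
  interpret F: module R ?F by (rule module_free[OF c])
  note q = quotient_module_props[OF module_free[OF c] tensor_module(2)[OF c m], folded tensor_product_def]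
  have e: "?e fs \<in> carrier ?F" if "fs \<in> tensor_words Ms" for fs
    by (rule free_gen_in[OF c that])
  have rel: "tensor_relations R Ms \<subseteq> ?K"
    unfolding tensor_kernel_def submodule_span_def by blast
  have m': "module R (Ms ! i)" if "i < length Ms" for i using m that by simp
  have ab: "abelian_monoid (Ms ! i)" if "i < length Ms" for i
    using m'[OF that] by (simp add: module_def abelian_group_def)
  note cl = abelian_monoid.a_closed[OF ab] module.smult_closed[OF m']
  show ?thesis
    unfolding multilinear_iff
  proof (intro conjI ballI allI impI)
    show "pure_tensor R Ms fs \<in> carrier (tensor_product R Ms)" if "fs \<in> tensor_words Ms" for fs
      unfolding pure_tensor_def using module_hom_in[OF q(2) e[OF that]] .
    fix fs i assume fs: "fs \<in> tensor_words Ms" and i: "i < length Ms"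
    have w: "?e (fs[i := x]) \<in> carrier ?F" if "x \<in> carrier (Ms ! i)" for x
      using e tensor_words_update[OF fs that] by blast
    show "(\<lambda>x. pure_tensor R Ms (fs[i := x])) \<in> module_hom R (Ms ! i) (tensor_product R Ms)"
    proof (rule module_homI)
      show "pure_tensor R Ms (fs[i := x]) \<in> carrier (tensor_product R Ms)"
        if "x \<in> carrier (Ms ! i)" for x
        unfolding pure_tensor_def using module_hom_in[OF q(2) w[OF that]] .
      fix x assume x: "x \<in> carrier (Ms ! i)"
      show "pure_tensor R Ms (fs[i := x \<oplus>\<^bsub>Ms ! i\<^esub> y]) =
          pure_tensor R Ms (fs[i := x]) \<oplus>\<^bsub>tensor_product R Ms\<^esub> pure_tensor R Ms (fs[i := y])"
        if y: "y \<in> carrier (Ms ! i)" for y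
      proof -
        have "?e (fs[i := x \<oplus>\<^bsub>Ms ! i\<^esub> y]) \<ominus>\<^bsub>?F\<^esub> (?e (fs[i := x]) \<oplus>\<^bsub>?F\<^esub> ?e (fs[i := y]))
            \<in> tensor_relations R Ms"
          unfolding tensor_relations_def Let_def using fs i x y by blast
        then have "?K +>\<^bsub>?F\<^esub> ?e (fs[i := x \<oplus>\<^bsub>Ms ! i\<^esub> y]) =
            ?K +>\<^bsub>?F\<^esub> (?e (fs[i := x]) \<oplus>\<^bsub>?F\<^esub> ?e (fs[i := y]))"
          using rel by (subst q(5)) (auto intro: w cl[OF i] x y)
        then show ?thesis
          unfolding pure_tensor_def using module_hom_add[OF q(2) w[OF x] w[OF y]] by simp
      qed
      show "pure_tensor R Ms (fs[i := a \<odot>\<^bsub>Ms ! i\<^esub> x]) =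
          a \<odot>\<^bsub>tensor_product R Ms\<^esub> pure_tensor R Ms (fs[i := x])"
        if a: "a \<in> carrier R" for a
      proof -
        have "?e (fs[i := a \<odot>\<^bsub>Ms ! i\<^esub> x]) \<ominus>\<^bsub>?F\<^esub> (a \<odot>\<^bsub>?F\<^esub> ?e (fs[i := x])) \<in> tensor_relations R Ms"
          unfolding tensor_relations_def Let_def using fs i x a by blast
        then have "?K +>\<^bsub>?F\<^esub> ?e (fs[i := a \<odot>\<^bsub>Ms ! i\<^esub> x]) = ?K +>\<^bsub>?F\<^esub> (a \<odot>\<^bsub>?F\<^esub> ?e (fs[i := x]))"
          using rel a by (subst q(5)) (auto intro: w cl[OF i] x)
        then show ?thesis
          unfolding pure_tensor_def using module_hom_smult[OF q(2) w[OF x] a] by simp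
      qed
    qed
  qed
qed

text \<open>The double sum in the square of a simplicial differential: the summands \<open>(i, j)\<close> with
  \<open>i \<le> j\<close> cancel those with \<open>j < i\<close>.\<close>

lemma (in abelian_group) alternating_double_sum:
  fixes m :: nat
  assumes u: "\<And>i j. i \<le> m \<Longrightarrow> j < m \<Longrightarrow> u i j \<in> carrier G"
    and sw: "\<And>i j. i \<le> j \<Longrightarrow> j < m \<Longrightarrow> u (j + 1) i = u i j"
  defines "v \<equiv> \<lambda>i j. if even (i + j) then u i j else \<ominus> u i j"
  shows "(\<Oplus>i\<in>{..<m + 1}. \<Oplus>j\<in>{..<m}. v i j) = \<zero>"
proof -
  let ?S = "\<lambda>i. {j \<in> {..<m}. i \<le> j}" and ?T = "\<lambda>i. {j \<in> {..<m}. j < i}"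
  let ?A = "SIGMA i:{..<m + 1}. ?S i" and ?B = "SIGMA i:{..<m + 1}. ?T i"
  have v: "v i j \<in> carrier G" if "i < m + 1" "j < m" for i j
    using u[of i j] that by (auto simp: v_def)
  have split: "(\<Oplus>j\<in>{..<m}. v i j) = (\<Oplus>j\<in>?S i. v i j) \<oplus> (\<Oplus>j\<in>?T i. v i j)" if "i < m + 1" for i
    using v[OF that] by (subst finsum_Un_disjoint[symmetric]) (auto intro!: finsum_cong')
  \<comment> \<open>Iterated sums become sums over sets of pairs, on which the cancellation is a
    reindexing.\<close>
  have sig: "(\<Oplus>i\<in>{..<k}. \<Oplus>j\<in>D i. v i j) = (\<Oplus>p\<in>(SIGMA i:{..<k}. D i). v (fst p) (snd p))"
    if "\<And>i. D i \<subseteq> {..<m}" "k \<le> m + 1" for D and k :: nat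
    using that(2)
  proof (induction k)
    case (Suc k)
    have fin: "finite (D i)" for i using that(1)[of i] finite_subset by blast
    have eq: "(SIGMA i:{..<Suc k}. D i) = (SIGMA i:{..<k}. D i) \<union> Pair k ` D k"
      by (auto simp: less_Suc_eq)
    have "(\<Oplus>p\<in>(SIGMA i:{..<Suc k}. D i). v (fst p) (snd p)) =
        (\<Oplus>p\<in>(SIGMA i:{..<k}. D i). v (fst p) (snd p)) \<oplus> (\<Oplus>p\<in>Pair k ` D k. v (fst p) (snd p))"
      unfolding eq using fin that(1) Suc.prems
      by (intro finsum_Un_disjoint) (auto simp: subset_eq intro!: v)
    also have "(\<Oplus>p\<in>Pair k ` D k. v (fst p) (snd p)) = (\<Oplus>j\<in>D k. v k j)"
      using that(1)[of k] Suc.prems by (subst finsum_reindex) (auto simp: inj_on_def intro!: v)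
    finally have *: "(\<Oplus>p\<in>(SIGMA i:{..<Suc k}. D i). v (fst p) (snd p)) =
        (\<Oplus>p\<in>(SIGMA i:{..<k}. D i). v (fst p) (snd p)) \<oplus> (\<Oplus>j\<in>D k. v k j)" .
    have cl: "(\<Oplus>j\<in>D i. v i j) \<in> carrier G" if "i \<le> k" for i
      using \<open>\<And>i. D i \<subseteq> {..<m}\<close>[of i] that Suc.prems by (intro finsum_closed) (auto intro!: v)
    have cs: "(\<Oplus>i\<in>{..<k}. \<Oplus>j\<in>D i. v i j) \<in> carrier G"
      using cl by (intro finsum_closed) auto
    have "(\<Oplus>i\<in>{..<Suc k}. \<Oplus>j\<in>D i. v i j) = (\<Oplus>j\<in>D k. v k j) \<oplus> (\<Oplus>i\<in>{..<k}. \<Oplus>j\<in>D i. v i j)"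
      unfolding lessThan_Suc using cl by (subst finsum_insert) auto
    then show ?case using * Suc cl[of k] cs by (simp add: a_comm)
  qed simp
  \<comment> \<open>This bijection changes the parity of the index sum while \<open>u\<close> keeps
    its value, so corresponding summands are opposite.\<close>
  have B: "?B = (\<lambda>(i, j). (j + 1, i)) ` ?A"
  proof (intro equalityI subsetI)
    fix p assume "p \<in> ?B"
    then have "p = (\<lambda>(i, j). (j + 1, i)) (snd p, fst p - 1)" "(snd p, fst p - 1) \<in> ?A"
      by (auto split: prod.splits)
    then show "p \<in> (\<lambda>(i, j). (j + 1, i)) ` ?A" by (rule image_eqI)
  qed auto
  have vA: "(\<lambda>p. v (fst p) (snd p)) \<in> ?A \<rightarrow> carrier G" by (auto intro!: v)
  have inv: "v (j + 1) i = \<ominus> v i j" if "i \<le> j" "j < m" for i j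
    using sw[OF that] u[of i j] that by (simp add: v_def)
  have "(\<Oplus>p\<in>?B. v (fst p) (snd p)) = (\<Oplus>p\<in>?A. v (snd p + 1) (fst p))"
    unfolding B by (subst finsum_reindex) (auto simp: inj_on_def case_prod_unfold intro!: v)
  also have "\<dots> = (\<Oplus>p\<in>?A. \<ominus> v (fst p) (snd p))"
    by (intro finsum_cong') (auto simp: inv[simplified] intro!: v)
  finally have "(\<Oplus>p\<in>?A. v (fst p) (snd p)) \<oplus> (\<Oplus>p\<in>?B. v (fst p) (snd p)) =
      (\<Oplus>p\<in>?A. v (fst p) (snd p) \<oplus> \<ominus> v (fst p) (snd p))"
    using vA by (subst finsum_addf) (auto simp: Pi_iff)
  also have "\<dots> = \<zero>"
    using vA by (subst finsum_cong'[of _ _ "\<lambda>_. \<zero>"]) (auto simp: r_neg Pi_iff)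
  finally have z: "(\<Oplus>p\<in>?A. v (fst p) (snd p)) \<oplus> (\<Oplus>p\<in>?B. v (fst p) (snd p)) = \<zero>" .
  have "(\<Oplus>i\<in>{..<m + 1}. \<Oplus>j\<in>{..<m}. v i j) =
      (\<Oplus>i\<in>{..<m + 1}. (\<Oplus>j\<in>?S i. v i j) \<oplus> (\<Oplus>j\<in>?T i. v i j))"
    using v by (intro finsum_cong') (auto simp: split intro!: a_closed finsum_closed)
  also have "\<dots> = (\<Oplus>i\<in>{..<m + 1}. \<Oplus>j\<in>?S i. v i j) \<oplus> (\<Oplus>i\<in>{..<m + 1}. \<Oplus>j\<in>?T i. v i j)"
    using v by (intro finsum_addf) (auto intro!: finsum_closed)
  also have "\<dots> = \<zero>"
  proof -
    have "(\<Oplus>i\<in>{..<m + 1}. \<Oplus>j\<in>?S i. v i j) = (\<Oplus>p\<in>?A. v (fst p) (snd p))"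
      by (rule sig) auto
    moreover have "(\<Oplus>i\<in>{..<m + 1}. \<Oplus>j\<in>?T i. v i j) = (\<Oplus>p\<in>?B. v (fst p) (snd p))"
      by (rule sig) auto
    ultimately show ?thesis by (simp only: z)
  qed
  finally show ?thesis .
qed

section \<open>Differential and action on the bar modules\<close>

context linear_category
begin

lemma bar_index_iff: "Xs \<in> bar_index C n \<longleftrightarrow> Xs \<noteq> [] \<and> set Xs \<subseteq> Ob C \<and> int (length Xs) = 1 - n"
  by (simp add: bar_index_def)

lemma bar_module_module:
  assumes "X \<in> Ob C" "X' \<in> Ob C"
  shows "module R (bar_module R C X X' n)"
  unfolding bar_module_def
  by (rule module_direct_sum[OF base_ring tensor_module(1)[OF base_ring bar_mors_module[OF assms]]])
    (auto simp: bar_index_iff)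

lemma bar_elem_multilinear:
  assumes "X \<in> Ob C" "X' \<in> Ob C" "Xs \<in> bar_index C n"
  shows "multilinear R (bar_mors C X X' Xs) (bar_module R C X X' n) (bar_elem R C X X' n Xs)"
proof -
  have m: "module R M" if "Xs \<in> bar_index C n" "M \<in> set (bar_mors C X X' Xs)" for M Xs
    by (rule bar_mors_module[OF assms(1,2) _ that(2)]) (use that(1) in \<open>simp add: bar_index_iff\<close>)
  have "sum_inj (bar_index C n) (\<lambda>Xs. tensor_product R (bar_mors C X X' Xs)) Xs
      \<in> module_hom R (tensor_product R (bar_mors C X X' Xs)) (bar_module R C X X' n)"
    unfolding bar_module_def
    by (rule sum_inj_hom[where M="\<lambda>Xs. tensor_product R (bar_mors C X X' Xs)",
        OF base_ring tensor_module(1)[OF base_ring m] assms(3)])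
  from multilinear_compose[OF pure_tensor_multilinear[OF base_ring m[OF assms(3)]] this]
  show ?thesis unfolding bar_elem_def .
qed

lemma bar_elem_closed:
  "X \<in> Ob C \<Longrightarrow> X' \<in> Ob C \<Longrightarrow> Xs \<in> bar_index C n \<Longrightarrow> fs \<in> tensor_words (bar_mors C X X' Xs) \<Longrightarrow>
    bar_elem R C X X' n Xs fs \<in> carrier (bar_module R C X X' n)"
  using bar_elem_multilinear by (simp add: multilinear_iff)

text \<open>The restrictions of \<open>h\<close> and \<open>k\<close> to the carrier both solve the
  extension problem posed by the values of \<open>h\<close>. Restriction is necessary because
  uniqueness holds among extensional maps. All identities on the bar complex are checked on words
  through this lemma.\<close>

lemma bar_hom_eqI:
  assumes X: "X \<in> Ob C" "X' \<in> Ob C" and N: "module R N"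
    and h: "h \<in> module_hom R (bar_module R C X X' n) N" and k: "k \<in> module_hom R (bar_module R C X X' n) N"
    and eq: "\<And>Xs fs. Xs \<in> bar_index C n \<Longrightarrow> fs \<in> tensor_words (bar_mors C X X' Xs) \<Longrightarrow>
      h (bar_elem R C X X' n Xs fs) = k (bar_elem R C X X' n Xs fs)"
    and x: "x \<in> carrier (bar_module R C X X' n)"
  shows "h x = k x"
proof -
  let ?B = "bar_module R C X X' n"
  have "\<exists>!l. l \<in> module_hom R ?B N \<and> l \<in> extensional (carrier ?B) \<and>
      (\<forall>Xs\<in>bar_index C n. \<forall>fs\<in>tensor_words (bar_mors C X X' Xs).
         l (bar_elem R C X X' n Xs fs) = h (bar_elem R C X X' n Xs fs))"
    by (rule bar_extend_unique_existence[OF linear_category_axioms X N])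
      (rule multilinear_compose[OF bar_elem_multilinear[OF X] h])
  moreover note module_hom_restrict[OF bar_module_module[OF X] h]
    module_hom_restrict[OF bar_module_module[OF X] k]
  ultimately have "restrict h (carrier ?B) = restrict k (carrier ?B)"
    using eq by (auto simp: bar_elem_closed[OF X])
  then show ?thesis using x by (metis restrict_apply')
qed

lemma bar_extend:
  assumes X: "X \<in> Ob C" "X' \<in> Ob C" and N: "module R N"
    and g: "\<And>Xs. Xs \<in> bar_index C n \<Longrightarrow> multilinear R (bar_mors C X X' Xs) N (g Xs)"
  shows "bar_extend R C X X' n N g \<in> module_hom R (bar_module R C X X' n) N"
    and "\<And>Xs fs. Xs \<in> bar_index C n \<Longrightarrow> fs \<in> tensor_words (bar_mors C X X' Xs) \<Longrightarrow>
      bar_extend R C X X' n N g (bar_elem R C X X' n Xs fs) = g Xs fs"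
  using theI'[OF bar_extend_unique_existence[OF linear_category_axioms X N g]]
  unfolding bar_extend_def by blast+

lemma bar_word_chain: "bar_mors C X X' Xs = chain_mors C (X # Xs @ [X'])"
  by (simp add: bar_mors_def)

lemma remove_nth_bar_index:
  "Xs \<in> bar_index C n \<Longrightarrow> n < 0 \<Longrightarrow> i < length Xs \<Longrightarrow> remove_nth i Xs \<in> bar_index C (n + 1)"
  by (auto simp: bar_index_iff dest: in_set_takeD in_set_dropD)

lemma bar_remove_nth: "i < length Xs \<Longrightarrow>
    bar_mors C X X' (remove_nth i Xs) = chain_mors C (remove_nth (i + 1) (X # Xs @ [X']))"
  by (simp add: bar_mors_def)

text \<open>The differential is defined by a description, which is meaningful since every face is
  multilinear. The third claim covers positive degrees as well, where the module is zero.\<close>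

lemma bar_diff:
  assumes X: "X \<in> Ob C" "X' \<in> Ob C"
  shows "bar_diff R C X X' n \<in> module_hom R (bar_module R C X X' n) (bar_module R C X X' (n + 1))"
    and "\<And>Xs fs. Xs \<in> bar_index C n \<Longrightarrow> fs \<in> tensor_words (bar_mors C X X' Xs) \<Longrightarrow> n < 0 \<Longrightarrow>
      bar_diff R C X X' n (bar_elem R C X X' n Xs fs) =
      (\<Oplus>\<^bsub>bar_module R C X X' (n + 1)\<^esub>i\<in>{..<length Xs}. signed (bar_module R C X X' (n + 1)) (int i)
         (bar_elem R C X X' (n + 1) (remove_nth i Xs) (merge C (X # Xs @ [X']) i fs)))"
    and "\<And>x. x \<in> carrier (bar_module R C X X' n) \<Longrightarrow> n \<ge> 0 \<Longrightarrow>
      bar_diff R C X X' n x = \<zero>\<^bsub>bar_module R C X X' (n + 1)\<^esub>"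
proof -
  let ?N = "bar_module R C X X' (n + 1)"
  let ?g = "\<lambda>Xs fs. if n = 0 then \<zero>\<^bsub>?N\<^esub> else (\<Oplus>\<^bsub>?N\<^esub>i\<in>{..<length Xs}. signed ?N (int i)
     (bar_elem R C X X' (n + 1) (remove_nth i Xs) (merge_mors C X X' Xs i fs)))"
  have N: "module R ?N" by (rule bar_module_module[OF X])
  interpret N: module R ?N by (rule N)
  have g: "multilinear R (bar_mors C X X' Xs) ?N (?g Xs)" if "Xs \<in> bar_index C n" for Xs
  proof (cases "n = 0")
    case True
    then show ?thesis using that N N.zero_closed bar_mors_module[OF X]
      by (auto simp: multilinear_iff bar_index_iff intro!: module_hom_const_zero)
  next
    case False
    \<comment> \<open>A nonempty \<open>Xs\<close> forces \<open>n <= 0\<close>, so only negative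
      degrees remain.\<close>
    then have n: "n < 0" using that by (cases Xs) (auto simp: bar_index_iff)
    have T: "multilinear R (bar_mors C X X' Xs) ?N
        (\<lambda>fs. signed ?N (int i) (bar_elem R C X X' (n + 1) (remove_nth i Xs) (merge_mors C X X' Xs i fs)))"
      if i: "i < length Xs" for i
      unfolding merge_mors_eq bar_word_chain
    proof (rule multilinear_compose[OF _ signed_hom[OF N]], rule multilinear_merge)
      show "set (X # Xs @ [X']) \<subseteq> Ob C" using X \<open>Xs \<in> bar_index C n\<close> by (simp add: bar_index_iff)
      show "i + 2 < length (X # Xs @ [X'])" using i by simp
      show "multilinear R (chain_mors C (remove_nth (i + 1) (X # Xs @ [X']))) ?N
          (bar_elem R C X X' (n + 1) (remove_nth i Xs))"
        using bar_elem_multilinear[OF X remove_nth_bar_index[OF \<open>Xs \<in> bar_index C n\<close> n i]]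
        by (simp only: bar_remove_nth[OF i])
    qed
    show ?thesis
      unfolding multilinear_iff using False
    proof (simp, intro conjI ballI allI impI)
      fix fs assume fs: "fs \<in> tensor_words (bar_mors C X X' Xs)"
      show "(\<Oplus>\<^bsub>?N\<^esub>i\<in>{..<length Xs}. signed ?N (int i)
         (bar_elem R C X X' (n + 1) (take i Xs @ drop (Suc i) Xs) (merge_mors C X X' Xs i fs))) \<in> carrier ?N"
        using T fs by (intro N.finsum_closed) (auto simp: multilinear_iff)
      fix k assume k: "k < length (bar_mors C X X' Xs)"
      have mk: "module R (bar_mors C X X' Xs ! k)"
        using bar_mors_module[OF X _ nth_mem[OF k]] \<open>Xs \<in> bar_index C n\<close> by (simp add: bar_index_iff)
      show "(\<lambda>x. \<Oplus>\<^bsub>?N\<^esub>i\<in>{..<length Xs}. signed ?N (int i)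
         (bar_elem R C X X' (n + 1) (take i Xs @ drop (Suc i) Xs) (merge_mors C X X' Xs i (fs[k := x]))))
         \<in> module_hom R (bar_mors C X X' Xs ! k) ?N"
        using multilinear_slot[OF T fs k] by (intro module_hom_finsum_fun[OF mk N]) auto
    qed
  qed
  have e: "bar_extend R C X X' n ?N ?g (bar_elem R C X X' n Xs fs) = ?g Xs fs"
    if "Xs \<in> bar_index C n" "fs \<in> tensor_words (bar_mors C X X' Xs)" for Xs fs
    by (rule bar_extend(2)[OF X N g that])
  have d: "bar_diff R C X X' n = bar_extend R C X X' n ?N ?g"
    by (simp add: bar_diff_def Let_def)
  show h: "bar_diff R C X X' n \<in> module_hom R (bar_module R C X X' n) ?N"
    unfolding d by (rule bar_extend(1)[OF X N g])
  show "bar_diff R C X X' n (bar_elem R C X X' n Xs fs) =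
      (\<Oplus>\<^bsub>?N\<^esub>i\<in>{..<length Xs}. signed ?N (int i)
         (bar_elem R C X X' (n + 1) (remove_nth i Xs) (merge C (X # Xs @ [X']) i fs)))"
    if "Xs \<in> bar_index C n" "fs \<in> tensor_words (bar_mors C X X' Xs)" "n < 0" for Xs fs
    unfolding d e[OF that(1,2)] using that(3) by (simp add: merge_mors_eq)
  show "bar_diff R C X X' n x = \<zero>\<^bsub>?N\<^esub>"
    if x: "x \<in> carrier (bar_module R C X X' n)" and n: "n \<ge> 0" for x
  proof (rule bar_hom_eqI[OF X N h module_hom_const_zero[OF bar_module_module[OF X] N] _ x])
    fix Xs fs assume a: "Xs \<in> bar_index C n" "fs \<in> tensor_words (bar_mors C X X' Xs)"
    \<comment> \<open>Words exist only for \<open>n <= 0\<close>; in degree 0 the prescribed value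
      is zero.\<close>
    then have "n = 0" using n by (cases Xs) (auto simp: bar_index_iff)
    then show "bar_diff R C X X' n (bar_elem R C X X' n Xs fs) = \<zero>\<^bsub>?N\<^esub>"
      unfolding d e[OF a] by simp
  qed
qed

lemma bar_diff_diff:
  assumes X: "X \<in> Ob C" "X' \<in> Ob C" and x: "x \<in> carrier (bar_module R C X X' n)"
  shows "bar_diff R C X X' (n + 1) (bar_diff R C X X' n x) = \<zero>\<^bsub>bar_module R C X X' (n + 1 + 1)\<^esub>"
proof -
  let ?B = "bar_module R C X X'" and ?d = "bar_diff R C X X'" and ?e = "bar_elem R C X X'"
  let ?N = "?B (n + 1 + 1)"
  note m = bar_module_module[OF X] and h = bar_diff(1)[OF X]
  interpret N: module R ?N by (rule m)
  show ?thesis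
  proof (cases "n < -1")
    \<comment> \<open>The second differential starts in degree \<open>n + 1 >= 0\<close>, where it
      vanishes.\<close>
    case False
    then show ?thesis using bar_diff(3)[OF X module_hom_in[OF h x]] by simp
  next
    case True
    show ?thesis
    proof (rule bar_hom_eqI[OF X m module_hom_compose[OF h h] module_hom_const_zero[OF m m] _ x])
      fix Xs fs assume Xs: "Xs \<in> bar_index C n" and fs: "fs \<in> tensor_words (bar_mors C X X' Xs)"
      let ?Y = "X # Xs @ [X']"
      have Y: "set ?Y \<subseteq> Ob C" using X Xs by (simp add: bar_index_iff)
      obtain l where l: "length Xs = l + 1" using Xs by (cases Xs) (auto simp: bar_index_iff)
      have R: "remove_nth i Xs \<in> bar_index C (n + 1)" if "i < l + 1" for i
        using remove_nth_bar_index[OF Xs _] that True l by simp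
      have W: "merge C ?Y i fs \<in> tensor_words (bar_mors C X X' (remove_nth i Xs))" if "i < l + 1" for i
        using merge_word[of fs ?Y i] fs Y l that by (simp add: bar_word_chain)
      have R2: "remove_nth j (remove_nth i Xs) \<in> bar_index C (n + 1 + 1)" if "i < l + 1" "j < l" for i j
        using remove_nth_bar_index[OF R[OF that(1)], of j] that True l by simp
      \<comment> \<open>The unsigned contribution of face \<open>j\<close> taken after face
        \<open>i\<close>. With \<open>length Xs = l + 1\<close> there are \<open>l + 1\<close>
        choices of \<open>i\<close> and \<open>l\<close> choices of \<open>j\<close>, as in the
        double sum above.\<close>
      define u where "u i j = ?e (n + 1 + 1) (remove_nth j (remove_nth i Xs))
          (merge C (X # remove_nth i Xs @ [X']) j (merge C ?Y i fs))" for i j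
      have uc: "u i j \<in> carrier ?N" if "i < l + 1" "j < l" for i j
        unfolding u_def
      proof (rule bar_elem_closed[OF X R2[OF that]])
        show "merge C (X # remove_nth i Xs @ [X']) j (merge C ?Y i fs)
            \<in> tensor_words (bar_mors C X X' (remove_nth j (remove_nth i Xs)))"
          using merge_word[of "merge C ?Y i fs" "X # remove_nth i Xs @ [X']" j] W[OF that(1)]
            R[OF that(1)] X that l by (simp add: bar_word_chain bar_index_iff)
      qed
      have "?d (n + 1) (?d n (?e n Xs fs)) = ?d (n + 1) (\<Oplus>\<^bsub>?B (n + 1)\<^esub>i\<in>{..<l + 1}.
          signed (?B (n + 1)) (int i) (?e (n + 1) (remove_nth i Xs) (merge C ?Y i fs)))"
        using bar_diff(2)[OF X Xs fs] True l by simp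
      also have "\<dots> = (\<Oplus>\<^bsub>?N\<^esub>i\<in>{..<l + 1}.
          ?d (n + 1) (signed (?B (n + 1)) (int i) (?e (n + 1) (remove_nth i Xs) (merge C ?Y i fs))))"
        by (rule module_hom_finsum[OF m m h]) (auto intro!: signed_closed m bar_elem_closed X R[simplified] W[simplified])
      also have "\<dots> = (\<Oplus>\<^bsub>?N\<^esub>i\<in>{..<l + 1}. \<Oplus>\<^bsub>?N\<^esub>j\<in>{..<l}. if even (i + j) then u i j else \<ominus>\<^bsub>?N\<^esub> u i j)"
      proof (rule N.finsum_cong')
        show "(\<lambda>i. \<Oplus>\<^bsub>?N\<^esub>j\<in>{..<l}. if even (i + j) then u i j else \<ominus>\<^bsub>?N\<^esub> u i j) \<in> {..<l + 1} \<rightarrow> carrier ?N"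
          by (intro funcsetI N.finsum_closed) (use uc N.a_inv_closed in auto)
        fix i assume "i \<in> {..<l + 1}"
        then have i: "i < l + 1" by simp
        have "?d (n + 1) (signed (?B (n + 1)) (int i) (?e (n + 1) (remove_nth i Xs) (merge C ?Y i fs))) =
            signed ?N (int i) (?d (n + 1) (?e (n + 1) (remove_nth i Xs) (merge C ?Y i fs)))"
          by (rule module_hom_signed[OF m m h bar_elem_closed[OF X R[OF i] W[OF i]]])
        also have "?d (n + 1) (?e (n + 1) (remove_nth i Xs) (merge C ?Y i fs)) =
            (\<Oplus>\<^bsub>?N\<^esub>j\<in>{..<l}. signed ?N (int j) (u i j))"
          unfolding u_def using bar_diff(2)[OF X R[OF i] W[OF i]] True i l by simp
        also have "signed ?N (int i) \<dots> = (\<Oplus>\<^bsub>?N\<^esub>j\<in>{..<l}. signed ?N (int i) (signed ?N (int j) (u i j)))"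
          by (rule module_hom_finsum[OF m m signed_hom[OF m]])
            (simp, rule signed_closed[OF m uc[OF i]], simp)
        also have "\<dots> = (\<Oplus>\<^bsub>?N\<^esub>j\<in>{..<l}. if even (i + j) then u i j else \<ominus>\<^bsub>?N\<^esub> u i j)"
          by (rule N.finsum_cong') (use uc i N.a_inv_closed N.minus_minus in \<open>auto simp: signed_def\<close>)
        finally show "?d (n + 1) (signed (?B (n + 1)) (int i) (?e (n + 1) (remove_nth i Xs) (merge C ?Y i fs))) =
            (\<Oplus>\<^bsub>?N\<^esub>j\<in>{..<l}. if even (i + j) then u i j else \<ominus>\<^bsub>?N\<^esub> u i j)" .
      qed simp
      also have "\<dots> = \<zero>\<^bsub>?N\<^esub>"
      proof (rule N.alternating_double_sum)
        show "u i j \<in> carrier ?N" if "i \<le> l" "j < l" for i j using uc that by simp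
        fix i j assume ij: "i \<le> j" "j < l"
        \<comment> \<open>The simplicial identity is needed twice: for the words and for the object
          lists that index the summands.\<close>
        have "merge C (X # remove_nth i Xs @ [X']) j (merge C ?Y i fs) =
            merge C (X # remove_nth (j + 1) Xs @ [X']) i (merge C ?Y (j + 1) fs)"
          using merge_merge[of fs ?Y i j] fs Y ij l by (simp add: bar_word_chain)
        moreover have "remove_nth j (remove_nth i Xs) = remove_nth i (remove_nth (j + 1) Xs)"
          by (rule remove_nth_remove_nth) (use ij l in auto)
        ultimately show "u (j + 1) i = u i j" by (simp add: u_def)
      qed
      finally show "?d (n + 1) (?d n (?e n Xs fs)) = \<zero>\<^bsub>?N\<^esub>" .
    qed
  qed
qed

text \<open>Composition is linear in the first and in the last slot, so the prescribed values are
  multilinear and the description that defines the action is meaningful.\<close>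

lemma bar_act:
  assumes X: "X \<in> Ob C" "X' \<in> Ob C" and Z: "Z \<in> Ob C" "Z' \<in> Ob C"
    and a: "a \<in> carrier (Mor C X Z)" and b: "b \<in> carrier (Mor C Z' X')"
  shows "(\<lambda>x. bar_act R C X Z X' Z' n a x b) \<in> module_hom R (bar_module R C X X' n) (bar_module R C Z Z' n)"
    and "\<And>Xs f ms g. Xs \<in> bar_index C n \<Longrightarrow> f # ms @ [g] \<in> tensor_words (bar_mors C X X' Xs) \<Longrightarrow>
      bar_act R C X Z X' Z' n a (bar_elem R C X X' n Xs (f # ms @ [g])) b =
      bar_elem R C Z Z' n Xs (Comp C (hd Xs) X Z a f # ms @ [Comp C Z' X' (last Xs) g b])"
proof -
  let ?N = "bar_module R C Z Z' n"
  let ?g = "\<lambda>Xs fs. bar_elem R C Z Z' n Xs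
     ([Comp C (hd Xs) X Z a (hd fs)] @ butlast (tl fs) @ [Comp C Z' X' (last Xs) (last fs) b])"
  have N: "module R ?N" by (rule bar_module_module[OF Z])
  have g: "multilinear R (bar_mors C X X' Xs) ?N (?g Xs)" if Xs: "Xs \<in> bar_index C n" for Xs
  proof -
    let ?c = "chain_mors C Xs"
    let ?M = "Mor C (hd Xs) X # ?c @ [Mor C X' (last Xs)]"
    let ?M' = "Mor C (hd Xs) X # ?c @ [Mor C Z' (last Xs)]"
    have ne: "Xs \<noteq> []" and o: "hd Xs \<in> Ob C" "last Xs \<in> Ob C"
      using Xs by (auto simp: bar_index_iff)
    have l: "length ?c + 1 = length Xs" using ne by (cases Xs) auto
    \<comment> \<open>A word over \<open>Xs\<close> has \<open>length Xs + 1\<close> entries, so its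
      last slot has index \<open>length Xs\<close>.\<close>
    have "?M[Suc (length ?c) := Mor C Z' (last Xs)] = ?M'" "?M ! Suc (length ?c) = Mor C X' (last Xs)"
      "Suc (length ?c) < length ?M"
      by (simp_all del: chain_mors_length)
    then have upd: "?M[length Xs := Mor C Z' (last Xs)] = ?M'" "?M ! length Xs = Mor C X' (last Xs)"
      "length Xs < length ?M"
      using l by (simp_all only: Suc_eq_plus1)
    have T: "multilinear R ?M' ?N (\<lambda>fs. bar_elem R C Z Z' n Xs (fs[0 := Comp C (hd Xs) X Z a (fs ! 0)]))"
      by (rule multilinear_update[where P="Mor C (hd Xs) Z"])
        (use bar_elem_multilinear[OF Z Xs] comp_linear_right[OF o(1) X(1) Z(1) a] in
          \<open>simp_all add: bar_mors_eq[OF ne]\<close>)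
    have u: "(\<lambda>g. Comp C Z' X' (last Xs) g b) \<in> module_hom R (?M ! length Xs) (Mor C Z' (last Xs))"
      unfolding upd(2) by (rule comp_linear_left[OF Z(2) X(2) o(2) b])
    have "multilinear R (bar_mors C X X' Xs) ?N (\<lambda>fs. bar_elem R C Z Z' n Xs
        ((fs[length Xs := Comp C Z' X' (last Xs) (fs ! length Xs) b])
          [0 := Comp C (hd Xs) X Z a ((fs[length Xs := Comp C Z' X' (last Xs) (fs ! length Xs) b]) ! 0)]))"
      unfolding bar_mors_eq[OF ne] by (rule multilinear_update[OF T[folded upd(1)] u upd(3)])
    then show ?thesis
    proof (rule multilinear_cong)
      fix fs assume "fs \<in> tensor_words (bar_mors C X X' Xs)"
      then obtain f ms g where fs: "fs = f # ms @ [g]" "ms \<in> tensor_words ?c"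
        by (auto simp: bar_word_iff[OF ne])
      have "length Xs = Suc (length ms)" using tensor_words_length[OF fs(2)] l by simp
      then show "?g Xs fs = bar_elem R C Z Z' n Xs
        ((fs[length Xs := Comp C Z' X' (last Xs) (fs ! length Xs) b])
          [0 := Comp C (hd Xs) X Z a ((fs[length Xs := Comp C Z' X' (last Xs) (fs ! length Xs) b]) ! 0)])"
        using fs by simp
    next
      fix M assume "M \<in> set (bar_mors C X X' Xs)"
      then show "module R M"
        by (rule bar_mors_module[OF X, rotated]) (use Xs in \<open>simp add: bar_index_iff\<close>)
    qed
  qed
  show "(\<lambda>x. bar_act R C X Z X' Z' n a x b) \<in> module_hom R (bar_module R C X X' n) ?N"
    unfolding bar_act_def by (rule bar_extend(1)[OF X N g])
  show "bar_act R C X Z X' Z' n a (bar_elem R C X X' n Xs (f # ms @ [g])) b =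
      bar_elem R C Z Z' n Xs (Comp C (hd Xs) X Z a f # ms @ [Comp C Z' X' (last Xs) g b])"
    if "Xs \<in> bar_index C n" "f # ms @ [g] \<in> tensor_words (bar_mors C X X' Xs)" for Xs f ms g
    unfolding bar_act_def by (subst bar_extend(2)[OF X N g that]) auto
qed

text \<open>The action touches only the two end slots. Inner faces do not see it, and for the first
  and the last face the compatibility is associativity of composition.\<close>

lemma bar_diff_act:
  assumes X: "X \<in> Ob C" "X' \<in> Ob C" and Z: "Z \<in> Ob C" "Z' \<in> Ob C"
    and a: "a \<in> carrier (Mor C X Z)" and b: "b \<in> carrier (Mor C Z' X')"
    and x: "x \<in> carrier (bar_module R C X X' n)"
  shows "bar_diff R C Z Z' n (bar_act R C X Z X' Z' n a x b) =
    bar_act R C X Z X' Z' (n + 1) a (bar_diff R C X X' n x) b"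
proof (cases "n < 0")
  case False
  then show ?thesis
    using bar_diff(3)[OF X x] bar_diff(3)[OF Z module_hom_in[OF bar_act(1)[OF X Z a b] x]]
      module_hom_zero[OF bar_module_module[OF X] bar_module_module[OF Z] bar_act(1)[OF X Z a b, of "n + 1"]]
    by simp
next
  case True
  let ?B = "bar_module R C X X' (n + 1)" and ?N = "bar_module R C Z Z' (n + 1)"
  note mX = bar_module_module[OF X] and mZ = bar_module_module[OF Z]
  note A = bar_act[OF X Z a b]
  interpret N: module R ?N by (rule mZ)
  show ?thesis
  proof (rule bar_hom_eqI[OF X mZ module_hom_compose[OF A(1) bar_diff(1)[OF Z]]
        module_hom_compose[OF bar_diff(1)[OF X] A(1)] _ x])
    fix Xs fs assume Xs: "Xs \<in> bar_index C n" and fs: "fs \<in> tensor_words (bar_mors C X X' Xs)"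
    have ne: "Xs \<noteq> []" and o: "set Xs \<subseteq> Ob C" "hd Xs \<in> Ob C" "last Xs \<in> Ob C"
      using Xs by (auto simp: bar_index_iff)
    have l2: "length Xs \<ge> 2" using Xs True by (simp add: bar_index_iff)
    obtain f ms g where f: "fs = f # ms @ [g]" "f \<in> carrier (Mor C (hd Xs) X)"
      "ms \<in> tensor_words (chain_mors C Xs)" "g \<in> carrier (Mor C X' (last Xs))"
      using fs by (auto simp: bar_word_iff[OF ne])
    have lms: "length ms + 1 = length Xs" using tensor_words_length[OF f(3)] ne by (cases Xs) auto
    let ?gs = "Comp C (hd Xs) X Z a f # ms @ [Comp C Z' X' (last Xs) g b]"
    have gs: "?gs \<in> tensor_words (bar_mors C Z Z' Xs)"
      using f comp_closed[OF o(2) X(1) Z(1) f(2) a] comp_closed[OF Z(2) X(2) o(3) b f(4)]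
      by (auto simp: bar_word_iff[OF ne])
    have R: "remove_nth i Xs \<in> bar_index C (n + 1)" if "i < length Xs" for i
      by (rule remove_nth_bar_index[OF Xs True that])
    have W: "merge C (X # Xs @ [X']) i fs \<in> tensor_words (bar_mors C X X' (remove_nth i Xs))"
      if "i < length Xs" for i
      using merge_word[of fs "X # Xs @ [X']" i] fs o X that by (simp add: bar_word_chain)
    have key: "bar_act R C X Z X' Z' (n + 1) a
        (bar_elem R C X X' (n + 1) (remove_nth i Xs) (merge C (X # Xs @ [X']) i fs)) b =
        bar_elem R C Z Z' (n + 1) (remove_nth i Xs) (merge C (Z # Xs @ [Z']) i ?gs)"
      if i: "i < length Xs" for i
    proof -
      \<comment> \<open>Since \<open>length Xs >= 2\<close> in negative degrees, the first and the
        last face are different, and no face merges the two end slots with each other.\<close>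
      consider "i = 0" | "i + 1 = length Xs" "i \<noteq> 0" | j where "i = Suc j" "j + 2 < length Xs"
        using i by (cases i) (auto, linarith)
      then show ?thesis
      proof cases
        case 1
        obtain W Y Ys where XsE: "Xs = W # Y # Ys"
          using l2 by (cases Xs; cases "tl Xs") auto
        then obtain m ms' where ms: "ms = m # ms'" "m \<in> carrier (Mor C Y W)"
          using f(3) by (auto simp: tensor_words_Cons)
        have m1: "merge C (X # Xs @ [X']) i fs = Comp C Y W X f m # ms' @ [g]"
          using 1 XsE f ms by simp
        have m2: "merge C (Z # Xs @ [Z']) i ?gs =
            Comp C Y W Z (Comp C W X Z a f) m # ms' @ [Comp C Z' X' (last Xs) g b]"
          using 1 XsE f ms by simp
        have "Comp C Y X Z a (Comp C Y W X f m) = Comp C Y W Z (Comp C W X Z a f) m"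
          using comp_assoc[of Y W X Z m f a] o X Z a f ms XsE by simp
        then show ?thesis
          using A(2)[OF R[OF i] W[OF i, unfolded m1]] 1 XsE unfolding m1 m2 by simp
      next
        case 2
        obtain Ys Y W where XsE: "Xs = Ys @ [Y, W]"
          using l2 by (cases Xs rule: rev_cases; cases "butlast Xs" rule: rev_cases) auto
        have "chain_mors C Xs = chain_mors C (Ys @ [Y]) @ [Mor C W Y]"
          using chain_mors_snoc[of "Ys @ [Y]" C W] XsE by simp
        then obtain ms' m where ms: "ms = ms' @ [m]" "m \<in> carrier (Mor C W Y)"
          using f(3) by (auto simp: tensor_words_snoc)
        have i': "i = Suc (length Ys)" "length ms' = length Ys" using 2 XsE lms ms by auto
        have m1: "merge C (X # Xs @ [X']) i fs = f # ms' @ [Comp C X' W Y m g]"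
          using i' XsE f ms by (simp add: merge_def nth_append)
        have m2: "merge C (Z # Xs @ [Z']) i ?gs =
            Comp C (hd Xs) X Z a f # ms' @ [Comp C Z' W Y m (Comp C Z' X' W g b)]"
          using i' XsE f ms by (simp add: merge_def nth_append)
        have "Comp C Z' X' Y (Comp C X' W Y m g) b = Comp C Z' W Y m (Comp C Z' X' W g b)"
          using comp_assoc[of Z' X' W Y b g m] o X Z b f ms XsE by simp
        then show ?thesis
          using A(2)[OF R[OF i] W[OF i, unfolded m1]] i' XsE hd_append2[of "Ys @ [Y]" "[W]"]
          unfolding m1 m2 by simp
      next
        case 3
        have m1: "merge C (X # Xs @ [X']) i fs = f # merge C Xs j ms @ [g]"
          using 3 f lms by (simp add: merge_append)
        have m2: "merge C (Z # Xs @ [Z']) i ?gs =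
            Comp C (hd Xs) X Z a f # merge C Xs j ms @ [Comp C Z' X' (last Xs) g b]"
          using 3 lms by (simp add: merge_append)
        show ?thesis
          using A(2)[OF R[OF i] W[OF i, unfolded m1]] 3 hd_remove_nth_Suc[OF ne, of j] last_remove_nth[of i Xs]
          unfolding m1 m2 by simp
      qed
    qed
    have "bar_diff R C Z Z' n (bar_act R C X Z X' Z' n a (bar_elem R C X X' n Xs fs) b) =
        bar_diff R C Z Z' n (bar_elem R C Z Z' n Xs ?gs)"
      using A(2)[OF Xs fs[unfolded f(1)]] f(1) by simp
    also have "\<dots> = (\<Oplus>\<^bsub>?N\<^esub>i\<in>{..<length Xs}. signed ?N (int i)
        (bar_elem R C Z Z' (n + 1) (remove_nth i Xs) (merge C (Z # Xs @ [Z']) i ?gs)))"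
      by (rule bar_diff(2)[OF Z Xs gs True])
    also have "\<dots> = (\<Oplus>\<^bsub>?N\<^esub>i\<in>{..<length Xs}. bar_act R C X Z X' Z' (n + 1) a (signed ?B (int i)
        (bar_elem R C X X' (n + 1) (remove_nth i Xs) (merge C (X # Xs @ [X']) i fs))) b)"
    proof (rule N.finsum_cong')
      show "(\<lambda>i. bar_act R C X Z X' Z' (n + 1) a (signed ?B (int i)
        (bar_elem R C X X' (n + 1) (remove_nth i Xs) (merge C (X # Xs @ [X']) i fs))) b) \<in> {..<length Xs} \<rightarrow> carrier ?N"
        by (intro funcsetI module_hom_in[OF A(1)] signed_closed[OF mX] bar_elem_closed[OF X R W]) auto
      fix i assume "i \<in> {..<length Xs}"
      then have i: "i < length Xs" by simp
      show "signed ?N (int i) (bar_elem R C Z Z' (n + 1) (remove_nth i Xs) (merge C (Z # Xs @ [Z']) i ?gs)) =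
          bar_act R C X Z X' Z' (n + 1) a (signed ?B (int i)
            (bar_elem R C X X' (n + 1) (remove_nth i Xs) (merge C (X # Xs @ [X']) i fs))) b"
        using module_hom_signed[OF mX mZ A(1) bar_elem_closed[OF X R[OF i] W[OF i]]] key[OF i] by simp
    qed simp
    also have "\<dots> = bar_act R C X Z X' Z' (n + 1) a (\<Oplus>\<^bsub>?B\<^esub>i\<in>{..<length Xs}. signed ?B (int i)
        (bar_elem R C X X' (n + 1) (remove_nth i Xs) (merge C (X # Xs @ [X']) i fs))) b"
      by (rule module_hom_finsum[OF mX mZ A(1), symmetric])
        (simp, intro signed_closed[OF mX] bar_elem_closed[OF X R W], auto)
    also have "(\<Oplus>\<^bsub>?B\<^esub>i\<in>{..<length Xs}. signed ?B (int i)
        (bar_elem R C X X' (n + 1) (remove_nth i Xs) (merge C (X # Xs @ [X']) i fs))) =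
        bar_diff R C X X' n (bar_elem R C X X' n Xs fs)"
      by (rule bar_diff(2)[OF X Xs fs True, symmetric])
    finally show "bar_diff R C Z Z' n (bar_act R C X Z X' Z' n a (bar_elem R C X X' n Xs fs) b) =
        bar_act R C X Z X' Z' (n + 1) a (bar_diff R C X X' n (bar_elem R C X X' n Xs fs)) b" .
  qed
qed

end

section \<open>Maps from the bar complex into a dg bimodule\<close>

text \<open>The homotopical argument uses the target only through these properties. They are stated
  for an arbitrary bimodule; complexes over the second category enter when $M^G_F$ is shown to be an
  instance.\<close>

locale dg_bimodule = linear_category R C
  for R :: "'k ring" and C :: "('o, 'k, 'm) lin_cat" +
  fixes Q :: "('o, 'k, 'm, 'e) bimod"
  assumes grade_module: "\<lbrakk>X \<in> Ob C; Y \<in> Ob C\<rbrakk> \<Longrightarrow> module R (grade (cpx Q X Y) n)"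
    and diff_hom: "\<lbrakk>X \<in> Ob C; Y \<in> Ob C\<rbrakk> \<Longrightarrow>
      diff (cpx Q X Y) n \<in> module_hom R (grade (cpx Q X Y) n) (grade (cpx Q X Y) (n + 1))"
    and diff_diff: "\<lbrakk>X \<in> Ob C; Y \<in> Ob C; q \<in> carrier (grade (cpx Q X Y) n)\<rbrakk> \<Longrightarrow>
      diff (cpx Q X Y) (n + 1) (diff (cpx Q X Y) n q) = \<zero>\<^bsub>grade (cpx Q X Y) (n + 1 + 1)\<^esub>"
    and act_hom_left: "\<lbrakk>X \<in> Ob C; X' \<in> Ob C; Y \<in> Ob C; Y' \<in> Ob C;
        q \<in> carrier (grade (cpx Q X Y) n); g \<in> carrier (Mor C Y' Y)\<rbrakk> \<Longrightarrow>
      (\<lambda>f. act Q X X' Y Y' n f q g) \<in> module_hom R (Mor C X X') (grade (cpx Q X' Y') n)"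
    and act_hom: "\<lbrakk>X \<in> Ob C; X' \<in> Ob C; Y \<in> Ob C; Y' \<in> Ob C;
        f \<in> carrier (Mor C X X'); g \<in> carrier (Mor C Y' Y)\<rbrakk> \<Longrightarrow>
      (\<lambda>q. act Q X X' Y Y' n f q g) \<in> module_hom R (grade (cpx Q X Y) n) (grade (cpx Q X' Y') n)"
    and act_hom_right: "\<lbrakk>X \<in> Ob C; X' \<in> Ob C; Y \<in> Ob C; Y' \<in> Ob C;
        f \<in> carrier (Mor C X X'); q \<in> carrier (grade (cpx Q X Y) n)\<rbrakk> \<Longrightarrow>
      (\<lambda>g. act Q X X' Y Y' n f q g) \<in> module_hom R (Mor C Y' Y) (grade (cpx Q X' Y') n)"
    and act_act: "\<lbrakk>X \<in> Ob C; X' \<in> Ob C; X'' \<in> Ob C; Y \<in> Ob C; Y' \<in> Ob C; Y'' \<in> Ob C;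
        f \<in> carrier (Mor C X X'); f' \<in> carrier (Mor C X' X'');
        q \<in> carrier (grade (cpx Q X Y) n); g \<in> carrier (Mor C Y' Y); g' \<in> carrier (Mor C Y'' Y')\<rbrakk> \<Longrightarrow>
      act Q X' X'' Y' Y'' n f' (act Q X X' Y Y' n f q g) g' =
      act Q X X'' Y Y'' n (Comp C X X' X'' f' f) q (Comp C Y'' Y' Y g g')"
    and act_ident: "\<lbrakk>X \<in> Ob C; Y \<in> Ob C; q \<in> carrier (grade (cpx Q X Y) n)\<rbrakk> \<Longrightarrow>
      act Q X X Y Y n (Ident C X) q (Ident C Y) = q"
    and diff_act: "\<lbrakk>X \<in> Ob C; X' \<in> Ob C; Y \<in> Ob C; Y' \<in> Ob C;
        f \<in> carrier (Mor C X X'); q \<in> carrier (grade (cpx Q X Y) n); g \<in> carrier (Mor C Y' Y)\<rbrakk> \<Longrightarrow>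
      diff (cpx Q X' Y') n (act Q X X' Y Y' n f q g) =
      act Q X X' Y Y' (n + 1) f (diff (cpx Q X Y) n q) g"
begin

text \<open>One component of a bimodule map, from bar degree \<open>n\<close> to target degree
  \<open>m\<close>; a map of degree \<open>l\<close> has \<open>m = n + l\<close>. Components can be
  constructed one after the other, and no values are prescribed off the carriers.\<close>

definition bar_map ::
    "int \<Rightarrow> int \<Rightarrow> ('o \<Rightarrow> 'o \<Rightarrow> ('o list \<Rightarrow> ('m list \<Rightarrow> 'k) set) \<Rightarrow> 'e) \<Rightarrow> bool" where
  "bar_map n m s \<longleftrightarrow>
     (\<forall>X\<in>Ob C. \<forall>Y\<in>Ob C. s X Y \<in> module_hom R (bar_module R C X Y n) (grade (cpx Q X Y) m)) \<and>
     (\<forall>X\<in>Ob C. \<forall>X'\<in>Ob C. \<forall>Y\<in>Ob C. \<forall>Y'\<in>Ob C. \<forall>f\<in>carrier (Mor C X X').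
        \<forall>b\<in>carrier (bar_module R C X Y n). \<forall>g\<in>carrier (Mor C Y' Y).
          s X' Y' (bar_act R C X X' Y Y' n f b g) = act Q X X' Y Y' m f (s X Y b) g)"

definition bar_gen :: "int \<Rightarrow> 'o list \<Rightarrow> 'm list \<Rightarrow> 'o list \<Rightarrow> ('m list \<Rightarrow> 'k) set" where
  "bar_gen n Xs ms = bar_elem R C (hd Xs) (last Xs) n Xs (Ident C (hd Xs) # ms @ [Ident C (last Xs)])"

lemma bar_map_hom: "bar_map n m s \<Longrightarrow> X \<in> Ob C \<Longrightarrow> Y \<in> Ob C \<Longrightarrow>
    s X Y \<in> module_hom R (bar_module R C X Y n) (grade (cpx Q X Y) m)"
  by (simp add: bar_map_def)

lemma bar_map_act: "bar_map n m s \<Longrightarrow> X \<in> Ob C \<Longrightarrow> X' \<in> Ob C \<Longrightarrow> Y \<in> Ob C \<Longrightarrow> Y' \<in> Ob C \<Longrightarrow>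
    f \<in> carrier (Mor C X X') \<Longrightarrow> b \<in> carrier (bar_module R C X Y n) \<Longrightarrow> g \<in> carrier (Mor C Y' Y) \<Longrightarrow>
    s X' Y' (bar_act R C X X' Y Y' n f b g) = act Q X X' Y Y' m f (s X Y b) g"
  by (simp add: bar_map_def)

lemma bar_index_ends: "Xs \<in> bar_index C n \<Longrightarrow> Xs \<noteq> [] \<and> hd Xs \<in> Ob C \<and> last Xs \<in> Ob C"
  by (auto simp: bar_index_iff)

lemma bar_gen_word:
  assumes "Xs \<in> bar_index C n" "ms \<in> tensor_words (chain_mors C Xs)"
  shows "Ident C (hd Xs) # ms @ [Ident C (last Xs)] \<in> tensor_words (bar_mors C (hd Xs) (last Xs) Xs)"
  using bar_index_ends[OF assms(1)] assms(2) ident_closed by (auto simp: bar_word_iff)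

lemma bar_gen_closed:
  assumes "Xs \<in> bar_index C n" "ms \<in> tensor_words (chain_mors C Xs)"
  shows "bar_gen n Xs ms \<in> carrier (bar_module R C (hd Xs) (last Xs) n)"
  unfolding bar_gen_def using bar_elem_closed[OF _ _ assms(1) bar_gen_word[OF assms]]
    bar_index_ends[OF assms(1)] by simp

text \<open>The outer entries of a word are absorbed by acting on the outer identities of a
  generator.\<close>

lemma bar_elem_eq_act:
  assumes X: "X \<in> Ob C" "X' \<in> Ob C" and Xs: "Xs \<in> bar_index C n"
    and ms: "ms \<in> tensor_words (chain_mors C Xs)"
    and f: "f \<in> carrier (Mor C (hd Xs) X)" and g: "g \<in> carrier (Mor C X' (last Xs))"
  shows "bar_elem R C X X' n Xs (f # ms @ [g]) =
    bar_act R C (hd Xs) X (last Xs) X' n f (bar_gen n Xs ms) g"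
  unfolding bar_gen_def using bar_index_ends[OF Xs] X f g
  by (subst bar_act(2)[OF _ _ _ _ _ _ Xs bar_gen_word[OF Xs ms]])
    (auto simp: comp_ident_left comp_ident_right)

text \<open>Generators suffice: every word is obtained from one of them by the action, which both
  maps respect.\<close>

lemma bar_map_eqI:
  assumes s: "bar_map n m s" and t: "bar_map n m t"
    and eq: "\<And>Xs ms. Xs \<in> bar_index C n \<Longrightarrow> ms \<in> tensor_words (chain_mors C Xs) \<Longrightarrow>
      s (hd Xs) (last Xs) (bar_gen n Xs ms) = t (hd Xs) (last Xs) (bar_gen n Xs ms)"
    and X: "X \<in> Ob C" "Y \<in> Ob C" and x: "x \<in> carrier (bar_module R C X Y n)"
  shows "s X Y x = t X Y x"
proof (rule bar_hom_eqI[OF X grade_module[OF X] bar_map_hom[OF s X] bar_map_hom[OF t X] _ x])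
  fix Xs fs assume Xs: "Xs \<in> bar_index C n" and "fs \<in> tensor_words (bar_mors C X Y Xs)"
  then obtain f ms g where fs: "fs = f # ms @ [g]" "f \<in> carrier (Mor C (hd Xs) X)"
    "ms \<in> tensor_words (chain_mors C Xs)" "g \<in> carrier (Mor C Y (last Xs))"
    using bar_index_ends[OF Xs] by (auto simp: bar_word_iff)
  have e: "hd Xs \<in> Ob C" "last Xs \<in> Ob C" using bar_index_ends[OF Xs] by auto
  note a = e(1) X(1) e(2) X(2) fs(2) bar_gen_closed[OF Xs fs(3)] fs(4)
  show "s X Y (bar_elem R C X Y n Xs fs) = t X Y (bar_elem R C X Y n Xs fs)"
    unfolding fs(1) bar_elem_eq_act[OF X Xs fs(3,2,4)] bar_map_act[OF s a] bar_map_act[OF t a]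
    by (simp only: eq[OF Xs fs(3)])
qed

text \<open>The existence half of freeness. Equivariance forces the value on
  \<open>f # ms @ [h]\<close> to be \<open>t Xs ms\<close> acted on by \<open>f\<close> and
  \<open>h\<close>; this is multilinear because the action is linear in each argument.\<close>

lemma bar_map_extend:
  assumes t: "\<And>Xs. Xs \<in> bar_index C n \<Longrightarrow>
      multilinear R (chain_mors C Xs) (grade (cpx Q (hd Xs) (last Xs)) m) (t Xs)"
  shows "\<exists>s. bar_map n m s \<and> (\<forall>Xs\<in>bar_index C n. \<forall>ms\<in>tensor_words (chain_mors C Xs).
      s (hd Xs) (last Xs) (bar_gen n Xs ms) = t Xs ms)"
proof -
  define g where "g X Y Xs fs = act Q (hd Xs) X (last Xs) Y m (hd fs) (t Xs (butlast (tl fs))) (last fs)"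
    for X Y Xs and fs :: "'m list"
  have g_simp: "g X Y Xs (f # ms @ [h]) = act Q (hd Xs) X (last Xs) Y m f (t Xs ms) h" for X Y Xs f ms h
    by (simp add: g_def)
  have tc: "t Xs ms \<in> carrier (grade (cpx Q (hd Xs) (last Xs)) m)"
    if "Xs \<in> bar_index C n" "ms \<in> tensor_words (chain_mors C Xs)" for Xs ms
    using t[OF that(1)] that(2) by (simp add: multilinear_iff)
  have ml: "multilinear R (bar_mors C X Y Xs) (grade (cpx Q X Y) m) (g X Y Xs)"
    if X: "X \<in> Ob C" "Y \<in> Ob C" and Xs: "Xs \<in> bar_index C n" for X Y Xs
    unfolding multilinear_iff
  proof (intro conjI ballI allI impI)
    have ne: "Xs \<noteq> []" and e: "hd Xs \<in> Ob C" "last Xs \<in> Ob C" using bar_index_ends[OF Xs] by auto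
    fix fs assume "fs \<in> tensor_words (bar_mors C X Y Xs)"
    then obtain f ms h where fs: "fs = f # ms @ [h]" "f \<in> carrier (Mor C (hd Xs) X)"
      "ms \<in> tensor_words (chain_mors C Xs)" "h \<in> carrier (Mor C Y (last Xs))"
      by (auto simp: bar_word_iff[OF ne])
    note T = tc[OF Xs fs(3)]
    have lms: "length ms = length (chain_mors C Xs)" by (rule tensor_words_length[OF fs(3)])
    show "g X Y Xs fs \<in> carrier (grade (cpx Q X Y) m)"
      unfolding fs(1) g_simp by (rule module_hom_in[OF act_hom[OF e(1) X(1) e(2) X(2) fs(2,4)] T])
    fix i assume "i < length (bar_mors C X Y Xs)"
    then consider "i = 0" | j where "i = Suc j" "j < length ms" | "i = Suc (length ms)"
      unfolding bar_mors_eq[OF ne] using lms by (cases i) (auto simp: less_Suc_eq)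
    then show "(\<lambda>x. g X Y Xs (fs[i := x])) \<in> module_hom R (bar_mors C X Y Xs ! i) (grade (cpx Q X Y) m)"
    proof cases
      case 1
      then show ?thesis
        using act_hom_left[OF e(1) X(1) e(2) X(2) T fs(4)] by (simp add: fs(1) g_simp bar_mors_eq[OF ne])
    next
      case 2
      then have "fs[i := x] = f # ms[j := x] @ [h]" for x by (simp add: fs(1) list_update_append)
      moreover have "bar_mors C X Y Xs ! i = chain_mors C Xs ! j"
        using 2 lms by (simp add: bar_mors_eq[OF ne] nth_append)
      ultimately show ?thesis
        using module_hom_compose[OF multilinear_slot[OF t[OF Xs] fs(3)]
            act_hom[OF e(1) X(1) e(2) X(2) fs(2,4)], of j] 2 lms by (simp add: g_simp)
    next
      case 3
      then have "fs[i := x] = f # ms @ [x]" for x by (simp add: fs(1))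
      moreover have "bar_mors C X Y Xs ! i = Mor C Y (last Xs)"
        using 3 lms by (simp add: bar_mors_eq[OF ne] nth_append)
      ultimately show ?thesis
        using act_hom_right[OF e(1) X(1) e(2) X(2) fs(2) T] by (simp add: g_simp)
    qed
  qed
  define s where "s X Y = bar_extend R C X Y n (grade (cpx Q X Y) m) (g X Y)" for X Y
  have hom: "s X Y \<in> module_hom R (bar_module R C X Y n) (grade (cpx Q X Y) m)"
    if "X \<in> Ob C" "Y \<in> Ob C" for X Y
    unfolding s_def by (rule bar_extend(1)[OF that grade_module[OF that] ml[OF that]])
  have val: "s X Y (bar_elem R C X Y n Xs (f # ms @ [h])) = act Q (hd Xs) X (last Xs) Y m f (t Xs ms) h"
    if "X \<in> Ob C" "Y \<in> Ob C" "Xs \<in> bar_index C n" "f # ms @ [h] \<in> tensor_words (bar_mors C X Y Xs)"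
    for X Y Xs f ms h
    unfolding s_def
    by (subst bar_extend(2)[OF that(1,2) grade_module[OF that(1,2)] ml[OF that(1,2)] that(3,4)])
      (simp_all add: g_simp)
  show ?thesis
  proof (intro exI[of _ s] conjI ballI)
    show "bar_map n m s"
      unfolding bar_map_def
    proof (intro conjI ballI hom)
      fix X X' Y Y' f b g
      assume X: "X \<in> Ob C" and X': "X' \<in> Ob C" and Y: "Y \<in> Ob C" and Y': "Y' \<in> Ob C"
        and f: "f \<in> carrier (Mor C X X')" and b: "b \<in> carrier (bar_module R C X Y n)"
        and g: "g \<in> carrier (Mor C Y' Y)"
      show "s X' Y' (bar_act R C X X' Y Y' n f b g) = act Q X X' Y Y' m f (s X Y b) g"
      proof (rule bar_hom_eqI[OF X Y grade_module[OF X' Y']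
            module_hom_compose[OF bar_act(1)[OF X Y X' Y' f g] hom[OF X' Y']]
            module_hom_compose[OF hom[OF X Y] act_hom[OF X X' Y Y' f g]] _ b])
        fix Xs fs assume Xs: "Xs \<in> bar_index C n" and fs: "fs \<in> tensor_words (bar_mors C X Y Xs)"
        have ne: "Xs \<noteq> []" and e: "hd Xs \<in> Ob C" "last Xs \<in> Ob C" using bar_index_ends[OF Xs] by auto
        obtain f0 ms g0 where f0: "fs = f0 # ms @ [g0]" "f0 \<in> carrier (Mor C (hd Xs) X)"
          "ms \<in> tensor_words (chain_mors C Xs)" "g0 \<in> carrier (Mor C Y (last Xs))"
          using fs by (auto simp: bar_word_iff[OF ne])
        let ?fs = "Comp C (hd Xs) X X' f f0 # ms @ [Comp C Y' Y (last Xs) g0 g]"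
        have W: "?fs \<in> tensor_words (bar_mors C X' Y' Xs)"
          using f0 comp_closed[OF e(1) X X' f0(2) f] comp_closed[OF Y' Y e(2) g f0(4)]
          by (auto simp: bar_word_iff[OF ne])
        have "s X' Y' (bar_act R C X X' Y Y' n f (bar_elem R C X Y n Xs fs) g) =
            s X' Y' (bar_elem R C X' Y' n Xs ?fs)"
          unfolding f0(1) bar_act(2)[OF X Y X' Y' f g Xs fs[unfolded f0(1)]] ..
        \<comment> \<open>Acting with the composites at the ends of \<open>?fs\<close> is acting
          first with \<open>f0\<close> and \<open>g0\<close> and then with \<open>f\<close> and
          \<open>g\<close>.\<close>
        also have "\<dots> = act Q X X' Y Y' m f (act Q (hd Xs) X (last Xs) Y m f0 (t Xs ms) g0) g"
          unfolding val[OF X' Y' Xs W]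
          by (rule act_act[OF e(1) X X' e(2) Y Y' f0(2) f tc[OF Xs f0(3)] f0(4) g, symmetric])
        finally show "s X' Y' (bar_act R C X X' Y Y' n f (bar_elem R C X Y n Xs fs) g) =
            act Q X X' Y Y' m f (s X Y (bar_elem R C X Y n Xs fs)) g"
          unfolding f0(1) val[OF X Y Xs fs[unfolded f0(1)]] .
      qed
    qed
    fix Xs ms assume Xs: "Xs \<in> bar_index C n" and ms: "ms \<in> tensor_words (chain_mors C Xs)"
    then show "s (hd Xs) (last Xs) (bar_gen n Xs ms) = t Xs ms"
      unfolding bar_gen_def using bar_index_ends[OF Xs] val[OF _ _ Xs bar_gen_word[OF Xs ms]]
        act_ident[OF _ _ tc[OF Xs ms]] by simp
  qed
qed

section \<open>Operations on components, and lifting through the differential\<close>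

lemma bar_map_diff:
  assumes s: "bar_map n m s"
  shows "bar_map n (m + 1) (\<lambda>X Y x. diff (cpx Q X Y) m (s X Y x))"
  unfolding bar_map_def
proof (intro conjI ballI)
  show "(\<lambda>x. diff (cpx Q X Y) m (s X Y x)) \<in> module_hom R (bar_module R C X Y n) (grade (cpx Q X Y) (m + 1))"
    if "X \<in> Ob C" "Y \<in> Ob C" for X Y
    by (rule module_hom_compose[OF bar_map_hom[OF s that] diff_hom[OF that]])
qed (simp add: bar_map_act[OF s] diff_act module_hom_in[OF bar_map_hom[OF s]])

lemma bar_map_bar_diff:
  assumes s: "bar_map (n + 1) m s"
  shows "bar_map n m (\<lambda>X Y x. s X Y (bar_diff R C X Y n x))"
  unfolding bar_map_def
proof (intro conjI ballI)
  show "(\<lambda>x. s X Y (bar_diff R C X Y n x)) \<in> module_hom R (bar_module R C X Y n) (grade (cpx Q X Y) m)"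
    if "X \<in> Ob C" "Y \<in> Ob C" for X Y
    by (rule module_hom_compose[OF bar_diff(1)[OF that] bar_map_hom[OF s that]])
qed (simp add: bar_diff_act bar_map_act[OF s] module_hom_in[OF bar_diff(1)])

lemma bar_map_add:
  assumes s: "bar_map n m s" and t: "bar_map n m t"
  shows "bar_map n m (\<lambda>X Y x. s X Y x \<oplus>\<^bsub>grade (cpx Q X Y) m\<^esub> t X Y x)"
  unfolding bar_map_def
proof (intro conjI ballI)
  show "(\<lambda>x. s X Y x \<oplus>\<^bsub>grade (cpx Q X Y) m\<^esub> t X Y x)
      \<in> module_hom R (bar_module R C X Y n) (grade (cpx Q X Y) m)"
    if "X \<in> Ob C" "Y \<in> Ob C" for X Y
    by (rule module_hom_sum[OF bar_module_module[OF that] grade_module[OF that]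
          bar_map_hom[OF s that] bar_map_hom[OF t that]])
qed (simp add: bar_map_act[OF s] bar_map_act[OF t] module_hom_add[OF act_hom]
      module_hom_in[OF bar_map_hom[OF s]] module_hom_in[OF bar_map_hom[OF t]])

lemma bar_map_signed:
  assumes s: "bar_map n m s"
  shows "bar_map n m (\<lambda>X Y x. signed (grade (cpx Q X Y) m) k (s X Y x))"
  unfolding bar_map_def
proof (intro conjI ballI)
  show "(\<lambda>x. signed (grade (cpx Q X Y) m) k (s X Y x))
      \<in> module_hom R (bar_module R C X Y n) (grade (cpx Q X Y) m)"
    if "X \<in> Ob C" "Y \<in> Ob C" for X Y
    by (rule module_hom_compose[OF bar_map_hom[OF s that] signed_hom[OF grade_module[OF that]]])
qed (simp add: bar_map_act[OF s] module_hom_signed[OF _ _ act_hom] grade_module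
      module_hom_in[OF bar_map_hom[OF s]])

lemma bar_map_zero: "bar_map n m (\<lambda>X Y x. \<zero>\<^bsub>grade (cpx Q X Y) m\<^esub>)"
  unfolding bar_map_def
  by (auto simp: module_hom_zero[OF _ _ act_hom] grade_module bar_module_module
      intro!: module_hom_const_zero)

text \<open>Exactness is asked for on generators alone. Projectivity serves to lift the multilinear
  dependence on the inner morphisms; the outer slots are handled by freeness, and the lifted
  equation again holds everywhere once it holds on generators.\<close>

lemma bar_map_lift:
  assumes proj: "\<And>X Y. X \<in> Ob C \<Longrightarrow> Y \<in> Ob C \<Longrightarrow> projective_module R (Mor C X Y)"
    and th: "bar_map n (m + 1) \<theta>"
    and im: "\<And>Xs ms. Xs \<in> bar_index C n \<Longrightarrow> ms \<in> tensor_words (chain_mors C Xs) \<Longrightarrow>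
      \<theta> (hd Xs) (last Xs) (bar_gen n Xs ms) \<in>
        diff (cpx Q (hd Xs) (last Xs)) m ` carrier (grade (cpx Q (hd Xs) (last Xs)) m)"
  shows "\<exists>s. bar_map n m s \<and> (\<forall>X\<in>Ob C. \<forall>Y\<in>Ob C. \<forall>x\<in>carrier (bar_module R C X Y n).
      diff (cpx Q X Y) m (s X Y x) = \<theta> X Y x)"
proof -
  have "\<exists>\<phi>. multilinear R (chain_mors C Xs) (grade (cpx Q (hd Xs) (last Xs)) m) \<phi> \<and>
      (\<forall>ms\<in>tensor_words (chain_mors C Xs).
        diff (cpx Q (hd Xs) (last Xs)) m (\<phi> ms) = \<theta> (hd Xs) (last Xs) (bar_gen n Xs ms))"
    if Xs: "Xs \<in> bar_index C n" for Xs
  proof (rule multilinear_lift[OF base_ring])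
    have ne: "Xs \<noteq> []" and e: "hd Xs \<in> Ob C" "last Xs \<in> Ob C" using bar_index_ends[OF Xs] by auto
    show "projective_module R M" if "M \<in> set (chain_mors C Xs)" for M
    proof -
      obtain i where i: "i < length Xs - 1" "M = chain_mors C Xs ! i"
        using \<open>M \<in> _\<close> by (auto simp: in_set_conv_nth)
      then have "Xs ! i \<in> Ob C" "Xs ! Suc i \<in> Ob C"
        using Xs nth_mem[of i Xs] nth_mem[of "Suc i" Xs] by (auto simp: bar_index_iff)
      then show ?thesis using i by (simp add: chain_mors_nth proj)
    qed
    show "module R (grade (cpx Q (hd Xs) (last Xs)) m)" "module R (grade (cpx Q (hd Xs) (last Xs)) (m + 1))"
      "diff (cpx Q (hd Xs) (last Xs)) m \<in> module_hom R (grade (cpx Q (hd Xs) (last Xs)) m)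
        (grade (cpx Q (hd Xs) (last Xs)) (m + 1))"
      using grade_module[OF e] diff_hom[OF e] by auto
    show "\<theta> (hd Xs) (last Xs) (bar_gen n Xs ms) \<in>
        diff (cpx Q (hd Xs) (last Xs)) m ` carrier (grade (cpx Q (hd Xs) (last Xs)) m)"
      if "ms \<in> tensor_words (chain_mors C Xs)" for ms by (rule im[OF Xs that])
    \<comment> \<open>Multilinearity in the inner word is read off from the whole word, where inner
      slot \<open>i\<close> is slot \<open>i + 1\<close> behind the identity.\<close>
    let ?T = "\<lambda>fs. \<theta> (hd Xs) (last Xs) (bar_elem R C (hd Xs) (last Xs) n Xs fs)"
    have T: "multilinear R (bar_mors C (hd Xs) (last Xs) Xs) (grade (cpx Q (hd Xs) (last Xs)) (m + 1)) ?T"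
      by (rule multilinear_compose[OF bar_elem_multilinear[OF e Xs] bar_map_hom[OF th e]])
    show "multilinear R (chain_mors C Xs) (grade (cpx Q (hd Xs) (last Xs)) (m + 1))
        (\<lambda>ms. \<theta> (hd Xs) (last Xs) (bar_gen n Xs ms))"
      unfolding multilinear_iff
    proof (intro conjI ballI allI impI)
      fix ms assume ms: "ms \<in> tensor_words (chain_mors C Xs)"
      show "\<theta> (hd Xs) (last Xs) (bar_gen n Xs ms) \<in> carrier (grade (cpx Q (hd Xs) (last Xs)) (m + 1))"
        by (rule module_hom_in[OF bar_map_hom[OF th e] bar_gen_closed[OF Xs ms]])
      fix i assume i: "i < length (chain_mors C Xs)"
      have "length ms = length (chain_mors C Xs)" by (rule tensor_words_length[OF ms])
      then show "(\<lambda>x. \<theta> (hd Xs) (last Xs) (bar_gen n Xs (ms[i := x])))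
          \<in> module_hom R (chain_mors C Xs ! i) (grade (cpx Q (hd Xs) (last Xs)) (m + 1))"
        using multilinear_slot[OF T bar_gen_word[OF Xs ms], of "Suc i"] i
        by (simp add: bar_gen_def bar_mors_eq[OF ne] list_update_append nth_append)
    qed
  qed
  then obtain t where t: "\<And>Xs. Xs \<in> bar_index C n \<Longrightarrow>
      multilinear R (chain_mors C Xs) (grade (cpx Q (hd Xs) (last Xs)) m) (t Xs)"
    and dt: "\<And>Xs ms. Xs \<in> bar_index C n \<Longrightarrow> ms \<in> tensor_words (chain_mors C Xs) \<Longrightarrow>
      diff (cpx Q (hd Xs) (last Xs)) m (t Xs ms) = \<theta> (hd Xs) (last Xs) (bar_gen n Xs ms)"
    by metis
  obtain s where s: "bar_map n m s" and st: "\<And>Xs ms. Xs \<in> bar_index C n \<Longrightarrow>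
      ms \<in> tensor_words (chain_mors C Xs) \<Longrightarrow> s (hd Xs) (last Xs) (bar_gen n Xs ms) = t Xs ms"
    using bar_map_extend[OF t] by blast
  have "diff (cpx Q X Y) m (s X Y x) = \<theta> X Y x"
    if "X \<in> Ob C" "Y \<in> Ob C" "x \<in> carrier (bar_module R C X Y n)" for X Y x
    using bar_map_eqI[OF bar_map_diff[OF s] th _ that] st dt by simp
  with s show ?thesis by blast
qed

text \<open>Solves \<open>D h = \<sigma>\<close> degree by degree for a closed \<open>\<sigma>\<close> of degree \<open>l + 1\<close>, where \<open>\<sigma> r\<close> is the component
  on the bar degree \<open>- (r + 1)\<close>. The right-hand side in each degree is closed by the previous equation,
  hence exact by acyclicity.\<close>

lemma bar_map_solve:
  fixes l :: int
  assumes proj: "\<And>X Y. X \<in> Ob C \<Longrightarrow> Y \<in> Ob C \<Longrightarrow> projective_module R (Mor C X Y)"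
    and acyclic: "\<And>X Y k q. X \<in> Ob C \<Longrightarrow> Y \<in> Ob C \<Longrightarrow> k < 0 \<Longrightarrow> q \<in> carrier (grade (cpx Q X Y) k) \<Longrightarrow>
      diff (cpx Q X Y) k q = \<zero>\<^bsub>grade (cpx Q X Y) (k + 1)\<^esub> \<Longrightarrow> q \<in> coboundaries (cpx Q X Y) k"
    and l: "l \<le> 0"
    and \<sigma>: "\<And>r. bar_map (- int (Suc r)) (l - int r) (\<sigma> r)"
    and closed: "\<And>r X Y x. X \<in> Ob C \<Longrightarrow> Y \<in> Ob C \<Longrightarrow> x \<in> carrier (bar_module R C X Y (- int (Suc (Suc r)))) \<Longrightarrow>
      diff (cpx Q X Y) (l - int (Suc r)) (\<sigma> (Suc r) X Y x) =
      signed (grade (cpx Q X Y) (l - int r)) (l + 1) (\<sigma> r X Y (bar_diff R C X Y (- int (Suc (Suc r))) x))"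
    and h0: "bar_map 0 l h0"
    and obstr: "\<And>Xs ms. Xs \<in> bar_index C (-1) \<Longrightarrow> ms \<in> tensor_words (chain_mors C Xs) \<Longrightarrow>
      \<sigma> 0 (hd Xs) (last Xs) (bar_gen (-1) Xs ms) \<oplus>\<^bsub>grade (cpx Q (hd Xs) (last Xs)) l\<^esub>
      signed (grade (cpx Q (hd Xs) (last Xs)) l) l
        (h0 (hd Xs) (last Xs) (bar_diff R C (hd Xs) (last Xs) (-1) (bar_gen (-1) Xs ms)))
      \<in> coboundaries (cpx Q (hd Xs) (last Xs)) l"
  shows "\<exists>h. h 0 = h0 \<and> (\<forall>r. bar_map (- int r) (l - int r) (h r)) \<and>
    (\<forall>r. \<forall>X\<in>Ob C. \<forall>Y\<in>Ob C. \<forall>x\<in>carrier (bar_module R C X Y (- int (Suc r))).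
      diff (cpx Q X Y) (l - int (Suc r)) (h (Suc r) X Y x) =
      \<sigma> r X Y x \<oplus>\<^bsub>grade (cpx Q X Y) (l - int r)\<^esub>
      signed (grade (cpx Q X Y) (l - int r)) l (h r X Y (bar_diff R C X Y (- int (Suc r)) x)))"
proof -
  \<comment> \<open>The right-hand side of \<open>d h = \<sigma> + (-1)^l h d\<close> on bar degree
    \<open>-(r + 1)\<close>; its target degree is \<open>-(r + 1) + (l + 1) = l - r\<close>.\<close>
  define \<theta> where "\<theta> r h X Y x = \<sigma> r X Y x \<oplus>\<^bsub>grade (cpx Q X Y) (l - int r)\<^esub>
      signed (grade (cpx Q X Y) (l - int r)) l (h X Y (bar_diff R C X Y (- int (Suc r)) x))"
    for r and h X Y x
  have deg: "- int (Suc r) + 1 = - int r" "l - int (Suc r) + 1 = l - int r" "l - int r - 1 = l - int (Suc r)" for r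
    by auto
  \<comment> \<open>Exactness of the next right-hand side is carried along, since the next lift
    needs it. At \<open>r = 0\<close> it comes from \<open>obstr\<close>, later from
    acyclicity.\<close>
  define P where "P r h \<longleftrightarrow> (r = 0 \<longrightarrow> h = h0) \<and> bar_map (- int r) (l - int r) h \<and>
      (\<forall>Xs\<in>bar_index C (- int (Suc r)). \<forall>ms\<in>tensor_words (chain_mors C Xs).
        \<theta> r h (hd Xs) (last Xs) (bar_gen (- int (Suc r)) Xs ms) \<in> coboundaries (cpx Q (hd Xs) (last Xs)) (l - int r))"
    for r h
  define rel where "rel r h h' \<longleftrightarrow> (\<forall>X\<in>Ob C. \<forall>Y\<in>Ob C. \<forall>x\<in>carrier (bar_module R C X Y (- int (Suc r))).
      diff (cpx Q X Y) (l - int (Suc r)) (h' X Y x) = \<theta> r h X Y x)" for r h h'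
  have step: "\<exists>h'. P (Suc r) h' \<and> rel r h h'" if P: "P r h" for r h
  proof -
    have h: "bar_map (- int r) (l - int r) h" using P by (simp add: P_def)
    have th: "bar_map (- int (Suc r)) (l - int r) (\<theta> r h)"
      unfolding \<theta>_def
      by (rule bar_map_add[OF \<sigma> bar_map_signed[OF bar_map_bar_diff]]) (use h deg in simp)
    have "\<exists>s. bar_map (- int (Suc r)) (l - int (Suc r)) s \<and>
        (\<forall>X\<in>Ob C. \<forall>Y\<in>Ob C. \<forall>x\<in>carrier (bar_module R C X Y (- int (Suc r))).
          diff (cpx Q X Y) (l - int (Suc r)) (s X Y x) = \<theta> r h X Y x)"
    proof (rule bar_map_lift[OF proj])
      show "bar_map (- int (Suc r)) (l - int (Suc r) + 1) (\<theta> r h)" unfolding deg by (rule th)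
      show "\<theta> r h (hd Xs) (last Xs) (bar_gen (- int (Suc r)) Xs ms) \<in>
          diff (cpx Q (hd Xs) (last Xs)) (l - int (Suc r)) ` carrier (grade (cpx Q (hd Xs) (last Xs)) (l - int (Suc r)))"
        if "Xs \<in> bar_index C (- int (Suc r))" "ms \<in> tensor_words (chain_mors C Xs)" for Xs ms
        using P that unfolding P_def coboundaries_def deg(3) by blast
    qed
    then obtain h' where h': "bar_map (- int (Suc r)) (l - int (Suc r)) h'" and rel: "rel r h h'"
      unfolding rel_def by blast
    have "P (Suc r) h'"
      unfolding P_def
    proof (intro conjI ballI)
      fix Xs ms assume Xs: "Xs \<in> bar_index C (- int (Suc (Suc r)))" and ms: "ms \<in> tensor_words (chain_mors C Xs)"
      let ?X = "hd Xs" and ?Y = "last Xs" and ?n = "- int (Suc (Suc r))"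
      let ?q = "\<theta> (Suc r) h' ?X ?Y (bar_gen ?n Xs ms)"
      let ?K = "grade (cpx Q ?X ?Y)" and ?d = "diff (cpx Q ?X ?Y)"
      have e: "?X \<in> Ob C" "?Y \<in> Ob C" using bar_index_ends[OF Xs] by auto
      note m = grade_module[OF e] and d = diff_hom[OF e]
      interpret K: module R "?K (l - int r)" by (rule m)
      let ?x = "bar_gen ?n Xs ms"
      have x: "?x \<in> carrier (bar_module R C ?X ?Y ?n)" by (rule bar_gen_closed[OF Xs ms])
      define y where "y = bar_diff R C ?X ?Y ?n ?x"
      have y: "y \<in> carrier (bar_module R C ?X ?Y (- int (Suc r)))"
        using module_hom_in[OF bar_diff(1)[OF e] x] unfolding y_def deg .
      have yy: "bar_diff R C ?X ?Y (- int (Suc r)) y = \<zero>\<^bsub>bar_module R C ?X ?Y (- int r)\<^esub>"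
        using bar_diff_diff[OF e x] unfolding y_def deg .
      have s1: "\<sigma> (Suc r) ?X ?Y ?x \<in> carrier (?K (l - int (Suc r)))"
        by (rule module_hom_in[OF bar_map_hom[OF \<sigma> e] x])
      have h1: "h' ?X ?Y y \<in> carrier (?K (l - int (Suc r)))"
        by (rule module_hom_in[OF bar_map_hom[OF h' e] y])
      have s0: "\<sigma> r ?X ?Y y \<in> carrier (?K (l - int r))"
        by (rule module_hom_in[OF bar_map_hom[OF \<sigma> e] y])
      have q: "?q \<in> carrier (?K (l - int (Suc r)))"
        unfolding \<theta>_def y_def[symmetric]
        by (rule abelian_monoid.a_closed[OF _ s1 signed_closed[OF m h1]])
          (use m in \<open>simp add: module_def abelian_group_def\<close>)
      \<comment> \<open>The term of the previous equation that contains \<open>h\<close> is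
        evaluated at the boundary of the boundary \<open>y\<close>, so only \<sigma> survives
        there.\<close>
      have "h ?X ?Y (\<zero>\<^bsub>bar_module R C ?X ?Y (- int r)\<^esub>) = \<zero>\<^bsub>?K (l - int r)\<^esub>"
        by (rule module_hom_zero[OF bar_module_module[OF e] m bar_map_hom[OF h e]])
      then have th0: "\<theta> r h ?X ?Y y = \<sigma> r ?X ?Y y"
        unfolding \<theta>_def yy using s0 by (simp add: signed_def)
      have "?d (l - int (Suc r)) ?q = ?d (l - int (Suc r)) (\<sigma> (Suc r) ?X ?Y ?x) \<oplus>\<^bsub>?K (l - int r)\<^esub>
          signed (?K (l - int r)) l (?d (l - int (Suc r)) (h' ?X ?Y y))"
        unfolding \<theta>_def y_def[symmetric]
        using module_hom_add[OF d s1 signed_closed[OF m h1]] module_hom_signed[OF m m d h1]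
        unfolding deg by simp
      \<comment> \<open>Closedness of \<sigma> contributes the sign \<open>(-1)^(l + 1)\<close> and
        the equation for \<open>h'\<close> the sign \<open>(-1)^l\<close>, in front of the same
        element.\<close>
      also have "\<dots> = signed (?K (l - int r)) (l + 1) (\<sigma> r ?X ?Y y) \<oplus>\<^bsub>?K (l - int r)\<^esub>
          signed (?K (l - int r)) l (\<sigma> r ?X ?Y y)"
        using closed[OF e x] rel e y th0 unfolding rel_def y_def by simp
      also have "\<dots> = \<zero>\<^bsub>?K (l - int r)\<^esub>"
        using s0 by (simp add: signed_def K.l_neg K.r_neg)
      \<comment> \<open>The degree \<open>l - (r + 1)\<close> is negative because
        \<open>l <= 0\<close>, so the cocycle is exact.\<close>
      finally show "?q \<in> coboundaries (cpx Q ?X ?Y) (l - int (Suc r))"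
        using l by (intro acyclic[OF e _ q]) (simp_all add: deg[simplified])
    qed (use h' in auto)
    with rel show ?thesis by blast
  qed
  have "P 0 h0" unfolding P_def \<theta>_def using h0 obstr by simp
  \<comment> \<open>Each step depends only on its predecessor, so dependent choice gives the family;
    the clause for \<open>r = 0\<close> in \<open>P\<close> pins its start to
    \<open>h0\<close>.\<close>
  then obtain h where h: "\<And>r. P r (h r)" "\<And>r. rel r (h r) (h (Suc r))"
    using dependent_nat_choice[of P rel] step by blast
  then show ?thesis
    by (intro exI[of _ h] conjI) (auto simp: P_def rel_def \<theta>_def)
qed

section \<open>The complex of bimodule maps out of the bar complex\<close>

abbreviation "bar_maps \<equiv> bimodule_maps R C (bar_bimodule R C) Q"
abbreviation "bar_map_complex \<equiv> bimodule_map_complex R C (bar_bimodule R C) Q"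

lemma bar_cpx [simp]:
  "grade (cpx (bar_bimodule R C) X Y) = bar_module R C X Y"
  "diff (cpx (bar_bimodule R C) X Y) = bar_diff R C X Y"
  "act (bar_bimodule R C) = bar_act R C"
  by (simp_all add: bar_bimodule_def)

lemma bar_map_complex_carrier [simp]: "carrier (grade bar_map_complex l) = bar_maps l"
  by (simp add: bimodule_map_complex_def module_of_def)

lemma bar_map_complex_zero: "\<zero>\<^bsub>grade bar_map_complex l\<^esub> =
    (\<lambda>X\<in>Ob C. \<lambda>Y\<in>Ob C. \<lambda>n. \<lambda>b\<in>carrier (bar_module R C X Y n). \<zero>\<^bsub>grade (cpx Q X Y) (n + l)\<^esub>)"
  by (simp add: bimodule_map_complex_def module_of_def)

lemma bar_map_complex_diff: "diff bar_map_complex l \<phi> =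
    (\<lambda>X\<in>Ob C. \<lambda>Y\<in>Ob C. \<lambda>n. \<lambda>b\<in>carrier (bar_module R C X Y n).
      diff (cpx Q X Y) (n + l) (\<phi> X Y n b) \<ominus>\<^bsub>grade (cpx Q X Y) (n + l + 1)\<^esub>
      signed (grade (cpx Q X Y) (n + l + 1)) l (\<phi> X Y (n + 1) (bar_diff R C X Y n b)))"
  by (simp add: bimodule_map_complex_def)

lemma bar_maps_bar_map: "\<phi> \<in> bar_maps l \<Longrightarrow> bar_map n (n + l) (\<lambda>X Y. \<phi> X Y n)"
  unfolding bimodule_maps_def bar_map_def by (auto simp: PiE_iff)

lemma bar_mapsI:
  assumes "\<And>n. bar_map n (n + l) (s n)"
  shows "(\<lambda>X\<in>Ob C. \<lambda>Y\<in>Ob C. \<lambda>n. \<lambda>b\<in>carrier (bar_module R C X Y n). s n X Y b) \<in> bar_maps l"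
  unfolding bimodule_maps_def
  by (auto simp: PiE_iff bar_map_act[OF assms] bar_map_hom[OF assms] module_hom_in[OF bar_act(1)]
      bar_module_module intro!: module_hom_restrict)

text \<open>Elements of \<open>bar_maps\<close> are undefined off the objects and the carriers, so
  pointwise agreement on carriers yields equality of functions.\<close>

lemma bar_maps_eqI:
  assumes "\<phi> \<in> bar_maps l"
    and "\<And>X Y n b. X \<in> Ob C \<Longrightarrow> Y \<in> Ob C \<Longrightarrow> b \<in> carrier (bar_module R C X Y n) \<Longrightarrow> s X Y n b = \<phi> X Y n b"
  shows "(\<lambda>X\<in>Ob C. \<lambda>Y\<in>Ob C. \<lambda>n. \<lambda>b\<in>carrier (bar_module R C X Y n). s X Y n b) = \<phi>"
proof (intro ext)
  fix X Y n b
  have "\<phi> \<in> (\<Pi>\<^sub>E X\<in>Ob C. \<Pi>\<^sub>E Y\<in>Ob C. \<Pi>\<^sub>E n\<in>UNIV. extensional (carrier (bar_module R C X Y n)))"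
    using assms(1) unfolding bimodule_maps_def by (simp add: PiE_iff)
  then show "(\<lambda>X\<in>Ob C. \<lambda>Y\<in>Ob C. \<lambda>n. \<lambda>b\<in>carrier (bar_module R C X Y n). s X Y n b) X Y n b = \<phi> X Y n b"
    using assms(2) by (auto simp: PiE_iff extensional_def restrict_def)
qed

lemma bar_map_pos:
  assumes "bar_map n m s" "n > 0" "X \<in> Ob C" "Y \<in> Ob C" "x \<in> carrier (bar_module R C X Y n)"
  shows "s X Y x = \<zero>\<^bsub>grade (cpx Q X Y) m\<^esub>"
proof (rule bar_map_eqI[OF assms(1) bar_map_zero _ assms(3-5)])
  fix Xs assume "Xs \<in> bar_index C n"
  then have False using assms(2) by (cases Xs) (auto simp: bar_index_iff)
  then show "s (hd Xs) (last Xs) (bar_gen n Xs ms) = \<zero>\<^bsub>grade (cpx Q (hd Xs) (last Xs)) m\<^esub>" for ms ..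
qed

text \<open>Passage from components indexed by \<open>r\<close> to a single map graded by all
  integers. The equation is \<open>dh0\<close> in degree 0, trivial in positive degrees, and
  supplied by the recursion in negative ones.\<close>

lemma bar_map_complex_solve:
  assumes proj: "\<And>X Y. X \<in> Ob C \<Longrightarrow> Y \<in> Ob C \<Longrightarrow> projective_module R (Mor C X Y)"
    and acyclic: "\<And>X Y k q. X \<in> Ob C \<Longrightarrow> Y \<in> Ob C \<Longrightarrow> k < 0 \<Longrightarrow> q \<in> carrier (grade (cpx Q X Y) k) \<Longrightarrow>
      diff (cpx Q X Y) k q = \<zero>\<^bsub>grade (cpx Q X Y) (k + 1)\<^esub> \<Longrightarrow> q \<in> coboundaries (cpx Q X Y) k"
    and l: "l \<le> 0"
    and \<sigma>: "\<sigma> \<in> bar_maps (l + 1)" and closed: "diff bar_map_complex (l + 1) \<sigma> = \<zero>\<^bsub>grade bar_map_complex (l + 1 + 1)\<^esub>"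
    and h0: "bar_map 0 l h0"
    and dh0: "\<And>X Y x. X \<in> Ob C \<Longrightarrow> Y \<in> Ob C \<Longrightarrow> x \<in> carrier (bar_module R C X Y 0) \<Longrightarrow>
      diff (cpx Q X Y) l (h0 X Y x) = \<sigma> X Y 0 x"
    and obstr: "\<And>Xs ms. Xs \<in> bar_index C (-1) \<Longrightarrow> ms \<in> tensor_words (chain_mors C Xs) \<Longrightarrow>
      \<sigma> (hd Xs) (last Xs) (-1) (bar_gen (-1) Xs ms) \<oplus>\<^bsub>grade (cpx Q (hd Xs) (last Xs)) l\<^esub>
      signed (grade (cpx Q (hd Xs) (last Xs)) l) l
        (h0 (hd Xs) (last Xs) (bar_diff R C (hd Xs) (last Xs) (-1) (bar_gen (-1) Xs ms)))
      \<in> coboundaries (cpx Q (hd Xs) (last Xs)) l"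
  shows "\<exists>\<phi>\<in>bar_maps l. diff bar_map_complex l \<phi> = \<sigma> \<and>
    (\<forall>X\<in>Ob C. \<forall>Y\<in>Ob C. \<forall>x\<in>carrier (bar_module R C X Y 0). \<phi> X Y 0 x = h0 X Y x)"
proof -
  define S where "S r X Y = \<sigma> X Y (- int (Suc r))" for r X Y
  have S: "bar_map (- int (Suc r)) (l - int r) (S r)" for r
    using bar_maps_bar_map[OF \<sigma>, of "- int (Suc r)"] by (simp add: S_def[abs_def] algebra_simps)
  \<comment> \<open>Closedness of \<sigma>, evaluated in bar degree \<open>-(r + 2)\<close> and
    solved for its first term.\<close>
  have cl: "diff (cpx Q X Y) (l - int (Suc r)) (S (Suc r) X Y x) =
      signed (grade (cpx Q X Y) (l - int r)) (l + 1) (S r X Y (bar_diff R C X Y (- int (Suc (Suc r))) x))"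
    if X: "X \<in> Ob C" "Y \<in> Ob C" and x: "x \<in> carrier (bar_module R C X Y (- int (Suc (Suc r))))" for r X Y x
  proof -
    let ?n = "- int (Suc (Suc r))"
    have deg: "?n + (l + 1) = l - int (Suc r)" "?n + (l + 1) + 1 = l - int r" "?n + (l + 1 + 1) = l - int r"
      "?n + 1 = - int (Suc r)" "l - int (Suc r) + 1 = l - int r"
      by auto
    interpret K: module R "grade (cpx Q X Y) (l - int r)" by (rule grade_module[OF X])
    let ?a = "diff (cpx Q X Y) (l - int (Suc r)) (S (Suc r) X Y x)"
    let ?b = "signed (grade (cpx Q X Y) (l - int r)) (l + 1) (S r X Y (bar_diff R C X Y ?n x))"
    have "diff bar_map_complex (l + 1) \<sigma> X Y ?n x = \<zero>\<^bsub>grade bar_map_complex (l + 1 + 1)\<^esub> X Y ?n x"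
      unfolding closed ..
    then have "?a \<ominus>\<^bsub>grade (cpx Q X Y) (l - int r)\<^esub> ?b = \<zero>\<^bsub>grade (cpx Q X Y) (l - int r)\<^esub>"
      unfolding bar_map_complex_diff bar_map_complex_zero S_def using X x
      by (simp only: restrict_apply' deg)
    moreover have "?a \<in> carrier (grade (cpx Q X Y) (l - int r))"
      using module_hom_in[OF diff_hom[OF X] module_hom_in[OF bar_map_hom[OF S X] x]] unfolding deg .
    moreover have "bar_diff R C X Y ?n x \<in> carrier (bar_module R C X Y (- int (Suc r)))"
      using module_hom_in[OF bar_diff(1)[OF X] x] unfolding deg .
    then have "?b \<in> carrier (grade (cpx Q X Y) (l - int r))"
      by (rule signed_closed[OF grade_module[OF X] module_hom_in[OF bar_map_hom[OF S X]]])
    ultimately show ?thesis using module_minus_eq_zeroD[OF K.module_axioms] by blast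
  qed
  have "\<exists>h. h 0 = h0 \<and> (\<forall>r. bar_map (- int r) (l - int r) (h r)) \<and>
    (\<forall>r. \<forall>X\<in>Ob C. \<forall>Y\<in>Ob C. \<forall>x\<in>carrier (bar_module R C X Y (- int (Suc r))).
      diff (cpx Q X Y) (l - int (Suc r)) (h (Suc r) X Y x) =
      S r X Y x \<oplus>\<^bsub>grade (cpx Q X Y) (l - int r)\<^esub>
      signed (grade (cpx Q X Y) (l - int r)) l (h r X Y (bar_diff R C X Y (- int (Suc r)) x)))"
  proof (rule bar_map_solve[where \<sigma>=S])
    fix Xs ms assume "Xs \<in> bar_index C (-1)" "ms \<in> tensor_words (chain_mors C Xs)"
    from obstr[OF this] show "S 0 (hd Xs) (last Xs) (bar_gen (-1) Xs ms) \<oplus>\<^bsub>grade (cpx Q (hd Xs) (last Xs)) l\<^esub>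
      signed (grade (cpx Q (hd Xs) (last Xs)) l) l
        (h0 (hd Xs) (last Xs) (bar_diff R C (hd Xs) (last Xs) (-1) (bar_gen (-1) Xs ms)))
      \<in> coboundaries (cpx Q (hd Xs) (last Xs)) l"
      by (simp add: S_def)
  qed (fact proj acyclic l S cl h0)+
  then obtain h where h: "h 0 = h0" "\<And>r. bar_map (- int r) (l - int r) (h r)"
    and dh: "\<And>r X Y x. X \<in> Ob C \<Longrightarrow> Y \<in> Ob C \<Longrightarrow> x \<in> carrier (bar_module R C X Y (- int (Suc r))) \<Longrightarrow>
      diff (cpx Q X Y) (l - int (Suc r)) (h (Suc r) X Y x) =
      S r X Y x \<oplus>\<^bsub>grade (cpx Q X Y) (l - int r)\<^esub>
      signed (grade (cpx Q X Y) (l - int r)) l (h r X Y (bar_diff R C X Y (- int (Suc r)) x))"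
    by blast
  \<comment> \<open>Component \<open>h r\<close> belongs to bar degree \<open>-r\<close>; the zero
    in positive degrees is the only possible value, as the bar modules vanish there.\<close>
  define s where "s n = (if n \<le> 0 then h (nat (- n)) else (\<lambda>X Y x. \<zero>\<^bsub>grade (cpx Q X Y) (n + l)\<^esub>))" for n
  define \<phi> where "\<phi> = (\<lambda>X\<in>Ob C. \<lambda>Y\<in>Ob C. \<lambda>n. \<lambda>b\<in>carrier (bar_module R C X Y n). s n X Y b)"
  have s: "bar_map n (n + l) (s n)" for n
  proof (cases "n \<le> 0")
    case True
    then have "- int (nat (- n)) = n" "l - int (nat (- n)) = n + l" by auto
    with h(2)[of "nat (- n)"] have "bar_map n (n + l) (h (nat (- n)))" by (simp only:)
    with True show ?thesis by (simp add: s_def)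
  qed (simp add: s_def bar_map_zero)
  have \<phi>: "\<phi> \<in> bar_maps l" unfolding \<phi>_def by (rule bar_mapsI[OF s])
  have val: "\<phi> X Y n b = s n X Y b"
    if "X \<in> Ob C" "Y \<in> Ob C" "b \<in> carrier (bar_module R C X Y n)" for X Y n b
    using that by (simp add: \<phi>_def)
  have "diff bar_map_complex l \<phi> = \<sigma>"
    unfolding bar_map_complex_diff
  proof (rule bar_maps_eqI[OF \<sigma>])
    fix X Y n b assume X: "X \<in> Ob C" "Y \<in> Ob C" and b: "b \<in> carrier (bar_module R C X Y n)"
    note m = grade_module[OF X]
    have db: "bar_diff R C X Y n b \<in> carrier (bar_module R C X Y (n + 1))"
      by (rule module_hom_in[OF bar_diff(1)[OF X] b])
    let ?K = "grade (cpx Q X Y) (n + l + 1)"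
    interpret K: module R ?K by (rule m)
    have sb: "\<sigma> X Y n b \<in> carrier ?K"
      using module_hom_in[OF bar_map_hom[OF bar_maps_bar_map[OF \<sigma>] X] b] by (simp add: add.assoc)
    have hz: "s (n + 1) X Y \<zero>\<^bsub>bar_module R C X Y (n + 1)\<^esub> = \<zero>\<^bsub>?K\<^esub>"
      using module_hom_zero[OF bar_module_module[OF X] m bar_map_hom[OF s[of "n + 1"] X]]
      by (simp add: algebra_simps)
    have "diff (cpx Q X Y) (n + l) (s n X Y b) \<ominus>\<^bsub>?K\<^esub>
      signed ?K l (s (n + 1) X Y (bar_diff R C X Y n b)) = \<sigma> X Y n b"
    proof (cases "n < 0")
      case True
      \<comment> \<open>The equation in bar degree \<open>n = -(r + 1)\<close> is the one found at
        stage \<open>r\<close>, where \<open>h r\<close> is the component in degree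
        \<open>n + 1\<close>.\<close>
      define r where "r = nat (- n - 1)"
      have n: "n = - int (Suc r)" using True by (simp add: r_def)
      have deg: "n + l = l - int (Suc r)" "l - int (Suc r) + 1 = l - int r" "nat (- n) = Suc r"
        "nat (- (n + 1)) = r"
        by (auto simp: n)
      have sn: "s n = h (Suc r)" "s (n + 1) = h r"
        using True deg(3,4) by (simp_all only: s_def) simp_all
      have hc: "signed ?K l (s (n + 1) X Y (bar_diff R C X Y n b)) \<in> carrier ?K"
        by (rule signed_closed[OF m
              module_hom_in[OF bar_map_hom[OF s[of "n + 1"] X] db, unfolded add.assoc add.commute[of 1 l],
                folded add.assoc]])
      have "diff (cpx Q X Y) (n + l) (s n X Y b) =
          \<sigma> X Y n b \<oplus>\<^bsub>?K\<^esub> signed ?K l (s (n + 1) X Y (bar_diff R C X Y n b))"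
        using dh[OF X, of b r] b unfolding sn deg(1,2) S_def n[symmetric] by blast
      then show ?thesis
        using sb hc by (simp add: K.minus_eq K.a_assoc K.r_neg)
    next
      case False
      \<comment> \<open>For \<open>n >= 0\<close> the bar differential is zero, so this is all that
        the equation says.\<close>
      have "diff (cpx Q X Y) (n + l) (s n X Y b) = \<sigma> X Y n b"
      proof (cases "n = 0")
        case True
        then show ?thesis using dh0[OF X, of b] b h(1) by (simp add: s_def)
      next
        case False
        then have n: "n > 0" using \<open>\<not> n < 0\<close> by simp
        have "s n X Y b = \<zero>\<^bsub>grade (cpx Q X Y) (n + l)\<^esub>"
          by (rule bar_map_pos[OF s n X b])
        moreover have "\<sigma> X Y n b = \<zero>\<^bsub>?K\<^esub>"
          using bar_map_pos[OF bar_maps_bar_map[OF \<sigma>] n X b] by (simp add: add.assoc)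
        ultimately show ?thesis using module_hom_zero[OF m m diff_hom[OF X]] by simp
      qed
      then show ?thesis
        using bar_diff(3)[OF X b] False sb hz by (simp add: signed_def K.minus_eq)
    qed
    then show "diff (cpx Q X Y) (n + l) (\<phi> X Y n b) \<ominus>\<^bsub>?K\<^esub>
      signed ?K l (\<phi> X Y (n + 1) (bar_diff R C X Y n b)) = \<sigma> X Y n b"
      by (simp only: val[OF X b] val[OF X db])
  qed
  moreover have "\<phi> X Y 0 x = h0 X Y x"
    if "X \<in> Ob C" "Y \<in> Ob C" "x \<in> carrier (bar_module R C X Y 0)" for X Y x
    using val[OF that] h(1) by (simp add: s_def)
  ultimately show ?thesis using \<phi> by blast
qed

lemma bar_map_complex_zero_closed: "\<zero>\<^bsub>grade bar_map_complex l\<^esub> \<in> bar_maps l"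
  unfolding bar_map_complex_zero by (rule bar_mapsI[OF bar_map_zero])

lemma bar_map_complex_diff_zero:
  "diff bar_map_complex l \<zero>\<^bsub>grade bar_map_complex l\<^esub> = \<zero>\<^bsub>grade bar_map_complex (l + 1)\<^esub>"
  unfolding bar_map_complex_diff
proof (rule bar_maps_eqI[OF bar_map_complex_zero_closed])
  fix X Y n b assume X: "X \<in> Ob C" "Y \<in> Ob C" and b: "b \<in> carrier (bar_module R C X Y n)"
  have db: "bar_diff R C X Y n b \<in> carrier (bar_module R C X Y (n + 1))"
    by (rule module_hom_in[OF bar_diff(1)[OF X] b])
  interpret K: module R "grade (cpx Q X Y) (n + (l + 1))" by (rule grade_module[OF X])
  have "diff (cpx Q X Y) (n + l) \<zero>\<^bsub>grade (cpx Q X Y) (n + l)\<^esub> = \<zero>\<^bsub>grade (cpx Q X Y) (n + l + 1)\<^esub>"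
    by (rule module_hom_zero[OF grade_module[OF X] grade_module[OF X] diff_hom[OF X]])
  moreover have "n + 1 + l = n + (l + 1)" "n + l + 1 = n + (l + 1)" by auto
  ultimately show "diff (cpx Q X Y) (n + l) (\<zero>\<^bsub>grade bar_map_complex l\<^esub> X Y n b) \<ominus>\<^bsub>grade (cpx Q X Y) (n + l + 1)\<^esub>
      signed (grade (cpx Q X Y) (n + l + 1)) l (\<zero>\<^bsub>grade bar_map_complex l\<^esub> X Y (n + 1) (bar_diff R C X Y n b)) =
      \<zero>\<^bsub>grade bar_map_complex (l + 1)\<^esub> X Y n b"
    using X b db by (simp only: bar_map_complex_zero restrict_apply') (simp add: signed_def K.minus_eq)
qed

section \<open>Bar degrees 0 and -1\<close>

lemma bar_index_0: "Xs \<in> bar_index C 0 \<longleftrightarrow> (\<exists>X\<in>Ob C. Xs = [X])"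
  by (cases Xs) (auto simp: bar_index_iff)

lemma bar_index_1: "Xs \<in> bar_index C (-1) \<longleftrightarrow> (\<exists>X\<in>Ob C. \<exists>Y\<in>Ob C. Xs = [X, Y])"
  by (cases Xs; cases "tl Xs") (auto simp: bar_index_iff)

lemma bar_gen_0: "bar_gen 0 [X] [] = bar_elem R C X X 0 [X] [Ident C X, Ident C X]"
  by (simp add: bar_gen_def)

lemma bar_diff_gen_1:
  assumes X: "X \<in> Ob C" "Y \<in> Ob C" and f: "f \<in> carrier (Mor C Y X)"
  shows "bar_diff R C X Y (-1) (bar_gen (-1) [X, Y] [f]) =
    bar_act R C Y X Y Y 0 f (bar_gen 0 [Y] []) (Ident C Y) \<ominus>\<^bsub>bar_module R C X Y 0\<^esub>
    bar_act R C X X X Y 0 (Ident C X) (bar_gen 0 [X] []) f"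
proof -
  interpret N: module R "bar_module R C X Y 0" by (rule bar_module_module[OF X])
  have i0: "[X] \<in> bar_index C 0" "[Y] \<in> bar_index C 0" using X by (auto simp: bar_index_0)
  have i1: "[X, Y] \<in> bar_index C (-1)" using X by (simp add: bar_index_1)
  have w: "[f] \<in> tensor_words (chain_mors C [X, Y])" using f by simp
  have 1: "bar_elem R C X Y 0 [Y] [f, Ident C Y] = bar_act R C Y X Y Y 0 f (bar_gen 0 [Y] []) (Ident C Y)"
    using bar_elem_eq_act[OF X i0(2), of "[]" f "Ident C Y"] f X ident_closed by simp
  have 2: "bar_elem R C X Y 0 [X] [Ident C X, f] = bar_act R C X X X Y 0 (Ident C X) (bar_gen 0 [X] []) f"
    using bar_elem_eq_act[OF X i0(1), of "[]" "Ident C X" f] f X ident_closed by simp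
  have c: "bar_elem R C X Y 0 [Y] [f, Ident C Y] \<in> carrier (bar_module R C X Y 0)"
    "bar_elem R C X Y 0 [X] [Ident C X, f] \<in> carrier (bar_module R C X Y 0)"
    using bar_elem_closed[OF X i0(2)] bar_elem_closed[OF X i0(1)] f X ident_closed
    by (auto simp: bar_mors_def)
  have "{..<length [X, Y]} = {0, 1}" by auto
  then show ?thesis
    using bar_diff(2)[OF X i1 bar_gen_word[OF i1 w, simplified]] c X f
    by (simp add: bar_gen_def[of "-1"] comp_ident_left comp_ident_right 1 2 signed_def N.minus_eq)
qed

text \<open>The result is the naturality defect of the values of \<open>s\<close> on the elements
  [id, id]. Its exactness is what extending a closed map to bar degree -1 requires.\<close>

lemma bar_map_gen_1:
  assumes s: "bar_map 0 m s" and X: "X \<in> Ob C" "Y \<in> Ob C" and f: "f \<in> carrier (Mor C Y X)"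
  shows "s X Y (bar_diff R C X Y (-1) (bar_gen (-1) [X, Y] [f])) =
    act Q Y X Y Y m f (s Y Y (bar_gen 0 [Y] [])) (Ident C Y) \<ominus>\<^bsub>grade (cpx Q X Y) m\<^esub>
    act Q X X X Y m (Ident C X) (s X X (bar_gen 0 [X] [])) f"
proof -
  have g: "bar_gen 0 [Z] [] \<in> carrier (bar_module R C Z Z 0)" if "Z \<in> Ob C" for Z
    using bar_gen_closed[of "[Z]" 0 "[]"] that by (simp add: bar_index_0)
  note i = ident_closed
  show ?thesis
    unfolding bar_diff_gen_1[OF X f]
    by (subst module_hom_minus[OF bar_module_module[OF X] grade_module[OF X] bar_map_hom[OF s X]
            module_hom_in[OF bar_act(1)[OF X(2,2) X f i[OF X(2)]] g[OF X(2)]]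
            module_hom_in[OF bar_act(1)[OF X(1,1) X i[OF X(1)] f] g[OF X(1)]]])
      (simp only: bar_map_act[OF s X(2,1,2,2) f g[OF X(2)] i[OF X(2)]]
        bar_map_act[OF s X(1,1,1,2) i[OF X(1)] g[OF X(1)] f])
qed

section \<open>Existence and uniqueness for a target without cohomology in negative degrees\<close>

context
  assumes proj: "\<And>X Y. X \<in> Ob C \<Longrightarrow> Y \<in> Ob C \<Longrightarrow> projective_module R (Mor C X Y)"
    and acyclic: "\<And>X Y k q. X \<in> Ob C \<Longrightarrow> Y \<in> Ob C \<Longrightarrow> k < 0 \<Longrightarrow> q \<in> carrier (grade (cpx Q X Y) k) \<Longrightarrow>
      diff (cpx Q X Y) k q = \<zero>\<^bsub>grade (cpx Q X Y) (k + 1)\<^esub> \<Longrightarrow> q \<in> coboundaries (cpx Q X Y) k"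
begin

text \<open>The values \<open>e X\<close> are attained on the nose, not only up to coboundaries,
  because the solution agrees with \<open>h0\<close> in bar degree 0.\<close>

lemma closed_bar_map_exists:
  assumes e: "\<And>X. X \<in> Ob C \<Longrightarrow> e X \<in> carrier (cocycles (cpx Q X X) 0)"
    and nat: "\<And>X Y f. X \<in> Ob C \<Longrightarrow> Y \<in> Ob C \<Longrightarrow> f \<in> carrier (Mor C Y X) \<Longrightarrow>
      act Q Y X Y Y 0 f (e Y) (Ident C Y) \<ominus>\<^bsub>grade (cpx Q X Y) 0\<^esub> act Q X X X Y 0 (Ident C X) (e X) f
      \<in> coboundaries (cpx Q X Y) 0"
  shows "\<exists>\<tau>\<in>carrier (cocycles bar_map_complex 0). \<forall>X\<in>Ob C. \<tau> X X 0 (bar_gen 0 [X] []) = e X"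
proof -
  have ec: "e X \<in> carrier (grade (cpx Q X X) 0)" "diff (cpx Q X X) 0 (e X) = \<zero>\<^bsub>grade (cpx Q X X) 1\<^esub>"
    if "X \<in> Ob C" for X
    using e[OF that] by (auto simp: cocycles_def)
  \<comment> \<open>Bar degree 0 is free on the elements [id, id], so any family of values extends
    to a bimodule map on it.\<close>
  have "\<exists>h0. bar_map 0 0 h0 \<and> (\<forall>Xs\<in>bar_index C 0. \<forall>ms\<in>tensor_words (chain_mors C Xs).
      h0 (hd Xs) (last Xs) (bar_gen 0 Xs ms) = e (hd Xs))"
    by (rule bar_map_extend) (use ec(1) in \<open>auto simp: bar_index_0 multilinear_iff\<close>)
  then obtain h0 where h0: "bar_map 0 0 h0" and "\<forall>Xs\<in>bar_index C 0. \<forall>ms\<in>tensor_words (chain_mors C Xs).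
      h0 (hd Xs) (last Xs) (bar_gen 0 Xs ms) = e (hd Xs)"
    by blast
  then have h0_gen: "h0 X X (bar_gen 0 [X] []) = e X" if "X \<in> Ob C" for X
    using that by (force simp: bar_index_0)
  let ?z = "\<zero>\<^bsub>grade bar_map_complex (0 + 1)\<^esub>"
  have "\<exists>\<phi>\<in>bar_maps 0. diff bar_map_complex 0 \<phi> = ?z \<and>
      (\<forall>X\<in>Ob C. \<forall>Y\<in>Ob C. \<forall>x\<in>carrier (bar_module R C X Y 0). \<phi> X Y 0 x = h0 X Y x)"
  proof (rule bar_map_complex_solve[where l=0 and ?h0.0=h0, OF proj acyclic _ bar_map_complex_zero_closed bar_map_complex_diff_zero h0])
    fix X Y x assume X: "X \<in> Ob C" "Y \<in> Ob C" and x: "x \<in> carrier (bar_module R C X Y 0)"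
    \<comment> \<open>In bar degree 0 the equation is \<open>d h0 = 0\<close>; on generators it says
      that \<open>e X\<close> is a cocycle.\<close>
    have "diff (cpx Q X Y) 0 (h0 X Y x) = \<zero>\<^bsub>grade (cpx Q X Y) (0 + 1)\<^esub>"
      by (rule bar_map_eqI[OF bar_map_diff[OF h0] bar_map_zero _ X x])
        (auto simp: bar_index_0 h0_gen ec(2))
    then show "diff (cpx Q X Y) 0 (h0 X Y x) = ?z X Y 0 x" using X x by (simp add: bar_map_complex_zero)
  next
    \<comment> \<open>With \<sigma> zero, the obstruction is the value of \<open>h0\<close> on the
      boundary of [id, f, id], the naturality defect of \<open>e\<close>.\<close>
    fix Xs ms assume "Xs \<in> bar_index C (-1)" "ms \<in> tensor_words (chain_mors C Xs)"
    then obtain X Y f where X: "X \<in> Ob C" "Y \<in> Ob C" and Xs: "Xs = [X, Y]" "ms = [f]"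
      and f: "f \<in> carrier (Mor C Y X)"
      by (auto simp: bar_index_1 tensor_words_Cons)
    interpret K: module R "grade (cpx Q X Y) 0" by (rule grade_module[OF X])
    have i1: "[X, Y] \<in> bar_index C (-1)" using X by (simp add: bar_index_1)
    have "bar_gen (-1) [X, Y] [f] \<in> carrier (bar_module R C X Y (-1))"
      using bar_gen_closed[OF i1, of "[f]"] f by simp
    then have z: "?z X Y (-1) (bar_gen (-1) [X, Y] [f]) = \<zero>\<^bsub>grade (cpx Q X Y) 0\<^esub>"
      using X by (simp add: bar_map_complex_zero)
    have "act Q Y X Y Y 0 f (e Y) (Ident C Y) \<in> carrier (grade (cpx Q X Y) 0)"
      by (rule module_hom_in[OF act_hom[OF X(2,1,2,2) f ident_closed[OF X(2)]] ec(1)[OF X(2)]])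
    moreover have "act Q X X X Y 0 (Ident C X) (e X) f \<in> carrier (grade (cpx Q X Y) 0)"
      by (rule module_hom_in[OF act_hom[OF X(1,1,1,2) ident_closed[OF X(1)] f] ec(1)[OF X(1)]])
    ultimately show "?z (hd Xs) (last Xs) (-1) (bar_gen (-1) Xs ms) \<oplus>\<^bsub>grade (cpx Q (hd Xs) (last Xs)) 0\<^esub>
        signed (grade (cpx Q (hd Xs) (last Xs)) 0) 0
          (h0 (hd Xs) (last Xs) (bar_diff R C (hd Xs) (last Xs) (-1) (bar_gen (-1) Xs ms)))
        \<in> coboundaries (cpx Q (hd Xs) (last Xs)) 0"
      using nat[OF X f] X by (simp add: Xs z[unfolded add_0_left] bar_map_gen_1[OF h0 X f] h0_gen signed_def)
  qed auto
  then obtain \<phi> where \<phi>: "\<phi> \<in> bar_maps 0" "diff bar_map_complex 0 \<phi> = ?z"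
    "\<And>X. X \<in> Ob C \<Longrightarrow> \<phi> X X 0 (bar_gen 0 [X] []) = h0 X X (bar_gen 0 [X] [])"
    using bar_gen_closed[of "[X]" 0 "[]" for X] by (auto simp: bar_index_0)
  then show ?thesis
    by (intro bexI[of _ \<phi>]) (auto simp: h0_gen cocycles_def)
qed

text \<open>The primitives on [id, id] may be chosen independently of each other: in degree -1 their
  incompatibility is itself a cocycle, hence exact.\<close>

lemma closed_bar_map_coboundary:
  assumes \<sigma>: "\<sigma> \<in> carrier (cocycles bar_map_complex 0)"
    and exact: "\<And>X. X \<in> Ob C \<Longrightarrow> \<sigma> X X 0 (bar_gen 0 [X] []) \<in> coboundaries (cpx Q X X) 0"
  shows "\<sigma> \<in> coboundaries bar_map_complex 0"
proof -
  have \<sigma>m: "\<sigma> \<in> bar_maps 0" and d\<sigma>: "diff bar_map_complex 0 \<sigma> = \<zero>\<^bsub>grade bar_map_complex 1\<^esub>"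
    using \<sigma> by (auto simp: cocycles_def)
  have bm: "bar_map n n (\<lambda>X Y. \<sigma> X Y n)" for n
    using bar_maps_bar_map[OF \<sigma>m, of n] by simp
  \<comment> \<open>The inner words are empty in bar degree 0, so a lift amounts to one chosen
    primitive for each object.\<close>
  have "\<exists>s. bar_map 0 (-1) s \<and> (\<forall>X\<in>Ob C. \<forall>Y\<in>Ob C. \<forall>x\<in>carrier (bar_module R C X Y 0).
      diff (cpx Q X Y) (-1) (s X Y x) = \<sigma> X Y 0 x)"
    by (rule bar_map_lift[OF proj])
      (use bm[of 0] exact in \<open>auto simp: bar_index_0 coboundaries_def\<close>)
  then obtain h0 where h0: "bar_map 0 (-1) h0"
    and dh0: "\<And>X Y x. X \<in> Ob C \<Longrightarrow> Y \<in> Ob C \<Longrightarrow> x \<in> carrier (bar_module R C X Y 0) \<Longrightarrow>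
      diff (cpx Q X Y) (-1) (h0 X Y x) = \<sigma> X Y 0 x"
    by blast
  have "\<exists>\<phi>\<in>bar_maps (-1). diff bar_map_complex (-1) \<phi> = \<sigma> \<and>
    (\<forall>X\<in>Ob C. \<forall>Y\<in>Ob C. \<forall>x\<in>carrier (bar_module R C X Y 0). \<phi> X Y 0 x = h0 X Y x)"
  proof (rule bar_map_complex_solve[where l="-1" and \<sigma>=\<sigma> and ?h0.0=h0, OF proj acyclic _ _ _ h0 dh0])
    show "\<sigma> \<in> bar_maps (-1 + 1)" "diff bar_map_complex (-1 + 1) \<sigma> = \<zero>\<^bsub>grade bar_map_complex (-1 + 1 + 1)\<^esub>"
      using \<sigma>m d\<sigma> by simp_all
    fix Xs ms assume Xs: "Xs \<in> bar_index C (-1)" and ms: "ms \<in> tensor_words (chain_mors C Xs)"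
    let ?X = "hd Xs" and ?Y = "last Xs"
    let ?K = "\<lambda>n. grade (cpx Q ?X ?Y) n" and ?x = "bar_gen (-1) Xs ms"
    have e: "?X \<in> Ob C" "?Y \<in> Ob C" using bar_index_ends[OF Xs] by auto
    have x: "?x \<in> carrier (bar_module R C ?X ?Y (-1))" by (rule bar_gen_closed[OF Xs ms])
    have y: "bar_diff R C ?X ?Y (-1) ?x \<in> carrier (bar_module R C ?X ?Y 0)"
      using module_hom_in[OF bar_diff(1)[OF e] x] by simp
    \<comment> \<open>For \<open>l = -1\<close> the obstruction is \<open>?a - ?b\<close>. Both
      terms have the differential \<open>\<sigma>\<close> of the boundary of \<open>?x\<close>, the
      first because \<sigma> is closed and the second by the choice of \<open>h0\<close>.\<close>
    let ?a = "\<sigma> ?X ?Y (-1) ?x" and ?b = "h0 ?X ?Y (bar_diff R C ?X ?Y (-1) ?x)"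
    have a: "?a \<in> carrier (?K (-1))" using module_hom_in[OF bar_map_hom[OF bm e] x] .
    have b: "?b \<in> carrier (?K (-1))" using module_hom_in[OF bar_map_hom[OF h0 e] y] .
    interpret K: module R "?K (-1)" by (rule grade_module[OF e])
    interpret K0: module R "?K 0" by (rule grade_module[OF e])
    have s0: "\<sigma> ?X ?Y 0 (bar_diff R C ?X ?Y (-1) ?x) \<in> carrier (?K 0)"
      using module_hom_in[OF bar_map_hom[OF bm e] y] .
    have da: "diff (cpx Q ?X ?Y) (-1) ?a \<in> carrier (?K 0)"
      using module_hom_in[OF diff_hom[OF e] a] by simp
    have "diff bar_map_complex 0 \<sigma> ?X ?Y (-1) ?x = \<zero>\<^bsub>?K 0\<^esub>"
      unfolding d\<sigma> bar_map_complex_zero using e x by simp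
    then have "diff (cpx Q ?X ?Y) (-1) ?a = \<sigma> ?X ?Y 0 (bar_diff R C ?X ?Y (-1) ?x)"
      using e x by (intro module_minus_eq_zeroD[OF K0.module_axioms da s0])
        (simp add: bar_map_complex_diff signed_def)
    moreover have "diff (cpx Q ?X ?Y) (-1) ?b = \<sigma> ?X ?Y 0 (bar_diff R C ?X ?Y (-1) ?x)"
      by (rule dh0[OF e y])
    moreover have "diff (cpx Q ?X ?Y) (-1) (?a \<ominus>\<^bsub>?K (-1)\<^esub> ?b) =
        diff (cpx Q ?X ?Y) (-1) ?a \<ominus>\<^bsub>?K 0\<^esub> diff (cpx Q ?X ?Y) (-1) ?b"
      using module_hom_minus[OF grade_module[OF e] grade_module[OF e] diff_hom[OF e] a b] by simp
    ultimately have "diff (cpx Q ?X ?Y) (-1) (?a \<ominus>\<^bsub>?K (-1)\<^esub> ?b) = \<zero>\<^bsub>?K (-1 + 1)\<^esub>"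
      using s0 by (simp add: K0.r_neg K0.minus_eq)
    then have "?a \<ominus>\<^bsub>?K (-1)\<^esub> ?b \<in> coboundaries (cpx Q ?X ?Y) (-1)"
      using a b by (intro acyclic[OF e]) auto
    then show "?a \<oplus>\<^bsub>?K (-1)\<^esub> signed (?K (-1)) (-1) ?b \<in> coboundaries (cpx Q ?X ?Y) (-1)"
      by (simp add: signed_def K.minus_eq)
  qed auto
  then show ?thesis unfolding coboundaries_def by force
qed

end

section \<open>Differences of bimodule maps\<close>

lemma bar_map_complex_add: "\<phi> \<oplus>\<^bsub>grade bar_map_complex l\<^esub> \<psi> =
    (\<lambda>X\<in>Ob C. \<lambda>Y\<in>Ob C. \<lambda>n. \<lambda>b\<in>carrier (bar_module R C X Y n).
      \<phi> X Y n b \<oplus>\<^bsub>grade (cpx Q X Y) (n + l)\<^esub> \<psi> X Y n b)"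
  by (simp add: bimodule_map_complex_def module_of_def)

lemma bar_maps_closed: "\<phi> \<in> bar_maps l \<Longrightarrow> X \<in> Ob C \<Longrightarrow> Y \<in> Ob C \<Longrightarrow>
    b \<in> carrier (bar_module R C X Y n) \<Longrightarrow> \<phi> X Y n b \<in> carrier (grade (cpx Q X Y) (n + l))"
  by (rule module_hom_in[OF bar_map_hom[OF bar_maps_bar_map]])

lemma bar_maps_add_closed:
  "\<phi> \<in> bar_maps l \<Longrightarrow> \<psi> \<in> bar_maps l \<Longrightarrow> \<phi> \<oplus>\<^bsub>grade bar_map_complex l\<^esub> \<psi> \<in> bar_maps l"
  unfolding bar_map_complex_add
  by (rule bar_mapsI[OF bar_map_add[OF bar_maps_bar_map bar_maps_bar_map]])

lemma bar_maps_uminus_closed: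
  assumes "\<phi> \<in> bar_maps l"
  shows "(\<lambda>X\<in>Ob C. \<lambda>Y\<in>Ob C. \<lambda>n. \<lambda>b\<in>carrier (bar_module R C X Y n).
      \<ominus>\<^bsub>grade (cpx Q X Y) (n + l)\<^esub> \<phi> X Y n b) \<in> bar_maps l"
  using bar_mapsI[OF bar_map_signed[OF bar_maps_bar_map[OF assms], where k=1]]
  by (simp add: signed_def)

text \<open>Homotopy is phrased with subtraction in the complex of maps. Additive inverses there are
  given by a description, so the difference can be computed pointwise only after the group laws are
  established.\<close>

lemma bar_map_complex_abelian_group: "abelian_group (grade bar_map_complex l)"
proof (rule abelian_groupI)
  note am = module.axioms(2)[OF grade_module, THEN abelian_group.axioms(1)]
  show "\<phi> \<oplus>\<^bsub>grade bar_map_complex l\<^esub> \<psi> \<in> carrier (grade bar_map_complex l)"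
    if "\<phi> \<in> carrier (grade bar_map_complex l)" "\<psi> \<in> carrier (grade bar_map_complex l)" for \<phi> \<psi>
    using that bar_maps_add_closed by simp
  show "\<zero>\<^bsub>grade bar_map_complex l\<^esub> \<in> carrier (grade bar_map_complex l)"
    by (simp add: bar_map_complex_zero_closed)
  show "\<phi> \<oplus>\<^bsub>grade bar_map_complex l\<^esub> \<psi> \<oplus>\<^bsub>grade bar_map_complex l\<^esub> \<chi> =
      \<phi> \<oplus>\<^bsub>grade bar_map_complex l\<^esub> (\<psi> \<oplus>\<^bsub>grade bar_map_complex l\<^esub> \<chi>)"
    if "\<phi> \<in> carrier (grade bar_map_complex l)" "\<psi> \<in> carrier (grade bar_map_complex l)"
      "\<chi> \<in> carrier (grade bar_map_complex l)" for \<phi> \<psi> \<chi>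
    using that unfolding bar_map_complex_add
    by (auto intro!: restrict_ext ext abelian_monoid.a_assoc[OF am] simp: bar_maps_closed restrict_def)
  show "\<phi> \<oplus>\<^bsub>grade bar_map_complex l\<^esub> \<psi> = \<psi> \<oplus>\<^bsub>grade bar_map_complex l\<^esub> \<phi>"
    if "\<phi> \<in> carrier (grade bar_map_complex l)" "\<psi> \<in> carrier (grade bar_map_complex l)" for \<phi> \<psi>
    using that unfolding bar_map_complex_add
    by (auto intro!: restrict_ext ext abelian_monoid.a_comm[OF am] simp: bar_maps_closed restrict_def)
  show "\<zero>\<^bsub>grade bar_map_complex l\<^esub> \<oplus>\<^bsub>grade bar_map_complex l\<^esub> \<phi> = \<phi>"
    if "\<phi> \<in> carrier (grade bar_map_complex l)" for \<phi>
    using that unfolding bar_map_complex_add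
    by (intro bar_maps_eqI) (simp_all add: bar_map_complex_zero abelian_monoid.l_zero[OF am] bar_maps_closed)
  show "\<exists>\<psi>\<in>carrier (grade bar_map_complex l). \<psi> \<oplus>\<^bsub>grade bar_map_complex l\<^esub> \<phi> = \<zero>\<^bsub>grade bar_map_complex l\<^esub>"
    if "\<phi> \<in> carrier (grade bar_map_complex l)" for \<phi>
    using that bar_maps_uminus_closed[of \<phi> l] abelian_group.l_neg[OF module.axioms(2)[OF grade_module]]
    by (intro bexI[of _ "\<lambda>X\<in>Ob C. \<lambda>Y\<in>Ob C. \<lambda>n. \<lambda>b\<in>carrier (bar_module R C X Y n).
      \<ominus>\<^bsub>grade (cpx Q X Y) (n + l)\<^esub> \<phi> X Y n b"])
      (auto simp: bar_map_complex_add bar_map_complex_zero bar_maps_closed restrict_def intro!: ext)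
qed

lemma bar_maps_minus:
  assumes \<phi>: "\<phi> \<in> bar_maps l" and \<psi>: "\<psi> \<in> bar_maps l"
  shows "\<phi> \<ominus>\<^bsub>grade bar_map_complex l\<^esub> \<psi> \<in> bar_maps l"
    and "X \<in> Ob C \<Longrightarrow> Y \<in> Ob C \<Longrightarrow> b \<in> carrier (bar_module R C X Y n) \<Longrightarrow>
      (\<phi> \<ominus>\<^bsub>grade bar_map_complex l\<^esub> \<psi>) X Y n b = \<phi> X Y n b \<ominus>\<^bsub>grade (cpx Q X Y) (n + l)\<^esub> \<psi> X Y n b"
proof -
  interpret G: abelian_group "grade bar_map_complex l" by (rule bar_map_complex_abelian_group)
  \<comment> \<open>The pointwise negative; uniqueness of inverses identifies it with the one of the
    group.\<close>
  let ?N = "\<lambda>X\<in>Ob C. \<lambda>Y\<in>Ob C. \<lambda>n. \<lambda>b\<in>carrier (bar_module R C X Y n).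
      \<ominus>\<^bsub>grade (cpx Q X Y) (n + l)\<^esub> \<psi> X Y n b"
  show "\<phi> \<ominus>\<^bsub>grade bar_map_complex l\<^esub> \<psi> \<in> bar_maps l"
    using G.minus_closed[of \<phi> \<psi>] \<phi> \<psi> by simp
  have "?N \<oplus>\<^bsub>grade bar_map_complex l\<^esub> \<psi> = \<zero>\<^bsub>grade bar_map_complex l\<^esub>"
    using \<psi> abelian_group.l_neg[OF module.axioms(2)[OF grade_module]]
    by (auto simp: bar_map_complex_add bar_map_complex_zero bar_maps_closed restrict_def intro!: ext)
  then have "\<ominus>\<^bsub>grade bar_map_complex l\<^esub> \<psi> = ?N"
    using \<psi> bar_maps_uminus_closed[OF \<psi>] by (intro G.minus_equality) simp_all
  then show "X \<in> Ob C \<Longrightarrow> Y \<in> Ob C \<Longrightarrow> b \<in> carrier (bar_module R C X Y n) \<Longrightarrow>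
      (\<phi> \<ominus>\<^bsub>grade bar_map_complex l\<^esub> \<psi>) X Y n b = \<phi> X Y n b \<ominus>\<^bsub>grade (cpx Q X Y) (n + l)\<^esub> \<psi> X Y n b"
    by (simp add: G.minus_eq bar_map_complex_add a_minus_def)
qed

text \<open>In degree 0, being closed means commuting with the two differentials, and pointwise
  differences inherit this.\<close>

lemma closed_bar_maps_minus:
  assumes "\<phi> \<in> carrier (cocycles bar_map_complex 0)" "\<psi> \<in> carrier (cocycles bar_map_complex 0)"
  shows "\<phi> \<ominus>\<^bsub>grade bar_map_complex 0\<^esub> \<psi> \<in> carrier (cocycles bar_map_complex 0)"
proof -
  have m: "\<phi> \<in> bar_maps 0" "\<psi> \<in> bar_maps 0"
    and d: "diff bar_map_complex 0 \<phi> = \<zero>\<^bsub>grade bar_map_complex 1\<^esub>"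
      "diff bar_map_complex 0 \<psi> = \<zero>\<^bsub>grade bar_map_complex 1\<^esub>"
    using assms by (auto simp: cocycles_def)
  have comm: "diff (cpx Q X Y) n (\<chi> X Y n b) = \<chi> X Y (n + 1) (bar_diff R C X Y n b)"
    if \<chi>: "\<chi> \<in> bar_maps 0" "diff bar_map_complex 0 \<chi> = \<zero>\<^bsub>grade bar_map_complex 1\<^esub>"
      and X: "X \<in> Ob C" "Y \<in> Ob C" and b: "b \<in> carrier (bar_module R C X Y n)" for \<chi> X Y n b
  proof (rule module_minus_eq_zeroD[OF grade_module[OF X, of "n + 1"]])
    show "diff (cpx Q X Y) n (\<chi> X Y n b) \<in> carrier (grade (cpx Q X Y) (n + 1))"
      using bar_maps_closed[OF \<chi>(1) X b] by (intro module_hom_in[OF diff_hom[OF X]]) simp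
    show "\<chi> X Y (n + 1) (bar_diff R C X Y n b) \<in> carrier (grade (cpx Q X Y) (n + 1))"
      using bar_maps_closed[OF \<chi>(1) X module_hom_in[OF bar_diff(1)[OF X] b]] by simp
    have "diff bar_map_complex 0 \<chi> X Y n b = \<zero>\<^bsub>grade bar_map_complex 1\<^esub> X Y n b"
      unfolding \<chi>(2) ..
    then show "diff (cpx Q X Y) n (\<chi> X Y n b) \<ominus>\<^bsub>grade (cpx Q X Y) (n + 1)\<^esub>
        \<chi> X Y (n + 1) (bar_diff R C X Y n b) = \<zero>\<^bsub>grade (cpx Q X Y) (n + 1)\<^esub>"
      using X b by (simp add: bar_map_complex_diff bar_map_complex_zero signed_def)
  qed
  let ?\<delta> = "\<phi> \<ominus>\<^bsub>grade bar_map_complex 0\<^esub> \<psi>"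
  have "diff bar_map_complex 0 ?\<delta> = \<zero>\<^bsub>grade bar_map_complex 1\<^esub>"
    unfolding bar_map_complex_diff
  proof (rule bar_maps_eqI[OF bar_map_complex_zero_closed])
    fix X Y n b assume X: "X \<in> Ob C" "Y \<in> Ob C" and b: "b \<in> carrier (bar_module R C X Y n)"
    note db = module_hom_in[OF bar_diff(1)[OF X] b]
    interpret K: module R "grade (cpx Q X Y) (n + 1)" by (rule grade_module[OF X])
    have c: "\<chi> X Y n b \<in> carrier (grade (cpx Q X Y) n)"
      "\<chi> X Y (n + 1) (bar_diff R C X Y n b) \<in> carrier (grade (cpx Q X Y) (n + 1))"
      if "\<chi> \<in> bar_maps 0" for \<chi>
      using bar_maps_closed[OF that X b] bar_maps_closed[OF that X db] by simp_all
    have "diff (cpx Q X Y) n (?\<delta> X Y n b) = ?\<delta> X Y (n + 1) (bar_diff R C X Y n b)"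
      using bar_maps_minus(2)[OF m X b] bar_maps_minus(2)[OF m X db]
        module_hom_minus[OF grade_module[OF X] grade_module[OF X] diff_hom[OF X] c(1)[OF m(1)] c(1)[OF m(2)]]
        comm[OF m(1) d(1) X b] comm[OF m(2) d(2) X b] by simp
    then show "diff (cpx Q X Y) (n + 0) (?\<delta> X Y n b) \<ominus>\<^bsub>grade (cpx Q X Y) (n + 0 + 1)\<^esub>
        signed (grade (cpx Q X Y) (n + 0 + 1)) 0 (?\<delta> X Y (n + 1) (bar_diff R C X Y n b)) =
        \<zero>\<^bsub>grade bar_map_complex 1\<^esub> X Y n b"
      using X b c(2)[OF bar_maps_minus(1)[OF m]]
      by (simp add: signed_def bar_map_complex_zero K.minus_eq K.r_neg)
  qed
  then show ?thesis using bar_maps_minus(1)[OF m] by (simp add: cocycles_def)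
qed

end

section \<open>Complexes over a linear category\<close>

lemma direct_product_simps:
  "carrier (direct_product M) = {x. \<forall>i. x i \<in> carrier (M i)}"
  "\<zero>\<^bsub>direct_product M\<^esub> = (\<lambda>i. \<zero>\<^bsub>M i\<^esub>)"
  "x \<oplus>\<^bsub>direct_product M\<^esub> y = (\<lambda>i. x i \<oplus>\<^bsub>M i\<^esub> y i)"
  "a \<odot>\<^bsub>direct_product M\<^esub> x = (\<lambda>i. a \<odot>\<^bsub>M i\<^esub> x i)"
  by (simp_all add: direct_product_def module_of_def)

lemma module_direct_product:
  assumes "cring R" and m: "\<And>i. module R (M i)"
  shows "module R (direct_product M)"
proof -
  have ag: "abelian_group (M i)" for i using m[of i] by (rule module.axioms(2))
  note am = abelian_group.axioms(1)[OF ag]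
  show ?thesis
    unfolding direct_product_def
  proof (rule module_ofI[OF assms(1)], goal_cases)
    case (4 x y)
    then show ?case by (auto intro!: ext abelian_monoid.a_comm[OF am])
  next
    case (6 x)
    then show ?case
      by (intro bexI[of _ "\<lambda>i. \<ominus>\<^bsub>M i\<^esub> x i"])
        (auto simp: abelian_group.l_neg[OF ag] abelian_group.a_inv_closed[OF ag])
  qed (auto intro!: ext simp: module.smult_closed[OF m] module.smult_l_distr[OF m] module.smult_r_distr[OF m]
      module.smult_assoc1[OF m] module.smult_one[OF m] abelian_monoid.a_closed[OF am]
      abelian_monoid.zero_closed[OF am] abelian_monoid.a_assoc[OF am] abelian_monoid.l_zero[OF am])
qed

lemma direct_product_homI:
  "(\<And>i. (\<lambda>x. h x i) \<in> module_hom R M (N i)) \<Longrightarrow> h \<in> module_hom R M (direct_product N)"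
  by (intro module_homI) (auto simp: direct_product_simps module_hom_def Pi_iff fun_eq_iff)

lemma direct_product_proj: "(\<lambda>x. x i) \<in> module_hom R (direct_product N) (N i)"
  by (intro module_homI) (auto simp: direct_product_simps)

context linear_category
begin

lemma comp_minus_right:
  assumes "X \<in> Ob C" "Y \<in> Ob C" "Z \<in> Ob C" "g \<in> carrier (Mor C Y Z)"
    "f \<in> carrier (Mor C X Y)" "f' \<in> carrier (Mor C X Y)"
  shows "Comp C X Y Z g (f \<ominus>\<^bsub>Mor C X Y\<^esub> signed (Mor C X Y) k f') =
    Comp C X Y Z g f \<ominus>\<^bsub>Mor C X Z\<^esub> signed (Mor C X Z) k (Comp C X Y Z g f')"
  using assms module_hom_minus[OF mor_module mor_module comp_linear_right]
    module_hom_signed[OF mor_module mor_module comp_linear_right] signed_closed[OF mor_module]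
  by simp

lemma comp_minus_left:
  assumes "X \<in> Ob C" "Y \<in> Ob C" "Z \<in> Ob C" "f \<in> carrier (Mor C X Y)"
    "g \<in> carrier (Mor C Y Z)" "g' \<in> carrier (Mor C Y Z)"
  shows "Comp C X Y Z (g \<ominus>\<^bsub>Mor C Y Z\<^esub> signed (Mor C Y Z) k g') f =
    Comp C X Y Z g f \<ominus>\<^bsub>Mor C X Z\<^esub> signed (Mor C X Z) k (Comp C X Y Z g' f)"
  using assms module_hom_minus[OF mor_module mor_module comp_linear_left]
    module_hom_signed[OF mor_module mor_module comp_linear_left] signed_closed[OF mor_module]
  by simp

lemma complex_ob: "bounded_complex C X \<Longrightarrow> cobj X i \<in> Ob C"
  by (simp add: bounded_complex_def)

lemma complex_cdiff: "bounded_complex C X \<Longrightarrow> cdiff X i \<in> carrier (Mor C (cobj X i) (cobj X (i + 1)))"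
  by (simp add: bounded_complex_def)

lemma complex_cdiff_cdiff: "bounded_complex C X \<Longrightarrow>
    Comp C (cobj X i) (cobj X (i + 1)) (cobj X (i + 1 + 1)) (cdiff X (i + 1)) (cdiff X i) =
    \<zero>\<^bsub>Mor C (cobj X i) (cobj X (i + 1 + 1))\<^esub>"
  by (simp add: bounded_complex_def add.assoc)

lemma hom_grade: "grade (hom_complex C X Y) k = direct_product (\<lambda>i. Mor C (cobj X i) (cobj Y (i + k)))"
  by (simp add: hom_complex_def)

lemma hom_diff: "diff (hom_complex C X Y) k f i =
    Comp C (cobj X i) (cobj Y (i + k)) (cobj Y (i + k + 1)) (cdiff Y (i + k)) (f i)
      \<ominus>\<^bsub>Mor C (cobj X i) (cobj Y (i + k + 1))\<^esub>
    signed (Mor C (cobj X i) (cobj Y (i + k + 1))) k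
      (Comp C (cobj X i) (cobj X (i + 1)) (cobj Y (i + k + 1)) (f (i + 1)) (cdiff X i))"
  by (simp add: hom_complex_def)

lemma hom_closed_iff: "f \<in> carrier (grade (hom_complex C X Y) k) \<longleftrightarrow>
    (\<forall>i. f i \<in> carrier (Mor C (cobj X i) (cobj Y (i + k))))"
  by (simp add: hom_grade direct_product_simps)

lemma hom_proj: "(\<lambda>f. f i) \<in> module_hom R (grade (hom_complex C X Y) k) (Mor C (cobj X i) (cobj Y (i + k)))"
  unfolding hom_grade by (rule direct_product_proj)

lemma hom_homI: "(\<And>i. (\<lambda>x. h x i) \<in> module_hom R M (Mor C (cobj X i) (cobj Y (i + k)))) \<Longrightarrow>
    h \<in> module_hom R M (grade (hom_complex C X Y) k)"
  unfolding hom_grade by (rule direct_product_homI)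

context
  fixes X Y assumes X: "bounded_complex C X" and Y: "bounded_complex C Y"
begin

lemma hom_module: "module R (grade (hom_complex C X Y) k)"
  unfolding hom_grade
  by (rule module_direct_product[OF base_ring mor_module[OF complex_ob[OF X] complex_ob[OF Y]]])

lemma hom_diff_hom:
  "diff (hom_complex C X Y) k \<in> module_hom R (grade (hom_complex C X Y) k) (grade (hom_complex C X Y) (k + 1))"
proof (rule hom_homI)
  fix i
  let ?N = "Mor C (cobj X i) (cobj Y (i + k + 1))"
  note x = complex_ob[OF X] and y = complex_ob[OF Y]
  have N: "module R ?N" by (rule mor_module[OF x y])
  have 1: "(\<lambda>f. Comp C (cobj X i) (cobj Y (i + k)) (cobj Y (i + k + 1)) (cdiff Y (i + k)) (f i))
      \<in> module_hom R (grade (hom_complex C X Y) k) ?N"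
    by (rule module_hom_compose[OF hom_proj comp_linear_right[OF x y y complex_cdiff[OF Y]]])
  \<comment> \<open>The component at \<open>i + 1\<close> ends in degree \<open>i + 1 + k\<close>,
    which has to be rewritten to \<open>i + k + 1\<close>.\<close>
  have p: "(\<lambda>f. f (i + 1)) \<in> module_hom R (grade (hom_complex C X Y) k) (Mor C (cobj X (i + 1)) (cobj Y (i + k + 1)))"
    using hom_proj[of "i + 1" X Y k] by (simp add: add.assoc add.commute[of 1 k])
  have 2: "(\<lambda>f. signed ?N k (Comp C (cobj X i) (cobj X (i + 1)) (cobj Y (i + k + 1)) (f (i + 1)) (cdiff X i)))
      \<in> module_hom R (grade (hom_complex C X Y) k) ?N"
    by (rule module_hom_compose[OF module_hom_compose[OF p comp_linear_left[OF x x y complex_cdiff[OF X]]]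
          signed_hom[OF N]])
  show "(\<lambda>f. diff (hom_complex C X Y) k f i)
      \<in> module_hom R (grade (hom_complex C X Y) k) (Mor C (cobj X i) (cobj Y (i + (k + 1))))"
    using module_hom_difference[OF hom_module N 1 2] by (simp only: hom_diff add.assoc)
qed

lemma hom_diff_diff:
  assumes f: "f \<in> carrier (grade (hom_complex C X Y) k)"
  shows "diff (hom_complex C X Y) (k + 1) (diff (hom_complex C X Y) k f) = \<zero>\<^bsub>grade (hom_complex C X Y) (k + 1 + 1)\<^esub>"
proof
  fix i
  \<comment> \<open>Target degrees that are equal as integers have to become identical terms; all
    are expressed as shifts of \<open>j\<close>.\<close>
  define j where "j = i + k"
  have eq: "i + k = j" "i + (k + 1) = j + 1" "i + 1 + k = j + 1" "i + (k + 1 + 1) = j + 1 + 1"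
    by (auto simp: j_def)
  note x = complex_ob[OF X] and y = complex_ob[OF Y]
  note a = complex_cdiff[OF X] and b = complex_cdiff[OF Y]
  have fc: "f i \<in> carrier (Mor C (cobj X i) (cobj Y j))"
    "f (i + 1) \<in> carrier (Mor C (cobj X (i + 1)) (cobj Y (j + 1)))"
    "f (i + 1 + 1) \<in> carrier (Mor C (cobj X (i + 1 + 1)) (cobj Y (j + 1 + 1)))"
    using f[unfolded hom_closed_iff, rule_format, of i] f[unfolded hom_closed_iff, rule_format, of "i + 1"]
      f[unfolded hom_closed_iff, rule_format, of "i + 1 + 1"] by (simp_all add: j_def algebra_simps)
  let ?N = "Mor C (cobj X i) (cobj Y (j + 1 + 1))"
  let ?z = "Comp C (cobj X i) (cobj X (i + 1)) (cobj Y (j + 1 + 1))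
      (Comp C (cobj X (i + 1)) (cobj Y (j + 1)) (cobj Y (j + 1 + 1)) (cdiff Y (j + 1)) (f (i + 1))) (cdiff X i)"
  have z: "?z \<in> carrier ?N" by (intro comp_closed x y a b fc)
  have "diff (hom_complex C X Y) (k + 1) (diff (hom_complex C X Y) k f) i =
      (Comp C (cobj X i) (cobj Y (j + 1)) (cobj Y (j + 1 + 1)) (cdiff Y (j + 1))
        (Comp C (cobj X i) (cobj Y j) (cobj Y (j + 1)) (cdiff Y j) (f i)) \<ominus>\<^bsub>?N\<^esub>
       signed ?N k (Comp C (cobj X i) (cobj Y (j + 1)) (cobj Y (j + 1 + 1)) (cdiff Y (j + 1))
        (Comp C (cobj X i) (cobj X (i + 1)) (cobj Y (j + 1)) (f (i + 1)) (cdiff X i))))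
      \<ominus>\<^bsub>?N\<^esub> signed ?N (k + 1)
      (?z \<ominus>\<^bsub>?N\<^esub> signed ?N k (Comp C (cobj X i) (cobj X (i + 1)) (cobj Y (j + 1 + 1))
        (Comp C (cobj X (i + 1)) (cobj X (i + 1 + 1)) (cobj Y (j + 1 + 1)) (f (i + 1 + 1)) (cdiff X (i + 1)))
        (cdiff X i)))"
    unfolding hom_diff eq
    by (simp only: comp_minus_right[OF x y y b comp_closed[OF x y y fc(1) b] comp_closed[OF x x y a fc(2)]]
        comp_minus_left[OF x x y a comp_closed[OF x y y fc(2) b] comp_closed[OF x x y a fc(3)]])
  \<comment> \<open>The two pure terms vanish since the differentials of \<open>Y\<close> and
    \<open>X\<close> square to zero. The mixed terms agree by associativity and carry opposite
    signs.\<close>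
  also have "Comp C (cobj X i) (cobj Y (j + 1)) (cobj Y (j + 1 + 1)) (cdiff Y (j + 1))
        (Comp C (cobj X i) (cobj Y j) (cobj Y (j + 1)) (cdiff Y j) (f i)) = \<zero>\<^bsub>?N\<^esub>"
    unfolding comp_assoc[OF x y y y fc(1) b b, symmetric] complex_cdiff_cdiff[OF Y]
    by (rule module_hom_zero[OF mor_module mor_module comp_linear_left[OF x y y fc(1)]]) (rule x y)+
  also have "Comp C (cobj X i) (cobj X (i + 1)) (cobj Y (j + 1 + 1))
        (Comp C (cobj X (i + 1)) (cobj X (i + 1 + 1)) (cobj Y (j + 1 + 1)) (f (i + 1 + 1)) (cdiff X (i + 1)))
        (cdiff X i) = \<zero>\<^bsub>?N\<^esub>"
    unfolding comp_assoc[OF x x x y a a fc(3)] complex_cdiff_cdiff[OF X]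
    by (rule module_hom_zero[OF mor_module mor_module comp_linear_right[OF x x y fc(3)]]) (rule x y)+
  also have "Comp C (cobj X i) (cobj Y (j + 1)) (cobj Y (j + 1 + 1)) (cdiff Y (j + 1))
        (Comp C (cobj X i) (cobj X (i + 1)) (cobj Y (j + 1)) (f (i + 1)) (cdiff X i)) = ?z"
    by (rule comp_assoc[OF x x y y a fc(2) b, symmetric])
  also have "(\<zero>\<^bsub>?N\<^esub> \<ominus>\<^bsub>?N\<^esub> signed ?N k ?z) \<ominus>\<^bsub>?N\<^esub> signed ?N (k + 1) (?z \<ominus>\<^bsub>?N\<^esub> signed ?N k \<zero>\<^bsub>?N\<^esub>) = \<zero>\<^bsub>?N\<^esub>"
    by (rule signed_cancel[OF mor_module[OF x y] z])
  finally show "diff (hom_complex C X Y) (k + 1) (diff (hom_complex C X Y) k f) i =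
      \<zero>\<^bsub>grade (hom_complex C X Y) (k + 1 + 1)\<^esub> i"
    by (simp only: hom_grade direct_product_simps eq)
qed

text \<open>This is where cocycles of degree 0 become ordinary chain maps, the form used in all
  later computations.\<close>

lemma chain_map:
  assumes "u \<in> carrier (cocycles (hom_complex C X Y) 0)"
  shows "u i \<in> carrier (Mor C (cobj X i) (cobj Y i))"
    and "Comp C (cobj X i) (cobj Y i) (cobj Y (i + 1)) (cdiff Y i) (u i) =
      Comp C (cobj X i) (cobj X (i + 1)) (cobj Y (i + 1)) (u (i + 1)) (cdiff X i)"
proof -
  note x = complex_ob[OF X] and y = complex_ob[OF Y]
  show c: "u i \<in> carrier (Mor C (cobj X i) (cobj Y i))" for i
    using assms hom_closed_iff[of u X Y 0] by (simp add: cocycles_def)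
  have "diff (hom_complex C X Y) 0 u i = \<zero>\<^bsub>grade (hom_complex C X Y) 1\<^esub> i"
    using assms by (simp add: cocycles_def)
  then have "Comp C (cobj X i) (cobj Y i) (cobj Y (i + 1)) (cdiff Y i) (u i) \<ominus>\<^bsub>Mor C (cobj X i) (cobj Y (i + 1))\<^esub>
      Comp C (cobj X i) (cobj X (i + 1)) (cobj Y (i + 1)) (u (i + 1)) (cdiff X i) =
      \<zero>\<^bsub>Mor C (cobj X i) (cobj Y (i + 1))\<^esub>"
    by (simp add: hom_diff hom_grade direct_product_simps signed_def)
  then show "Comp C (cobj X i) (cobj Y i) (cobj Y (i + 1)) (cdiff Y i) (u i) =
      Comp C (cobj X i) (cobj X (i + 1)) (cobj Y (i + 1)) (u (i + 1)) (cdiff X i)"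
    by (rule module_minus_eq_zeroD[OF mor_module[OF x y] comp_closed[OF x y y c complex_cdiff[OF Y]]
          comp_closed[OF x x y complex_cdiff[OF X] c]])
qed

end

section \<open>Composition with chain maps\<close>

lemma hom_comp_post: "hom_comp C X Y Z 0 k g f =
    (\<lambda>i. Comp C (cobj X i) (cobj Y (i + k)) (cobj Z (i + k)) (g (i + k)) (f i))"
  by (simp add: hom_comp_def)

lemma hom_comp_pre: "hom_comp C X Y Z k 0 g f =
    (\<lambda>i. Comp C (cobj X i) (cobj Y i) (cobj Z (i + k)) (g i) (f i))"
  by (simp add: hom_comp_def)

lemma hom_comp_post_hom:
  assumes X: "bounded_complex C X" and Y: "bounded_complex C Y" and Z: "bounded_complex C Z"
    and u: "u \<in> carrier (cocycles (hom_complex C Y Z) 0)"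
  shows "hom_comp C X Y Z 0 k u \<in> module_hom R (grade (hom_complex C X Y) k) (grade (hom_complex C X Z) k)"
  unfolding hom_comp_post
  by (rule hom_homI, rule module_hom_compose[OF hom_proj])
    (rule comp_linear_right[OF complex_ob[OF X] complex_ob[OF Y] complex_ob[OF Z] chain_map(1)[OF Y Z u]])

lemma hom_comp_pre_hom:
  assumes X: "bounded_complex C X" and Y: "bounded_complex C Y" and Z: "bounded_complex C Z"
    and u: "u \<in> carrier (cocycles (hom_complex C X Y) 0)"
  shows "(\<lambda>f. hom_comp C X Y Z k 0 f u) \<in> module_hom R (grade (hom_complex C Y Z) k) (grade (hom_complex C X Z) k)"
  unfolding hom_comp_pre
  by (rule hom_homI, rule module_hom_compose[OF hom_proj])
    (rule comp_linear_left[OF complex_ob[OF X] complex_ob[OF Y] complex_ob[OF Z] chain_map(1)[OF X Y u]])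

lemma hom_diff_post:
  assumes X: "bounded_complex C X" and Y: "bounded_complex C Y" and Z: "bounded_complex C Z"
    and u: "u \<in> carrier (cocycles (hom_complex C Y Z) 0)" and f: "f \<in> carrier (grade (hom_complex C X Y) k)"
  shows "diff (hom_complex C X Z) k (hom_comp C X Y Z 0 k u f) =
    hom_comp C X Y Z 0 (k + 1) u (diff (hom_complex C X Y) k f)"
proof
  fix i
  define j where "j = i + k"
  have eq: "i + k = j" "i + (k + 1) = j + 1" "i + 1 + k = j + 1" by (auto simp: j_def)
  note x = complex_ob[OF X] and y = complex_ob[OF Y] and z = complex_ob[OF Z]
  note a = complex_cdiff[OF X] and b = complex_cdiff[OF Y] and c = complex_cdiff[OF Z]
  note uc = chain_map[OF Y Z u]
  have fc: "f i \<in> carrier (Mor C (cobj X i) (cobj Y j))"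
    "f (i + 1) \<in> carrier (Mor C (cobj X (i + 1)) (cobj Y (j + 1)))"
    using f[unfolded hom_closed_iff, rule_format, of i] f[unfolded hom_closed_iff, rule_format, of "i + 1"]
    by (simp_all add: j_def algebra_simps)
  show "diff (hom_complex C X Z) k (hom_comp C X Y Z 0 k u f) i =
    hom_comp C X Y Z 0 (k + 1) u (diff (hom_complex C X Y) k f) i"
    unfolding hom_diff hom_comp_post eq
    \<comment> \<open>After associativity both sides differ only in whether the differential is
      applied before or after \<open>u\<close>, and \<open>uc(2)\<close> exchanges the two.\<close>
    unfolding comp_minus_right[OF x y z uc(1) comp_closed[OF x y y fc(1) b] comp_closed[OF x x y a fc(2)]]
      comp_assoc[OF x y z z fc(1) uc(1) c, symmetric] comp_assoc[OF x x y z a fc(2) uc(1)] uc(2)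
      comp_assoc[OF x y y z fc(1) b uc(1)] ..
qed

lemma hom_diff_pre:
  assumes X: "bounded_complex C X" and Y: "bounded_complex C Y" and Z: "bounded_complex C Z"
    and u: "u \<in> carrier (cocycles (hom_complex C X Y) 0)" and f: "f \<in> carrier (grade (hom_complex C Y Z) k)"
  shows "diff (hom_complex C X Z) k (hom_comp C X Y Z k 0 f u) =
    hom_comp C X Y Z (k + 1) 0 (diff (hom_complex C Y Z) k f) u"
proof
  fix i
  define j where "j = i + k"
  have eq: "i + k = j" "i + (k + 1) = j + 1" "i + 1 + k = j + 1" by (auto simp: j_def)
  note x = complex_ob[OF X] and y = complex_ob[OF Y] and z = complex_ob[OF Z]
  note a = complex_cdiff[OF X] and b = complex_cdiff[OF Y] and c = complex_cdiff[OF Z]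
  note uc = chain_map[OF X Y u]
  have fc: "f i \<in> carrier (Mor C (cobj Y i) (cobj Z j))"
    "f (i + 1) \<in> carrier (Mor C (cobj Y (i + 1)) (cobj Z (j + 1)))"
    using f[unfolded hom_closed_iff, rule_format, of i] f[unfolded hom_closed_iff, rule_format, of "i + 1"]
    by (simp_all add: j_def algebra_simps)
  show "diff (hom_complex C X Z) k (hom_comp C X Y Z k 0 f u) i =
    hom_comp C X Y Z (k + 1) 0 (diff (hom_complex C Y Z) k f) u i"
    unfolding hom_diff hom_comp_pre eq
    unfolding comp_minus_left[OF x y z uc(1) comp_closed[OF y z z fc(1) c] comp_closed[OF y y z b fc(2)]]
      comp_assoc[OF x y z z uc(1) fc(1) c] comp_assoc[OF x x y z a uc(1) fc(2)] uc(2)[symmetric]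
      comp_assoc[OF x y y z uc(1) b fc(2)] ..
qed

end

section \<open>The bimodule of a pair of dg functors\<close>

lemma chain_category_simps:
  "Ob (chain_category B) = {X. bounded_complex B X}"
  "Mor (chain_category B) X Y = cocycles (hom_complex B X Y) 0"
  "Comp (chain_category B) X Y Z = hom_comp B X Y Z 0 0"
  "Ident (chain_category B) X = hom_ident B X"
  by (simp_all add: chain_category_def)

lemma dg_functorD:
  assumes "dg_functor R A B F"
  shows "X \<in> Ob A \<Longrightarrow> bounded_complex B (fobj F X)"
    and "X \<in> Ob A \<Longrightarrow> Y \<in> Ob A \<Longrightarrow>
      fmor F X Y \<in> module_hom R (Mor A X Y) (cocycles (hom_complex B (fobj F X) (fobj F Y)) 0)"
    and "X \<in> Ob A \<Longrightarrow> Y \<in> Ob A \<Longrightarrow> Z \<in> Ob A \<Longrightarrow> f \<in> carrier (Mor A X Y) \<Longrightarrow> g \<in> carrier (Mor A Y Z) \<Longrightarrow>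
      fmor F X Z (Comp A X Y Z g f) i =
      Comp B (cobj (fobj F X) i) (cobj (fobj F Y) i) (cobj (fobj F Z) i) (fmor F Y Z g i) (fmor F X Y f i)"
    and "X \<in> Ob A \<Longrightarrow> fmor F X X (Ident A X) i = Ident B (cobj (fobj F X) i)"
  using assms unfolding dg_functor_def is_linear_functor_def chain_category_simps
  by (auto simp: hom_comp_def hom_ident_def)

lemma hom_bimodule_simps:
  "cpx (hom_bimodule B F G) X X' = hom_complex B (fobj F X') (fobj G X)"
  "act (hom_bimodule B F G) X Z X' Z' n a m b =
    hom_comp B (fobj F Z') (fobj G X) (fobj G Z) 0 n (fmor G X Z a)
      (hom_comp B (fobj F Z') (fobj F X') (fobj G X) n 0 m (fmor F Z' X' b))"
  by (simp_all add: hom_bimodule_def)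

text \<open>The action composes with the chain maps \<open>G f\<close> and \<open>F g\<close>, so
  the axioms reduce to functoriality, to associativity in each component, and to the compatibility
  of such compositions with differentials.\<close>

lemma (in linear_category) hom_bimodule_dg_bimodule:
  assumes A: "linear_category R A" and F: "dg_functor R A C F" and G: "dg_functor R A C G"
  shows "dg_bimodule R A (hom_bimodule C F G)"
proof (intro dg_bimodule.intro[OF A] dg_bimodule_axioms.intro, unfold hom_bimodule_simps)
  interpret A: linear_category R A by (rule A)
  note FO = dg_functorD(1)[OF F] and GO = dg_functorD(1)[OF G]
  note Fm = module_hom_in[OF dg_functorD(2)[OF F]] and Gm = module_hom_in[OF dg_functorD(2)[OF G]]
  note ob = complex_ob[OF FO] complex_ob[OF GO]
  have Fi: "fmor F X Y f i \<in> carrier (Mor C (cobj (fobj F X) i) (cobj (fobj F Y) i))"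
    and Gi: "fmor G X Y f i \<in> carrier (Mor C (cobj (fobj G X) i) (cobj (fobj G Y) i))"
    if "X \<in> Ob A" "Y \<in> Ob A" "f \<in> carrier (Mor A X Y)" for X Y f i
    using chain_map(1)[OF FO FO Fm] chain_map(1)[OF GO GO Gm] that by blast+
  \<comment> \<open>Used with \<open>G\<close> for linearity of the action in the left argument and
    with \<open>F\<close> in the right one.\<close>
  have proj: "(\<lambda>f. fmor H X Y f i) \<in> module_hom R (Mor A X Y) (Mor C (cobj (fobj H X) i) (cobj (fobj H Y) i))"
    if H: "dg_functor R A C H" and X: "X \<in> Ob A" "Y \<in> Ob A" for H X Y i
    using module_hom_compose[OF cocycles_hom[OF dg_functorD(2)[OF H X]] hom_proj, of i] by simp
  fix X X' X'' Y Y' Y'' n f f' q g g'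
  assume X: "X \<in> Ob A" and Y: "Y \<in> Ob A"
  show "module R (grade (hom_complex C (fobj F Y) (fobj G X)) n)"
    by (rule hom_module[OF FO[OF Y] GO[OF X]])
  show "diff (hom_complex C (fobj F Y) (fobj G X)) n \<in> module_hom R
      (grade (hom_complex C (fobj F Y) (fobj G X)) n) (grade (hom_complex C (fobj F Y) (fobj G X)) (n + 1))"
    by (rule hom_diff_hom[OF FO[OF Y] GO[OF X]])
  note act_simps = hom_comp_post hom_comp_pre
  {
    assume q: "q \<in> carrier (grade (hom_complex C (fobj F Y) (fobj G X)) n)"
    have qi: "q i \<in> carrier (Mor C (cobj (fobj F Y) i) (cobj (fobj G X) (i + n)))" for i
      using q by (simp add: hom_closed_iff)
    show "diff (hom_complex C (fobj F Y) (fobj G X)) (n + 1) (diff (hom_complex C (fobj F Y) (fobj G X)) n q) =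
        \<zero>\<^bsub>grade (hom_complex C (fobj F Y) (fobj G X)) (n + 1 + 1)\<^esub>"
      by (rule hom_diff_diff[OF FO[OF Y] GO[OF X] q])
    show "hom_comp C (fobj F Y) (fobj G X) (fobj G X) 0 n (fmor G X X (Ident A X))
        (hom_comp C (fobj F Y) (fobj F Y) (fobj G X) n 0 q (fmor F Y Y (Ident A Y))) = q"
      using X Y qi ob
      by (simp add: act_simps dg_functorD(4)[OF F] dg_functorD(4)[OF G] comp_ident_left comp_ident_right)
    assume X': "X' \<in> Ob A" and Y': "Y' \<in> Ob A"
    note o = complex_ob[OF FO[OF Y]] complex_ob[OF FO[OF Y']] complex_ob[OF GO[OF X]] complex_ob[OF GO[OF X']]
    {
      assume g: "g \<in> carrier (Mor A Y' Y)"
      show "(\<lambda>f. hom_comp C (fobj F Y') (fobj G X) (fobj G X') 0 n (fmor G X X' f)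
          (hom_comp C (fobj F Y') (fobj F Y) (fobj G X) n 0 q (fmor F Y' Y g)))
          \<in> module_hom R (Mor A X X') (grade (hom_complex C (fobj F Y') (fobj G X')) n)"
        unfolding act_simps
        by (rule hom_homI, rule module_hom_compose[OF proj[OF G X X']])
          (rule comp_linear_left[OF o(2,3,4) comp_closed[OF o(2,1,3) Fi[OF Y' Y g] qi]])
      assume f: "f \<in> carrier (Mor A X X')"
      have pre: "hom_comp C (fobj F Y') (fobj F Y) (fobj G X) n 0 q (fmor F Y' Y g)
          \<in> carrier (grade (hom_complex C (fobj F Y') (fobj G X)) n)"
        by (rule module_hom_in[OF hom_comp_pre_hom[OF FO[OF Y'] FO[OF Y] GO[OF X] Fm[OF Y' Y g]] q])
      show "diff (hom_complex C (fobj F Y') (fobj G X')) n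
          (hom_comp C (fobj F Y') (fobj G X) (fobj G X') 0 n (fmor G X X' f)
            (hom_comp C (fobj F Y') (fobj F Y) (fobj G X) n 0 q (fmor F Y' Y g))) =
          hom_comp C (fobj F Y') (fobj G X) (fobj G X') 0 (n + 1) (fmor G X X' f)
            (hom_comp C (fobj F Y') (fobj F Y) (fobj G X) (n + 1) 0
              (diff (hom_complex C (fobj F Y) (fobj G X)) n q) (fmor F Y' Y g))"
        by (simp only: hom_diff_post[OF FO[OF Y'] GO[OF X] GO[OF X'] Gm[OF X X' f] pre]
            hom_diff_pre[OF FO[OF Y'] FO[OF Y] GO[OF X] Fm[OF Y' Y g] q])
      assume X'': "X'' \<in> Ob A" and Y'': "Y'' \<in> Ob A"
        and f': "f' \<in> carrier (Mor A X' X'')" and g': "g' \<in> carrier (Mor A Y'' Y')"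
      note o' = complex_ob[OF FO[OF Y'']] complex_ob[OF GO[OF X'']]
      show "hom_comp C (fobj F Y'') (fobj G X') (fobj G X'') 0 n (fmor G X' X'' f')
          (hom_comp C (fobj F Y'') (fobj F Y') (fobj G X') n 0
            (hom_comp C (fobj F Y') (fobj G X) (fobj G X') 0 n (fmor G X X' f)
              (hom_comp C (fobj F Y') (fobj F Y) (fobj G X) n 0 q (fmor F Y' Y g))) (fmor F Y'' Y' g')) =
          hom_comp C (fobj F Y'') (fobj G X) (fobj G X'') 0 n (fmor G X X'' (Comp A X X' X'' f' f))
            (hom_comp C (fobj F Y'') (fobj F Y) (fobj G X) n 0 q (fmor F Y'' Y (Comp A Y'' Y' Y g g')))"
        unfolding act_simps
        by (rule ext)
          (simp only: dg_functorD(3)[OF F Y'' Y' Y g' g] dg_functorD(3)[OF G X X' X'' f f']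
            comp_assoc[OF o'(1) o(2,1,3) Fi[OF Y'' Y' g'] Fi[OF Y' Y g] qi]
            comp_assoc[OF o'(1) o(2,3,4) Fi[OF Y'' Y' g'] comp_closed[OF o(2,1,3) Fi[OF Y' Y g] qi] Gi[OF X X' f]]
            comp_assoc[OF o'(1) o(3,4) o'(2) comp_closed[OF o'(1) o(1,3) comp_closed[OF o'(1) o(2,1) Fi[OF Y'' Y' g'] Fi[OF Y' Y g]] qi] Gi[OF X X' f] Gi[OF X' X'' f']])
    }
    assume f: "f \<in> carrier (Mor A X X')"
    show "(\<lambda>g. hom_comp C (fobj F Y') (fobj G X) (fobj G X') 0 n (fmor G X X' f)
        (hom_comp C (fobj F Y') (fobj F Y) (fobj G X) n 0 q (fmor F Y' Y g)))
        \<in> module_hom R (Mor A Y' Y) (grade (hom_complex C (fobj F Y') (fobj G X')) n)"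
      unfolding act_simps
      by (rule hom_homI, rule module_hom_compose[OF module_hom_compose[OF proj[OF F Y' Y]
            comp_linear_right[OF o(2,1,3) qi]] comp_linear_right[OF o(2,3,4) Gi[OF X X' f]]])
  }
  assume X': "X' \<in> Ob A" and Y': "Y' \<in> Ob A" and f: "f \<in> carrier (Mor A X X')" and g: "g \<in> carrier (Mor A Y' Y)"
  show "(\<lambda>q. hom_comp C (fobj F Y') (fobj G X) (fobj G X') 0 n (fmor G X X' f)
      (hom_comp C (fobj F Y') (fobj F Y) (fobj G X) n 0 q (fmor F Y' Y g)))
      \<in> module_hom R (grade (hom_complex C (fobj F Y) (fobj G X)) n) (grade (hom_complex C (fobj F Y') (fobj G X')) n)"
    by (rule module_hom_compose[OF hom_comp_pre_hom[OF FO[OF Y'] FO[OF Y] GO[OF X] Fm[OF Y' Y g]]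
          hom_comp_post_hom[OF FO[OF Y'] GO[OF X] GO[OF X'] Gm[OF X X' f]]])
qed

section \<open>Cohomology classes\<close>

lemma coh_class_iff: "y \<in> coh_class K n x \<longleftrightarrow> (\<exists>b\<in>coboundaries K n. y = b \<oplus>\<^bsub>grade K n\<^esub> x)"
  by (simp add: coh_class_def a_r_coset_def' cocycles_def)

lemma cohomology_carrier: "carrier (cohomology K n) = coh_class K n ` carrier (cocycles K n)"
  by (auto simp: cohomology_def quotient_module_def module_of_def A_RCOSETS_def' coh_class_def)

lemma cohomology_zero: "\<zero>\<^bsub>cohomology K n\<^esub> = coboundaries K n"
  by (simp add: cohomology_def quotient_module_def module_of_def)

context
  fixes R :: "'k ring" and K :: "('k, 'e) mod_complex" and n :: int
  assumes m: "\<And>n. module R (grade K n)"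
    and d: "\<And>n. diff K n \<in> module_hom R (grade K n) (grade K (n + 1))"
begin

lemma coboundaries_closed: "b \<in> coboundaries K n \<Longrightarrow> b \<in> carrier (grade K n)"
  using module_hom_in[OF d, of _ "n - 1"] by (auto simp: coboundaries_def)

lemma coboundaries_zero: "\<zero>\<^bsub>grade K n\<^esub> \<in> coboundaries K n"
proof -
  interpret M: module R "grade K (n - 1)" by (rule m)
  show ?thesis
    using module_hom_zero[OF m m d, of "n - 1"] by (force simp: coboundaries_def)
qed

lemma coboundaries_add:
  "b \<in> coboundaries K n \<Longrightarrow> c \<in> coboundaries K n \<Longrightarrow> b \<oplus>\<^bsub>grade K n\<^esub> c \<in> coboundaries K n"
proof -
  interpret M: module R "grade K (n - 1)" by (rule m)
  assume "b \<in> coboundaries K n" "c \<in> coboundaries K n"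
  then obtain x y where "x \<in> carrier (grade K (n - 1))" "y \<in> carrier (grade K (n - 1))"
    "b = diff K (n - 1) x" "c = diff K (n - 1) y"
    by (auto simp: coboundaries_def)
  then show ?thesis
    using module_hom_add[OF d, of x "n - 1" y] unfolding coboundaries_def
    by (intro image_eqI[of _ _ "x \<oplus>\<^bsub>grade K (n - 1)\<^esub> y"]) simp_all
qed

lemma coboundaries_minus:
  "b \<in> coboundaries K n \<Longrightarrow> c \<in> coboundaries K n \<Longrightarrow> b \<ominus>\<^bsub>grade K n\<^esub> c \<in> coboundaries K n"
proof -
  interpret M: module R "grade K (n - 1)" by (rule m)
  assume "b \<in> coboundaries K n" "c \<in> coboundaries K n"
  then obtain x y where "x \<in> carrier (grade K (n - 1))" "y \<in> carrier (grade K (n - 1))"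
    "b = diff K (n - 1) x" "c = diff K (n - 1) y"
    by (auto simp: coboundaries_def)
  then show ?thesis
    using module_hom_minus[OF m m d, of x "n - 1" y] unfolding coboundaries_def
    by (intro image_eqI[of _ _ "x \<ominus>\<^bsub>grade K (n - 1)\<^esub> y"]) simp_all
qed

lemma coh_class_self: "x \<in> carrier (grade K n) \<Longrightarrow> x \<in> coh_class K n x"
proof -
  interpret M: module R "grade K n" by (rule m)
  show "x \<in> carrier (grade K n) \<Longrightarrow> x \<in> coh_class K n x"
    using coboundaries_zero by (force simp: coh_class_iff)
qed

lemma coh_class_eqD:
  assumes "x \<in> carrier (grade K n)" "y \<in> carrier (grade K n)" "coh_class K n x = coh_class K n y"
  shows "x \<ominus>\<^bsub>grade K n\<^esub> y \<in> coboundaries K n"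
proof -
  interpret M: module R "grade K n" by (rule m)
  obtain b where b: "b \<in> coboundaries K n" "x = b \<oplus>\<^bsub>grade K n\<^esub> y"
    using coh_class_self[OF assms(1)] assms(3) by (auto simp: coh_class_iff)
  then have "x \<ominus>\<^bsub>grade K n\<^esub> y = b"
    using coboundaries_closed[OF b(1)] assms(2) by (simp add: M.minus_eq M.a_assoc M.r_neg)
  then show ?thesis using b(1) by simp
qed

text \<open>A class contains its representative, and the zero class is the set of coboundaries
  itself.\<close>

lemma trivial_cohomology:
  assumes "carrier (cohomology K n) = {\<zero>\<^bsub>cohomology K n\<^esub>}"
    and "x \<in> carrier (grade K n)" "diff K n x = \<zero>\<^bsub>grade K (n + 1)\<^esub>"
  shows "x \<in> coboundaries K n"
proof -
  have "x \<in> carrier (cocycles K n)" using assms(2,3) by (simp add: cocycles_def)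
  then have "coh_class K n x = coboundaries K n"
    using assms(1) unfolding cohomology_carrier cohomology_zero by auto
  then show ?thesis using coh_class_self[OF assms(2)] by simp
qed

end

context linear_category
begin

text \<open>Composition in \<open>homotopy_category\<close> is a union over all representatives, so
  arbitrary ones must be compared with fixed ones. For \<open>g = d k + g0\<close> and
  \<open>f = d h + f0\<close> the difference is
  \<open>(d k) f + g0 (d h) = d (k f) + d (g0 h)\<close>, as \<open>f\<close> and \<open>g0\<close>
  are cocycles.\<close>

lemma hom_comp_class:
  assumes X: "bounded_complex C X" and Y: "bounded_complex C Y" and Z: "bounded_complex C Z"
    and f0: "f0 \<in> carrier (cocycles (hom_complex C X Y) 0)" and g0: "g0 \<in> carrier (cocycles (hom_complex C Y Z) 0)"
    and f: "f \<in> coh_class (hom_complex C X Y) 0 f0" and g: "g \<in> coh_class (hom_complex C Y Z) 0 g0"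
  shows "hom_comp C X Y Z 0 0 g f \<ominus>\<^bsub>grade (hom_complex C X Z) 0\<^esub> hom_comp C X Y Z 0 0 g0 f0
    \<in> coboundaries (hom_complex C X Z) 0"
    and "hom_comp C X Y Z 0 0 g f \<in> carrier (grade (hom_complex C X Z) 0)"
proof -
  let ?XY = "hom_complex C X Y" and ?YZ = "hom_complex C Y Z" and ?XZ = "hom_complex C X Z"
  let ?c = "hom_comp C X Y Z 0 0"
  note mXY = hom_module[OF X Y] and mXZ = hom_module[OF X Z]
  interpret M: module R "grade ?XZ 0" by (rule mXZ)
  have fc0: "f0 \<in> carrier (grade ?XY 0)" and gc0: "g0 \<in> carrier (grade ?YZ 0)"
    using f0 g0 by (auto simp: cocycles_def)
  obtain h where h: "h \<in> carrier (grade ?XY (-1))" "f = diff ?XY (-1) h \<oplus>\<^bsub>grade ?XY 0\<^esub> f0"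
    using f by (auto simp: coh_class_iff coboundaries_def)
  obtain k where k: "k \<in> carrier (grade ?YZ (-1))" "g = diff ?YZ (-1) k \<oplus>\<^bsub>grade ?YZ 0\<^esub> g0"
    using g by (auto simp: coh_class_iff coboundaries_def)
  have dh: "diff ?XY (-1) h \<in> carrier (grade ?XY 0)"
    using module_hom_in[OF hom_diff_hom[OF X Y] h(1)] by simp
  have dk: "diff ?YZ (-1) k \<in> carrier (grade ?YZ 0)"
    using module_hom_in[OF hom_diff_hom[OF Y Z] k(1)] by simp
  have dhc: "diff ?XY (-1) h \<in> carrier (cocycles ?XY 0)"
    using dh hom_diff_diff[OF X Y h(1)] by (simp add: cocycles_def)
  have fcyc: "f \<in> carrier (cocycles ?XY 0)"
  proof -
    interpret M0: module R "grade ?XY 0" by (rule mXY)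
    interpret M1: module R "grade ?XY 1" by (rule mXY)
    show ?thesis
      using module_hom_add[OF hom_diff_hom[OF X Y] dh fc0] dh fc0 dhc f0 by (simp add: cocycles_def h(2))
  qed
  note pre = hom_comp_pre_hom[OF X Y Z fcyc] and post = hom_comp_post_hom[OF X Y Z g0]
  have 1: "?c g f = ?c (diff ?YZ (-1) k) f \<oplus>\<^bsub>grade ?XZ 0\<^esub> ?c g0 f"
    unfolding k(2) by (rule module_hom_add[OF pre dk gc0])
  have 2: "?c g0 f = ?c g0 (diff ?XY (-1) h) \<oplus>\<^bsub>grade ?XZ 0\<^esub> ?c g0 f0"
    unfolding h(2) by (rule module_hom_add[OF post dh fc0])
  have a: "?c (diff ?YZ (-1) k) f = diff ?XZ (-1) (hom_comp C X Y Z (-1) 0 k f)"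
    using hom_diff_pre[OF X Y Z fcyc k(1)] by simp
  have b: "?c g0 (diff ?XY (-1) h) = diff ?XZ (-1) (hom_comp C X Y Z 0 (-1) g0 h)"
    using hom_diff_post[OF X Y Z g0 h(1)] by simp
  have A: "?c (diff ?YZ (-1) k) f \<in> coboundaries ?XZ 0"
    unfolding a using module_hom_in[OF pre k(1)] by (simp add: coboundaries_def)
  have B: "?c g0 (diff ?XY (-1) h) \<in> coboundaries ?XZ 0"
    unfolding b using module_hom_in[OF post h(1)] by (simp add: coboundaries_def)
  note cl = coboundaries_closed[OF mXZ hom_diff_hom[OF X Z]]
  have c0: "?c g0 f0 \<in> carrier (grade ?XZ 0)" by (rule module_hom_in[OF post fc0])
  have "?c g f \<ominus>\<^bsub>grade ?XZ 0\<^esub> ?c g0 f0 = ?c (diff ?YZ (-1) k) f \<oplus>\<^bsub>grade ?XZ 0\<^esub> ?c g0 (diff ?XY (-1) h)"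
    unfolding 1 2 using cl[OF A] cl[OF B] c0 by (simp add: M.minus_eq M.a_assoc M.r_neg)
  then show "?c g f \<ominus>\<^bsub>grade ?XZ 0\<^esub> ?c g0 f0 \<in> coboundaries ?XZ 0"
    using coboundaries_add[OF mXZ hom_diff_hom[OF X Z] A B] by simp
  show "?c g f \<in> carrier (grade ?XZ 0)"
    unfolding 1 2 using cl[OF A] cl[OF B] c0 by simp
qed

end

theorem theorem4p7:
  fixes R :: "'k ring"
    and A :: "('a, 'k, 'f) lin_cat"
    and B :: "('b, 'k, 'g) lin_cat"
    and F G :: "('a, 'f, ('b, 'g) cochain, int \<Rightarrow> 'g) lin_functor"
  assumes "cring R"
    and "linear_category R A"
    and "linear_category R B"
    and "\<And>X Y. X \<in> Ob A \<Longrightarrow> Y \<in> Ob A \<Longrightarrow> projective_module R (Mor A X Y)"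
    and "dg_functor R A B F"
    and "dg_functor R A B G"
    and "unobstructed A B F G"
  shows "\<forall>\<eta>. natural_transformation A (homotopy_category B) (H0_functor B F) (H0_functor B G) \<eta> \<longrightarrow>
           (\<exists>\<tau>. closed_A_inf_transformation R A B F G \<tau> \<and> extends_transformation R A B F G \<tau> \<eta>) \<and>
           (\<forall>\<tau> \<tau>'.
              closed_A_inf_transformation R A B F G \<tau> \<and> extends_transformation R A B F G \<tau> \<eta> \<and>
              closed_A_inf_transformation R A B F G \<tau>' \<and> extends_transformation R A B F G \<tau>' \<eta> \<longrightarrow>
              A_inf_homotopic R A B F G \<tau> \<tau>')"
proof -
  interpret A: linear_category R A by fact
  interpret B: linear_category R B by fact
  let ?Q = "hom_bimodule B F G"
  interpret Q: dg_bimodule R A ?Q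
    by (rule B.hom_bimodule_dg_bimodule[OF assms(2,5,6)])
  note FO = dg_functorD(1)[OF assms(5)] and GO = dg_functorD(1)[OF assms(6)]
  note Fm = module_hom_in[OF dg_functorD(2)[OF assms(5)]] and Gm = module_hom_in[OF dg_functorD(2)[OF assms(6)]]
  let ?K = "\<lambda>X Y. hom_complex B (fobj F Y) (fobj G X)"
  have m: "module R (grade (?K X Y) n)" if "X \<in> Ob A" "Y \<in> Ob A" for X Y n
    by (rule B.hom_module[OF FO[OF that(2)] GO[OF that(1)]])
  have d: "diff (?K X Y) n \<in> module_hom R (grade (?K X Y) n) (grade (?K X Y) (n + 1))"
    if "X \<in> Ob A" "Y \<in> Ob A" for X Y n
    by (rule B.hom_diff_hom[OF FO[OF that(2)] GO[OF that(1)]])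
  have cpx: "cpx ?Q X Y = ?K X Y" for X Y by (rule hom_bimodule_simps)
  \<comment> \<open>The bimodule at \<open>(X, Y)\<close> is the hom complex from \<open>F Y\<close>
    to \<open>G X\<close>, which matches the order of objects in
    \<open>unobstructed\<close>.\<close>
  have acyclic: "q \<in> coboundaries (cpx ?Q X Y) k"
    if X: "X \<in> Ob A" "Y \<in> Ob A" and k: "k < 0" and q: "q \<in> carrier (grade (cpx ?Q X Y) k)"
      "diff (cpx ?Q X Y) k q = \<zero>\<^bsub>grade (cpx ?Q X Y) (k + 1)\<^esub>" for X Y k q
    unfolding cpx
  proof (rule trivial_cohomology[OF m[OF X] d[OF X] _ q[unfolded cpx]])
    show "carrier (cohomology (?K X Y) k) = {\<zero>\<^bsub>cohomology (?K X Y) k\<^esub>}"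
      using assms(7) X k by (simp add: unobstructed_def Let_def)
  qed
  have gen: "bar_elem R A X X 0 [X] [Ident A X, Ident A X] = Q.bar_gen 0 [X] []" for X
    by (simp add: Q.bar_gen_0)
  have cocyc: "\<tau> X X 0 (Q.bar_gen 0 [X] []) \<in> carrier (grade (?K X X) 0)"
    if "\<tau> \<in> carrier (cocycles Q.bar_map_complex 0)" "X \<in> Ob A" for \<tau> X
    using Q.bar_maps_closed[of \<tau> 0 X X _ 0] Q.bar_gen_closed[of "[X]" 0 "[]"] that
    by (simp add: cocycles_def cpx Q.bar_index_0)
  show ?thesis
  proof (intro allI impI conjI)
    fix \<eta> assume \<eta>: "natural_transformation A (homotopy_category B) (H0_functor B F) (H0_functor B G) \<eta>"
    have "\<eta> X \<in> coh_class (?K X X) 0 ` carrier (cocycles (?K X X) 0)" if "X \<in> Ob A" for X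
      using \<eta> that
      by (simp add: natural_transformation_def homotopy_category_def H0_functor_def cohomology_carrier)
    then have "\<exists>e\<in>carrier (cocycles (?K X X) 0). \<eta> X = coh_class (?K X X) 0 e" if "X \<in> Ob A" for X
      using that by (simp add: image_iff)
    \<comment> \<open>Chain maps representing \<eta>, chosen independently for each object; they are
      natural only up to homotopy.\<close>
    then obtain e where e: "\<And>X. X \<in> Ob A \<Longrightarrow> e X \<in> carrier (cocycles (?K X X) 0)"
      and \<eta>e: "\<And>X. X \<in> Ob A \<Longrightarrow> \<eta> X = coh_class (?K X X) 0 (e X)"
      by metis
    have ec: "e X \<in> carrier (grade (?K X X) 0)" if "X \<in> Ob A" for X
      using e[OF that] by (simp add: cocycles_def)
    have nat: "act ?Q Y X Y Y 0 f (e Y) (Ident A Y) \<ominus>\<^bsub>grade (cpx ?Q X Y) 0\<^esub>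
        act ?Q X X X Y 0 (Ident A X) (e X) f \<in> coboundaries (cpx ?Q X Y) 0"
      if X: "X \<in> Ob A" and Y: "Y \<in> Ob A" and f: "f \<in> carrier (Mor A Y X)" for X Y f
    proof -
      let ?l = "hom_comp B (fobj F Y) (fobj G Y) (fobj G X) 0 0 (fmor G Y X f) (e Y)"
      let ?r = "hom_comp B (fobj F Y) (fobj F X) (fobj G X) 0 0 (e X) (fmor F Y X f)"
      interpret M: module R "grade (?K X Y) 0" by (rule m[OF X Y])
      have l: "act ?Q Y X Y Y 0 f (e Y) (Ident A Y) = ?l"
        using B.chain_map(1)[OF FO[OF Y] GO[OF Y] e[OF Y]] B.complex_ob[OF FO[OF Y]] B.complex_ob[OF GO[OF Y]]
        by (simp add: hom_bimodule_simps B.hom_comp_pre B.hom_comp_post dg_functorD(4)[OF assms(5) Y]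
            B.comp_ident_right)
      have r: "act ?Q X X X Y 0 (Ident A X) (e X) f = ?r"
        using B.chain_map(1)[OF FO[OF X] GO[OF X] e[OF X]] B.chain_map(1)[OF FO[OF Y] FO[OF X] Fm[OF Y X f]]
          B.complex_ob[OF FO[OF Y]] B.complex_ob[OF FO[OF X]] B.complex_ob[OF GO[OF X]]
        by (simp add: hom_bimodule_simps B.hom_comp_pre B.hom_comp_post dg_functorD(4)[OF assms(6) X]
            B.comp_ident_left B.comp_closed)
      have lc: "?l \<in> carrier (grade (?K X Y) 0)"
        by (rule module_hom_in[OF B.hom_comp_post_hom[OF FO[OF Y] GO[OF Y] GO[OF X] Gm[OF Y X f]] ec[OF Y]])
      have rc: "?r \<in> carrier (grade (?K X Y) 0)"
        by (rule module_hom_in[OF B.hom_comp_pre_hom[OF FO[OF Y] FO[OF X] GO[OF X] Fm[OF Y X f]] ec[OF X]])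
      \<comment> \<open>Naturality of \<eta> equates two unions over representatives. The composite
        \<open>?r\<close> lies in the left one, hence in the class of some composite of
        representatives on the right.\<close>
      have "(\<Union>g\<in>\<eta> X. \<Union>h\<in>coh_class (hom_complex B (fobj F Y) (fobj F X)) 0 (fmor F Y X f).
            coh_class (?K X Y) 0 (hom_comp B (fobj F Y) (fobj F X) (fobj G X) 0 0 g h)) =
          (\<Union>g\<in>coh_class (hom_complex B (fobj G Y) (fobj G X)) 0 (fmor G Y X f). \<Union>h\<in>\<eta> Y.
            coh_class (?K X Y) 0 (hom_comp B (fobj F Y) (fobj G Y) (fobj G X) 0 0 g h))"
        using \<eta> X Y f by (simp add: natural_transformation_def homotopy_category_def H0_functor_def)
      moreover have "e X \<in> \<eta> X"
        unfolding \<eta>e[OF X] by (rule coh_class_self[OF m[OF X X] d[OF X X] ec[OF X]])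
      moreover have "fmor F Y X f \<in> coh_class (hom_complex B (fobj F Y) (fobj F X)) 0 (fmor F Y X f)"
        using Fm[OF Y X f]
        by (intro coh_class_self[OF B.hom_module[OF FO[OF Y] FO[OF X]] B.hom_diff_hom[OF FO[OF Y] FO[OF X]]])
          (simp add: cocycles_def)
      moreover have "?r \<in> coh_class (?K X Y) 0 ?r"
        by (rule coh_class_self[OF m[OF X Y] d[OF X Y] rc])
      ultimately obtain g h where g: "g \<in> coh_class (hom_complex B (fobj G Y) (fobj G X)) 0 (fmor G Y X f)"
        and h: "h \<in> \<eta> Y" and "?r \<in> coh_class (?K X Y) 0 (hom_comp B (fobj F Y) (fobj G Y) (fobj G X) 0 0 g h)"
        by blast
      then obtain b where b: "b \<in> coboundaries (?K X Y) 0"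
        "?r = b \<oplus>\<^bsub>grade (?K X Y) 0\<^esub> hom_comp B (fobj F Y) (fobj G Y) (fobj G X) 0 0 g h"
        by (auto simp: coh_class_iff)
      define s where "s = hom_comp B (fobj F Y) (fobj G Y) (fobj G X) 0 0 g h"
      \<comment> \<open>Returning from these unknown representatives to \<open>fmor G Y X f\<close>
        and \<open>e Y\<close> changes the composite by a coboundary.\<close>
      have s: "s \<ominus>\<^bsub>grade (?K X Y) 0\<^esub> ?l \<in> coboundaries (?K X Y) 0"
        unfolding s_def
        by (rule B.hom_comp_class(1)[OF FO[OF Y] GO[OF Y] GO[OF X] e[OF Y] Gm[OF Y X f] h[unfolded \<eta>e[OF Y]] g])
      note cl = coboundaries_closed[OF m[OF X Y] d[OF X Y]]
      have sc: "s \<in> carrier (grade (?K X Y) 0)"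
        unfolding s_def
        by (rule B.hom_comp_class(2)[OF FO[OF Y] GO[OF Y] GO[OF X] e[OF Y] Gm[OF Y X f] h[unfolded \<eta>e[OF Y]] g])
      \<comment> \<open>From \<open>?r = b + s\<close>, the difference \<open>?l - ?r\<close> is
        \<open>-(s - ?l) - b\<close>, a combination of two coboundaries.\<close>
      have "?l \<ominus>\<^bsub>grade (?K X Y) 0\<^esub> ?r =
          (\<zero>\<^bsub>grade (?K X Y) 0\<^esub> \<ominus>\<^bsub>grade (?K X Y) 0\<^esub> (s \<ominus>\<^bsub>grade (?K X Y) 0\<^esub> ?l)) \<ominus>\<^bsub>grade (?K X Y) 0\<^esub> b"
        unfolding b(2) s_def[symmetric] using cl[OF b(1)] sc lc
        by (simp add: M.minus_eq M.minus_add M.a_ac)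
      then show ?thesis
        unfolding l r cpx
        using coboundaries_minus[OF m[OF X Y] d[OF X Y] coboundaries_minus[OF m[OF X Y] d[OF X Y]
              coboundaries_zero[OF m[OF X Y] d[OF X Y]] s] b(1)]
        by (simp only:)
    qed
    show "\<exists>\<tau>. closed_A_inf_transformation R A B F G \<tau> \<and> extends_transformation R A B F G \<tau> \<eta>"
    proof -
      have e': "\<And>X. X \<in> Ob A \<Longrightarrow> e X \<in> carrier (cocycles (cpx ?Q X X) 0)"
        unfolding cpx by (rule e)
      have "\<exists>\<tau>\<in>carrier (cocycles Q.bar_map_complex 0). \<forall>X\<in>Ob A. \<tau> X X 0 (Q.bar_gen 0 [X] []) = e X"
        by (rule Q.closed_bar_map_exists) (fact assms(4) acyclic e' nat)+
      then show ?thesis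
        using \<eta>e by (auto simp: closed_A_inf_transformation_def extends_transformation_def A_inf_complex_def gen)
    qed
    fix \<tau> \<tau>'
    assume "closed_A_inf_transformation R A B F G \<tau> \<and> extends_transformation R A B F G \<tau> \<eta> \<and>
      closed_A_inf_transformation R A B F G \<tau>' \<and> extends_transformation R A B F G \<tau>' \<eta>"
    then have \<tau>: "\<tau> \<in> carrier (cocycles Q.bar_map_complex 0)" and \<tau>': "\<tau>' \<in> carrier (cocycles Q.bar_map_complex 0)"
      and eq: "\<And>X. X \<in> Ob A \<Longrightarrow> coh_class (?K X X) 0 (\<tau> X X 0 (Q.bar_gen 0 [X] [])) =
        coh_class (?K X X) 0 (\<tau>' X X 0 (Q.bar_gen 0 [X] []))"
      by (simp_all add: closed_A_inf_transformation_def extends_transformation_def A_inf_complex_def gen)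
    \<comment> \<open>The difference is closed, and on [id, id] it is exact because both values
      represent the same class of \<eta>.\<close>
    have "\<tau> \<ominus>\<^bsub>grade Q.bar_map_complex 0\<^esub> \<tau>' \<in> coboundaries Q.bar_map_complex 0"
    proof (rule Q.closed_bar_map_coboundary)
      fix X assume X: "X \<in> Ob A"
      have "Q.bar_gen 0 [X] [] \<in> carrier (bar_module R A X X 0)"
        using Q.bar_gen_closed[of "[X]" 0 "[]"] X by (simp add: Q.bar_index_0)
      then have "(\<tau> \<ominus>\<^bsub>grade Q.bar_map_complex 0\<^esub> \<tau>') X X 0 (Q.bar_gen 0 [X] []) =
          \<tau> X X 0 (Q.bar_gen 0 [X] []) \<ominus>\<^bsub>grade (?K X X) 0\<^esub> \<tau>' X X 0 (Q.bar_gen 0 [X] [])"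
        using Q.bar_maps_minus(2)[of \<tau> 0 \<tau>' X X _ 0] \<tau> \<tau>' X by (simp add: cocycles_def cpx)
      then show "(\<tau> \<ominus>\<^bsub>grade Q.bar_map_complex 0\<^esub> \<tau>') X X 0 (Q.bar_gen 0 [X] []) \<in> coboundaries (cpx ?Q X X) 0"
        using coh_class_eqD[OF m[OF X X] d[OF X X] cocyc[OF \<tau> X] cocyc[OF \<tau>' X] eq[OF X]] by (simp add: cpx)
    qed (fact assms(4) acyclic Q.closed_bar_maps_minus[OF \<tau> \<tau>'])+
    then show "A_inf_homotopic R A B F G \<tau> \<tau>'"
      by (simp add: A_inf_homotopic_def A_inf_complex_def)
  qed
qed

end
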